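(* Consider the polling model and standing assumptions described in the context. Let $\hat\rho=\sum_{i=1}^N\lambda_i(\tau_i-\tilde\tau_i)$, and let $F=(F_1,\ldots,F_N)$ and $\bar\tau$ denote the solution of the linear system $$\sum_{j\in\mathcal S}F_j=1,\qquad F_j=\sum_{i\in\mathcal S}\tilde p_{i,j}F_i+\bar\tau\sum_{i\in\mathcal S}\lambda_i(p_{i,j}-\tilde p_{i,j})\ \ (j\in\mathcal S),\qquad \bar\tau=\frac1{1-\hat\rho}\sum_{j\in\mathcal S}F_j\tilde\tau_j .$$ Assume that $$\hat\rho<1,\qquad \lambda_i\bar\tau<F_i\ \text{ for all }i\in\mathcal S,$$ and that for any ergodic face $\Lambda\subset\mathcal S$, $$f_i(\vec v^{\,\Lambda})\equiv\frac{\lambda_i\sum_{j=1}^N\pi^\Lambda(j)\tilde\tau_j}{1-\hat\rho}-\pi^\Lambda(i)<0\quad\text{for all } i\in\Lambda .$$ Then $\mathcal L$ is ergodic. In particular, when $P=\widetilde P$, the conditions $\hat\rho<1$ and $\lambda_i\bar\tau<F_i$ for all $i\in\mathcal S$ are necessary and sufficient for $\mathcal L$ to be ergodic.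
   Context: Polling model. Let $\mathcal S=\{1,\ldots,N\}$ be the set of stations and let $P=(p_{i,j})_{i,j\in\mathcal S}$ and $\widetilde P=(\tilde p_{i,j})_{i,j\in\mathcal S}$ be stochastic matrices. For each $i,j$, $(B_{i,j}(n))_n$ and $(\widetilde B_{i,j}(n))_n$ are sequences of random vectors in $\mathbb Z_+^N$ with finite means, i.i.d. in $n$; the components $B_{i,j;q}(n)$, $q\in\mathcal S$, of each vector may be dependent and have different laws. The process $\mathcal L=(S(n),X(n))_{n\ge 0}$, with $S(n)\in\mathcal S$ (position of the server at polling instant $n$) and $X(n)\in\mathbb Z_+^N$ (queue lengths at polling instant $n$), is the Markov chain (random walk) on $\mathcal S\times\mathbb Z_+^N$ with the following dynamics. Given the past up to $n$ with $S(n)=i$: - if $X_i(n)>0$, then $S(n+1)=j$ with probability $p_{i,j}$, and in that case $X(n+1)=X(n)-\vec e_i+B_{i,j}(n)$; - if $X_i(n)=0$, then $S(n+1)=j$ with probability $\tilde p_{i,j}$, and in that case $X(n+1)=X(n)+\widetilde B_{i,j}(n)$. Here $\vec e_i$ is the $i$-th canonical basis vector, and the routing choices and the vectors $B_{i,j}(n),\widetilde B_{i,j}(n)$ are independent of each other and of the past up to $n$. The chain $\mathcal L$ is assumed irreducible. Mean values. It is assumed that $\sum_{j=1}^N p_{i,j}\,\mathbb E B_{i,j;q}(n)=\lambda_q\tau_i$ and $\sum_{j=1}^N\tilde p_{i,j}\,\mathbb E\widetilde B_{i,j;q}(n)=\lambda_q\tilde\tau_i$ for all $i,q\in\mathcal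 S$. Here $\lambda_q$ is the mean number of arrivals at station $q$ per unit of time, and $\tau_i\ge0$ (resp. $\tilde\tau_i\ge0$) is the mean time between a polling instant at which the server finds station $i$ nonempty (resp. empty) and the next polling instant. Faces and induced chains. A face is a subset $\Lambda\subset\mathcal S$. The induced chain $\mathcal L^\Lambda$ is the Markov chain describing the same polling system when the queues in $\Lambda$ are kept saturated (always nonempty). Its state is $(s,x)$ with $s\in\mathcal S$ and $x=(x_i)_{i\notin\Lambda}\in\mathbb Z_+^{\mathcal S\setminus\Lambda}$. From $(s,x)$, if $s\in\Lambda$ or $x_s>0$, it moves with probability $p_{s,t}$ to station $t$, with $x$ increased by the restriction of $B_{s,t}$ to $\mathcal S\setminus\Lambda$ and decreased by $\vec e_s$ if $s\notin\Lambda$. If $s\notin\Lambda$ and $x_s=0$, it moves with probability $\tilde p_{s,t}$ to station $t$, with $x$ increased by the restriction of $\widetilde B_{s,t}$ to $\mathcal S\setminus\Lambda$. Thus $\mathcal L^\emptyset=\mathcal L$. A face $\Lambda$ is called ergodic if $\mathcal L^\Lambda$ is ergodic; $\Lambda=\mathcal S$ is ergodic by definition (there $\mathcal L^{\mathcal S}$ is the chain on $\mathcal S$ with transition matrix $P$). For an ergodic face, $\pi^\Lambda(s)$ and $\pi^\Lambda(s,x)$ denote the stationary probabilities of $\mathcal L^\Lambda$ that the server is at $s$, and of the state $(s,x)$, respectively. Second vector field. For an ergodic face $\Lambda$, the vector $\vec v^{\,\Lambda}\in\mathbb R^N$ has $v^\Lambda_i=0$ for $i\notin\Lambda$. For $i\in\Lambda$,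 $v^\Lambda_i$ is the mean drift of queue $i$ in the stationary regime of $\mathcal L^\Lambda$, namely $$v_i^\Lambda=\sum_{s,x}\pi^\Lambda(s,x)\bigl(\lambda_i\tau_s\mathbf 1_{\{s\in\Lambda\text{ or }x_s>0\}}+\lambda_i\tilde\tau_s\mathbf 1_{\{s\notin\Lambda,\,x_s=0\}}\bigr)-\pi^\Lambda(i).$$ For $\vec x\in\mathbb R^N$, $f_i(\vec x)=x_i+\dfrac{\lambda_i\sum_{j=1}^N x_j(\tau_j-\tilde\tau_j)}{1-\hat\rho}$. Standing assumptions: for every face $\Lambda$ the chain $\mathcal L^\Lambda$ is irreducible and aperiodic; for every ergodic face $\Lambda$ and every $i\in\Lambda$, $v_i^\Lambda\neq0$. *)

theory Defs
  imports "HOL-Probability.Probability"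
begin

text \<open>
  A Markov chain is given by its transition kernel \<open>K\<close>, a map from states to distributions of the
  next state, together with a state space \<open>E\<close> that is closed under \<open>K\<close>.
\<close>

primrec nsteps :: "('s \<Rightarrow> 's pmf) \<Rightarrow> nat \<Rightarrow> 's \<Rightarrow> 's pmf" where
  "nsteps K 0 x = return_pmf x"
| "nsteps K (Suc n) x = bind_pmf (K x) (nsteps K n)"

definition irreducible_chain :: "'s set \<Rightarrow> ('s \<Rightarrow> 's pmf) \<Rightarrow> bool" where
  "irreducible_chain E K \<longleftrightarrow> (\<forall>x\<in>E. \<forall>y\<in>E. \<exists>n. pmf (nsteps K n x) y > 0)"

definition aperiodic_chain :: "'s set \<Rightarrow> ('s \<Rightarrow> 's pmf) \<Rightarrow> bool" where
  "aperiodic_chain E K \<longleftrightarrow> (\<forall>x\<in>E. Gcd {n. n \<ge> 1 \<and> pmf (nsteps K n x) x > 0} = 1)"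

text \<open>
  \<open>first_passage K y n x\<close> is the probability that the chain started at \<open>x\<close> visits \<open>y\<close> for the first
  time after time 0 at time \<open>n + 1\<close>.
\<close>

primrec first_passage :: "('s \<Rightarrow> 's pmf) \<Rightarrow> 's \<Rightarrow> nat \<Rightarrow> 's \<Rightarrow> real" where
  "first_passage K y 0 x = pmf (K x) y"
| "first_passage K y (Suc n) x =
     measure_pmf.expectation (K x) (\<lambda>z. if z = y then 0 else first_passage K y n z)"

text \<open>The return time is almost surely finite and has finite mean.\<close>

definition positive_recurrent :: "('s \<Rightarrow> 's pmf) \<Rightarrow> 's \<Rightarrow> bool" where
  "positive_recurrent K x \<longleftrightarrow>
     (\<lambda>n. first_passage K x n x) sums 1 \<and>
     summable (\<lambda>n. real (n + 1) * first_passage K x n x)"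

definition ergodic_chain :: "'s set \<Rightarrow> ('s \<Rightarrow> 's pmf) \<Rightarrow> bool" where
  "ergodic_chain E K \<longleftrightarrow>
     irreducible_chain E K \<and> aperiodic_chain E K \<and> (\<forall>x\<in>E. positive_recurrent K x)"

text \<open>Only used for ergodic chains, which have exactly one stationary distribution.\<close>

definition stationary_pmf :: "'s set \<Rightarrow> ('s \<Rightarrow> 's pmf) \<Rightarrow> 's pmf" where
  "stationary_pmf E K = (THE \<mu>. set_pmf \<mu> \<subseteq> E \<and> bind_pmf \<mu> K = \<mu>)"

text \<open>
  The stations are the elements of a finite type \<open>'n\<close>. The rows of the stochastic matrices are the
  distributions \<open>P i\<close> and \<open>P' i\<close>, so \<open>p\<^sub>i\<^sub>,\<^sub>j = pmf (P i) j\<close>; \<open>B i j\<close> and \<open>B' i j\<close> are the laws of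
  the arrival vectors. Primed letters stand for the tilde quantities (server finds an empty queue).
\<close>

type_synonym 'n routing = "'n \<Rightarrow> 'n pmf"
type_synonym 'n arrivals = "'n \<Rightarrow> 'n \<Rightarrow> ('n \<Rightarrow> nat) pmf"

definition polling_kernel ::
  "'n routing \<Rightarrow> 'n routing \<Rightarrow> 'n arrivals \<Rightarrow> 'n arrivals \<Rightarrow>
   'n \<times> ('n \<Rightarrow> nat) \<Rightarrow> ('n \<times> ('n \<Rightarrow> nat)) pmf" where
  "polling_kernel P P' B B' = (\<lambda>(i, x).
     if x i > 0
     then bind_pmf (P i) (\<lambda>j. bind_pmf (B i j) (\<lambda>b.
            return_pmf (j, \<lambda>q. (if q = i then x q - 1 else x q) + b q)))
     else bind_pmf (P' i) (\<lambda>j. bind_pmf (B' i j) (\<lambda>b.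
            return_pmf (j, \<lambda>q. x q + b q))))"

text \<open>
  A vector indexed by the complement of a face \<open>L\<close> is represented by its extension by 0 to all
  stations. The zeros on \<open>L\<close> are a pure encoding: the queues in \<open>L\<close> count as nonempty.
\<close>

definition face_states :: "'n set \<Rightarrow> ('n \<times> ('n \<Rightarrow> nat)) set" where
  "face_states L = {(s, x). \<forall>i\<in>L. x i = 0}"

definition induced_kernel ::
  "'n routing \<Rightarrow> 'n routing \<Rightarrow> 'n arrivals \<Rightarrow> 'n arrivals \<Rightarrow> 'n set \<Rightarrow>
   'n \<times> ('n \<Rightarrow> nat) \<Rightarrow> ('n \<times> ('n \<Rightarrow> nat)) pmf" where
  "induced_kernel P P' B B' L = (\<lambda>(s, x).
     if s \<in> L \<or> x s > 0
     then bind_pmf (P s) (\<lambda>t. bind_pmf (B s t) (\<lambda>b.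
            return_pmf (t, \<lambda>q. if q \<in> L then 0 else (if q = s then x q - 1 else x q) + b q)))
     else bind_pmf (P' s) (\<lambda>t. bind_pmf (B' s t) (\<lambda>b.
            return_pmf (t, \<lambda>q. if q \<in> L then 0 else x q + b q))))"

lemma face_states_empty: "face_states {} = UNIV"
  by (auto simp: face_states_def)

lemma induced_kernel_empty: "induced_kernel P P' B B' {} = polling_kernel P P' B B'"
  by (rule ext) (simp add: induced_kernel_def polling_kernel_def split: prod.splits)

lemma induced_kernel_closed:
  assumes "z \<in> face_states L"
  shows "set_pmf (induced_kernel P P' B B' L z) \<subseteq> face_states L"
  by (auto simp: induced_kernel_def face_states_def split: if_splits prod.splits)

text \<open>The full face is ergodic by convention.\<close>

definition ergodic_face ::
  "'n routing \<Rightarrow> 'n routing \<Rightarrow> 'n arrivals \<Rightarrow> 'n arrivals \<Rightarrow> 'n set \<Rightarrow> bool" where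
  "ergodic_face P P' B B' L \<longleftrightarrow>
     L = UNIV \<or> ergodic_chain (face_states L) (induced_kernel P P' B B' L)"

definition face_pmf ::
  "'n routing \<Rightarrow> 'n routing \<Rightarrow> 'n arrivals \<Rightarrow> 'n arrivals \<Rightarrow> 'n set \<Rightarrow>
   ('n \<times> ('n \<Rightarrow> nat)) pmf" where
  "face_pmf P P' B B' L = stationary_pmf (face_states L) (induced_kernel P P' B B' L)"

definition server_prob ::
  "'n routing \<Rightarrow> 'n routing \<Rightarrow> 'n arrivals \<Rightarrow> 'n arrivals \<Rightarrow> 'n set \<Rightarrow> 'n \<Rightarrow> real" where
  "server_prob P P' B B' L s = pmf (map_pmf fst (face_pmf P P' B B' L)) s"

definition second_vector_field ::
  "'n routing \<Rightarrow> 'n routing \<Rightarrow> 'n arrivals \<Rightarrow> 'n arrivals \<Rightarrow>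
   ('n \<Rightarrow> real) \<Rightarrow> ('n \<Rightarrow> real) \<Rightarrow> ('n \<Rightarrow> real) \<Rightarrow> 'n set \<Rightarrow> 'n \<Rightarrow> real" where
  "second_vector_field P P' B B' lam \<tau> \<tau>' L i =
     (if i \<in> L then
        measure_pmf.expectation (face_pmf P P' B B' L)
          (\<lambda>(s, x). lam i * \<tau> s * of_bool (s \<in> L \<or> x s > 0)
                  + lam i * \<tau>' s * of_bool (s \<notin> L \<and> x s = 0))
        - server_prob P P' B B' L i
      else 0)"

definition rho_hat ::
  "('n::finite \<Rightarrow> real) \<Rightarrow> ('n \<Rightarrow> real) \<Rightarrow> ('n \<Rightarrow> real) \<Rightarrow> real" where
  "rho_hat lam \<tau> \<tau>' = (\<Sum>i\<in>UNIV. lam i * (\<tau> i - \<tau>' i))"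

definition drift_form ::
  "('n::finite \<Rightarrow> real) \<Rightarrow> ('n \<Rightarrow> real) \<Rightarrow> ('n \<Rightarrow> real) \<Rightarrow> 'n \<Rightarrow> ('n \<Rightarrow> real) \<Rightarrow> real" where
  "drift_form lam \<tau> \<tau>' i x =
     x i + lam i * (\<Sum>j\<in>UNIV. x j * (\<tau> j - \<tau>' j)) / (1 - rho_hat lam \<tau> \<tau>')"

end

theory Submission
  imports Defs "HOL-Real_Asymp.Real_Asymp"
begin

text \<open>
  For the ergodicity criterion consider \<open>H x = Max\<^sub>i (drift_form i x / lam i)\<close>. Since
  \<open>drift_form i x / lam i\<close> is \<open>x\<^sub>i / lam i\<close> plus a linear term that does not depend on \<open>i\<close>, the maximum is
  attained at the queue \<open>i\<close> with the largest \<open>x\<^sub>i / lam i\<close>. Far from the origin this queue is long, and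
  what the system does on a large time scale is a mixture of the stationary regimes of ergodic faces \<open>L\<close>
  containing \<open>i\<close>. In each of them \<open>drift_form i\<close> decreases at the rate given by its value at the second
  vector field. So \<open>H\<close> decreases, while it is nonnegative (\<open>lyapunov_nonneg\<close>, which needs that the
  load, the sum of the \<open>lam i * \<tau> i\<close>, is at most 1; this in turn follows from the hypothesis at the full face, \<open>load_le_1\<close>).

  The proof is by contradiction and works with occupation measures. Their limits live on a space in which
  queues may be infinite; \<open>limit_mixture\<close> shows that the part with infinite queues exactly in \<open>L\<close> is a
  multiple of the stationary distribution of the chain induced on \<open>L\<close>, which is ergodic as soon as this
  part is nonzero. If the part of the empty face vanishes, the chain leaves all bounded sets. The maximum is
  then replaced by a log-sum-exp function with a parameter tending to 0; its gradient consists of slowly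
  varying weights, and the occupation measure weighted with the \<open>i\<close>-th of them is still almost invariant and
  lives where queue \<open>i\<close> is long. Its limit is a mixture over faces containing \<open>i\<close>, so all weights
  contribute a negative drift (\<open>ergodic_if_negative_drift_forms\<close>).

  The formula for \<open>drift_form i\<close> at the second vector field rests on \<open>stationary_drift_zero\<close>: queues
  outside the face are balanced in its stationary regime. Applied to the empty face, the same balance
  equations give the necessity of the conditions for identical routing. Their sufficiency follows from
  the general criterion, since then the server position has the stationary law \<open>F\<close> on every ergodic face
  and the drift forms become \<open>lam i * taubar - F i\<close>.

  Positive recurrence is reached from, and converted to, the existence of a stationary distribution by
  \<open>invariant_pmf_positive_recurrent\<close> and \<open>positive_recurrent_invariant_pmf\<close>.
\<close>

section \<open>Stationary distributions and positive recurrence\<close>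

lemma integrable_pmf_bounded:
  fixes f :: "'a \<Rightarrow> real"
  assumes "\<And>x. \<bar>f x\<bar> \<le> c"
  shows "integrable (measure_pmf p) f"
  using assms by (intro measure_pmf.integrable_const_bound[where B=c]) auto

lemma expectation_abs_bound:
  fixes f :: "'a \<Rightarrow> real"
  assumes "\<And>x. \<bar>f x\<bar> \<le> c"
  shows "\<bar>measure_pmf.expectation p f\<bar> \<le> c"
proof -
  have int: "integrable (measure_pmf p) f" by (rule integrable_pmf_bounded[OF assms])
  have 1: "measure_pmf.expectation p f \<le> c"
    by (rule measure_pmf.integral_le_const[OF int]) (use assms in \<open>auto simp: abs_le_iff\<close>)
  have 2: "- c \<le> measure_pmf.expectation p f"
    by (rule measure_pmf.integral_ge_const[OF int])
       (use assms in \<open>auto simp: abs_le_iff minus_le_iff\<close>)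
  from 1 2 show ?thesis by linarith
qed

lemma expectation_bind_nonneg:
  fixes f :: "'a \<Rightarrow> real"
  assumes nn: "\<And>x. 0 \<le> f x" and i: "\<And>x. integrable (measure_pmf (k x)) f"
    and ii: "integrable (measure_pmf p) (\<lambda>x. measure_pmf.expectation (k x) f)"
  shows "integrable (measure_pmf (bind_pmf p k)) f"
    and "measure_pmf.expectation (bind_pmf p k) f
           = measure_pmf.expectation p (\<lambda>x. measure_pmf.expectation (k x) f)"
proof -
  have "(\<integral>\<^sup>+x. ennreal (f x) \<partial>measure_pmf (bind_pmf p k))
      = (\<integral>\<^sup>+x. ennreal (measure_pmf.expectation (k x) f) \<partial>measure_pmf p)"
    unfolding nn_integral_bind_pmf
    by (intro nn_integral_cong nn_integral_eq_integral i) (simp add: nn)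
  also have "\<dots> = ennreal (measure_pmf.expectation p (\<lambda>x. measure_pmf.expectation (k x) f))"
    by (intro nn_integral_eq_integral ii) (simp add: nn)
  finally have e: "(\<integral>\<^sup>+x. ennreal (f x) \<partial>measure_pmf (bind_pmf p k))
      = ennreal (measure_pmf.expectation p (\<lambda>x. measure_pmf.expectation (k x) f))" .
  show "integrable (measure_pmf (bind_pmf p k)) f"
    by (rule integrableI_nn_integral_finite[OF _ _ e]) (auto simp: nn)
  have "measure_pmf.expectation (bind_pmf p k) f = enn2real (\<integral>\<^sup>+x. ennreal (f x) \<partial>measure_pmf (bind_pmf p k))"
    by (rule integral_eq_nn_integral) (auto simp: nn)
  also have "\<dots> = measure_pmf.expectation p (\<lambda>x. measure_pmf.expectation (k x) f)"
    unfolding e by (rule enn2real_ennreal) (simp add: nn)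
  finally show "measure_pmf.expectation (bind_pmf p k) f
           = measure_pmf.expectation p (\<lambda>x. measure_pmf.expectation (k x) f)" .
qed

lemma expectation_bind:
  fixes f :: "'a \<Rightarrow> real"
  assumes i: "\<And>x. integrable (measure_pmf (k x)) f"
    and ii: "integrable (measure_pmf p) (\<lambda>x. measure_pmf.expectation (k x) (\<lambda>y. \<bar>f y\<bar>))"
  shows "measure_pmf.expectation (bind_pmf p k) f
           = measure_pmf.expectation p (\<lambda>x. measure_pmf.expectation (k x) f)"
proof -
  let ?p = "\<lambda>x. max 0 (f x)" and ?n = "\<lambda>x. max 0 (- f x)"
  have ip: "integrable (measure_pmf (k x)) ?p" "integrable (measure_pmf (k x)) ?n" for x
    using i by auto
  have b: "integrable (measure_pmf p) (\<lambda>x. measure_pmf.expectation (k x) g)"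
    if g: "\<And>x. 0 \<le> g x \<and> g x \<le> \<bar>f x\<bar>" "\<And>x. integrable (measure_pmf (k x)) g" for g
  proof (rule Bochner_Integration.integrable_bound[OF ii], simp, intro AE_I2)
    fix x
    have "0 \<le> measure_pmf.expectation (k x) g"
      using g by (intro Bochner_Integration.integral_nonneg) auto
    moreover have "measure_pmf.expectation (k x) g \<le> measure_pmf.expectation (k x) (\<lambda>y. \<bar>f y\<bar>)"
      using g i by (intro integral_mono) auto
    ultimately show "norm (measure_pmf.expectation (k x) g) \<le> norm (measure_pmf.expectation (k x) (\<lambda>y. \<bar>f y\<bar>))"
      by simp
  qed
  have bp: "integrable (measure_pmf p) (\<lambda>x. measure_pmf.expectation (k x) ?p)"
    and bn: "integrable (measure_pmf p) (\<lambda>x. measure_pmf.expectation (k x) ?n)"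
    by (rule b; use ip in auto)+
  have f: "f = (\<lambda>x. ?p x - ?n x)" by (auto simp: fun_eq_iff)
  have d: "measure_pmf.expectation q f = measure_pmf.expectation q ?p - measure_pmf.expectation q ?n"
    if "integrable (measure_pmf q) ?p" "integrable (measure_pmf q) ?n" for q
    by (subst f) (rule Bochner_Integration.integral_diff[OF that])
  have "measure_pmf.expectation (bind_pmf p k) f
      = measure_pmf.expectation (bind_pmf p k) ?p - measure_pmf.expectation (bind_pmf p k) ?n"
    by (rule d) (rule expectation_bind_nonneg; use ip bp bn in auto)+
  also have "\<dots> = measure_pmf.expectation p (\<lambda>x. measure_pmf.expectation (k x) ?p)
      - measure_pmf.expectation p (\<lambda>x. measure_pmf.expectation (k x) ?n)"
    by (intro arg_cong2[where f="(-)"] expectation_bind_nonneg ip bp bn) auto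
  also have "\<dots> = measure_pmf.expectation p (\<lambda>x. measure_pmf.expectation (k x) f)"
    by (subst Bochner_Integration.integral_diff[symmetric, OF bp bn]) (simp add: d[OF ip])
  finally show ?thesis .
qed

lemma integrable_bind_pmf:
  fixes f :: "'a \<Rightarrow> real"
  assumes i: "\<And>x. integrable (measure_pmf (k x)) f"
    and ii: "integrable (measure_pmf p) (\<lambda>x. measure_pmf.expectation (k x) (\<lambda>y. \<bar>f y\<bar>))"
  shows "integrable (measure_pmf (bind_pmf p k)) f"
proof -
  have "integrable (measure_pmf (bind_pmf p k)) (\<lambda>y. \<bar>f y\<bar>)"
    by (rule expectation_bind_nonneg(1)) (use assms in auto)
  then show ?thesis by (rule integrable_abs_cancel) simp
qed

lemma expectation_bind_bounded:
  fixes f :: "'a \<Rightarrow> real"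
  assumes "\<And>x. \<bar>f x\<bar> \<le> c"
  shows "measure_pmf.expectation (bind_pmf p k) f
           = measure_pmf.expectation p (\<lambda>x. measure_pmf.expectation (k x) f)"
proof (rule expectation_bind)
  show "integrable (measure_pmf (k x)) f" for x by (rule integrable_pmf_bounded[OF assms])
  show "integrable (measure_pmf p) (\<lambda>x. measure_pmf.expectation (k x) (\<lambda>y. \<bar>f y\<bar>))"
    by (rule integrable_pmf_bounded[where c=c], rule expectation_abs_bound) (use assms in simp)
qed

lemma nsteps_Suc_right: "nsteps K (Suc n) x = bind_pmf (nsteps K n x) K"
proof (induction n arbitrary: x)
  case 0
  have "nsteps K 0 = return_pmf" by (rule ext) simp
  then show ?case by (simp add: bind_return_pmf bind_return_pmf')
next
  case (Suc n)
  have "nsteps K (Suc (Suc n)) x = bind_pmf (K x) (\<lambda>y. bind_pmf (nsteps K n y) K)"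
    using Suc by (simp cong: bind_pmf_cong)
  then show ?case by (simp add: bind_assoc_pmf)
qed

lemma nsteps_closed:
  assumes "\<And>z. z \<in> A \<Longrightarrow> set_pmf (K z) \<subseteq> A" "x \<in> A"
  shows "set_pmf (nsteps K n x) \<subseteq> A"
  using assms(2)
proof (induction n arbitrary: x)
  case (Suc n)
  then show ?case using assms(1)[OF Suc.prems] by fastforce
qed simp

text \<open>The chain cannot leave \<open>A\<close>, but it reaches every state.\<close>

lemma irreducible_closed:
  assumes "irreducible_chain E K" "\<And>z. z \<in> A \<Longrightarrow> set_pmf (K z) \<subseteq> A"
    and "x \<in> A" "x \<in> E"
  shows "E \<subseteq> A"
proof
  fix y assume "y \<in> E"
  with assms obtain n where "pmf (nsteps K n x) y > 0"
    unfolding irreducible_chain_def by blast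
  then have "y \<in> set_pmf (nsteps K n x)" by (simp add: set_pmf_iff)
  with nsteps_closed[of A K x n] assms(2,3) show "y \<in> A" by blast
qed

lemma invariant_nsteps:
  assumes "bind_pmf \<nu> K = \<nu>"
  shows "bind_pmf \<nu> (nsteps K n) = \<nu>"
proof (induction n)
  case 0
  have "nsteps K 0 = return_pmf" by (rule ext) simp
  then show ?case by (simp add: bind_return_pmf')
next
  case (Suc n)
  have "nsteps K (Suc n) = (\<lambda>x. bind_pmf (K x) (nsteps K n))" by (rule ext) simp
  then have "bind_pmf \<nu> (nsteps K (Suc n)) = bind_pmf (bind_pmf \<nu> K) (nsteps K n)"
    by (simp only: bind_assoc_pmf)
  with Suc assms show ?case by (simp only:)
qed

lemma invariant_pmf_positive:
  assumes irr: "irreducible_chain E K" and sub: "set_pmf \<nu> \<subseteq> E"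
    and inv: "bind_pmf \<nu> K = \<nu>" and y: "y \<in> E"
  shows "pmf \<nu> y > 0"
proof -
  obtain x where x: "x \<in> set_pmf \<nu>" using set_pmf_not_empty by fast
  with sub irr y obtain n where n: "pmf (nsteps K n x) y > 0"
    unfolding irreducible_chain_def by blast
  then have "y \<in> set_pmf (bind_pmf \<nu> (nsteps K n))"
    using x by (force simp: set_pmf_iff)
  then show ?thesis unfolding invariant_nsteps[OF inv] by (simp add: set_pmf_iff pmf_pos)
qed

text \<open>
  The set \<open>A\<close> where one stationary distribution exceeds another cannot be left by the chain: both
  integrate \<open>1\<^sub>A - K 1\<^sub>A\<close> to 0, and this function is nonnegative on \<open>A\<close> and nonpositive off \<open>A\<close>. For
  an irreducible chain such an \<open>A\<close> is everything or nothing, and the total masses exclude everything.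
\<close>

lemma invariant_pmf_unique:
  assumes irr: "irreducible_chain E K"
    and mu: "set_pmf \<mu> \<subseteq> E" "bind_pmf \<mu> K = \<mu>"
    and nu: "set_pmf \<nu> \<subseteq> E" "bind_pmf \<nu> K = \<nu>"
  shows "\<mu> = \<nu>"
proof (rule ccontr)
  assume "\<mu> \<noteq> \<nu>"
  then obtain x where x: "pmf \<nu> x < pmf \<mu> x" using pmf_neq_exists_less by metis
  define A where "A = {x. pmf \<nu> x < pmf \<mu> x}"
  define g where "g z = indicator A z - measure (K z) A" for z
  have g_bd: "\<bar>g z\<bar> \<le> 1" for z by (auto simp: g_def indicator_def)
  have zero: "measure_pmf.expectation p g = 0" if "bind_pmf p K = p" for p
  proof -
    have "measure p A = measure (bind_pmf p K) A" using that by simp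
    also have "\<dots> = measure_pmf.expectation (bind_pmf p K) (indicator A)" by simp
    also have "\<dots> = measure_pmf.expectation p (\<lambda>z. measure (K z) A)"
      by (subst expectation_bind_bounded[where c=1]) (auto simp: indicator_def)
    finally have e: "measure p A = measure_pmf.expectation p (\<lambda>z. measure (K z) A)" .
    have "measure_pmf.expectation p g
        = measure_pmf.expectation p (indicator A) - measure_pmf.expectation p (\<lambda>z. measure (K z) A)"
      unfolding g_def
      by (rule Bochner_Integration.integral_diff)
         (auto intro!: integrable_pmf_bounded[where c=1] simp: indicator_def)
    then show ?thesis using e by simp
  qed
  have dens: "measure_pmf.expectation p g = (\<integral>z. pmf p z * g z \<partial>count_space UNIV)"
    and densi: "integrable (count_space UNIV) (\<lambda>z. pmf p z * g z)" for p
  proof -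
    show "measure_pmf.expectation p g = (\<integral>z. pmf p z * g z \<partial>count_space UNIV)"
      unfolding measure_pmf_eq_density by (subst integral_density) auto
    have "integrable (measure_pmf p) g" by (rule integrable_pmf_bounded[OF g_bd])
    then show "integrable (count_space UNIV) (\<lambda>z. pmf p z * g z)"
      unfolding measure_pmf_eq_density by (subst (asm) integrable_density) auto
  qed
  let ?h = "\<lambda>z. pmf \<mu> z * g z - pmf \<nu> z * g z"
  have h0: "(\<integral>z. ?h z \<partial>count_space UNIV) = 0"
    by (subst Bochner_Integration.integral_diff[OF densi densi])
       (simp add: dens[symmetric] zero mu nu)
  have hi: "integrable (count_space UNIV) ?h" by (rule Bochner_Integration.integrable_diff[OF densi densi])
  have hnn: "0 \<le> ?h z" for z
  proof (cases "z \<in> A")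
    case True
    then have "0 \<le> g z" "pmf \<nu> z \<le> pmf \<mu> z" by (auto simp: g_def A_def)
    then have "0 \<le> (pmf \<mu> z - pmf \<nu> z) * g z" by simp
    then show ?thesis by (simp add: algebra_simps)
  next
    case False
    then have "g z \<le> 0" "pmf \<mu> z \<le> pmf \<nu> z" by (auto simp: g_def A_def)
    then have "0 \<le> (pmf \<mu> z - pmf \<nu> z) * g z" by (simp add: mult_nonpos_nonpos)
    then show ?thesis by (simp add: algebra_simps)
  qed
  have "AE z in count_space UNIV. ?h z = 0"
    using integral_nonneg_eq_0_iff_AE[OF hi] hnn h0 by auto
  then have hz: "?h z = 0" for z by (simp add: AE_count_space)
  have closed: "set_pmf (K z) \<subseteq> A" if "z \<in> A" for z
  proof -
    have "(pmf \<mu> z - pmf \<nu> z) * g z = 0" using hz[of z] by (simp add: algebra_simps)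
    then have "g z = 0" using that by (auto simp: A_def)
    then have "measure (K z) A = 1" using that by (simp add: g_def)
    then have "AE y in K z. y \<in> A" by (subst (asm) measure_pmf.prob_eq_1) auto
    then show ?thesis by (auto simp: AE_measure_pmf_iff)
  qed
  have "x \<in> E"
  proof -
    have "pmf \<mu> x \<noteq> 0" using x pmf_nonneg[of \<nu> x] by linarith
    then show ?thesis using mu(1) by (auto simp: set_pmf_iff)
  qed
  have EA: "E \<subseteq> A"
    by (rule irreducible_closed[OF irr closed _ \<open>x \<in> E\<close>]) (use x in \<open>auto simp: A_def\<close>)
  have le: "pmf \<nu> y \<le> pmf \<mu> y" for y
  proof (cases "y \<in> E")
    case True then show ?thesis using EA by (auto simp: A_def)
  next
    case False
    then have "pmf \<nu> y = 0" using nu(1) by (auto simp: set_pmf_iff)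
    then show ?thesis by simp
  qed
  from \<open>\<mu> \<noteq> \<nu>\<close> obtain y where "pmf \<mu> y < pmf \<nu> y" using pmf_neq_exists_less by metis
  with le[of y] show False by simp
qed

text \<open>
  The probability of not visiting \<open>y\<close> at the times \<open>1, \<dots>, n\<close>: the tail of the first passage time.
\<close>

primrec avoid_prob :: "('s \<Rightarrow> 's pmf) \<Rightarrow> 's \<Rightarrow> nat \<Rightarrow> 's \<Rightarrow> real" where
  "avoid_prob K y 0 z = 1"
| "avoid_prob K y (Suc n) z =
     measure_pmf.expectation (K z) (\<lambda>w. if w = y then 0 else avoid_prob K y n w)"

lemma avoid_prob_bounds: "0 \<le> avoid_prob K y n z \<and> avoid_prob K y n z \<le> 1"
proof (induction n arbitrary: z)
  case (Suc n)
  let ?f = "\<lambda>w. if w = y then 0 else avoid_prob K y n w"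
  have "\<bar>?f w\<bar> \<le> 1" for w using Suc[of w] by auto
  then have "\<bar>measure_pmf.expectation (K z) ?f\<bar> \<le> 1" by (rule expectation_abs_bound)
  moreover have "0 \<le> measure_pmf.expectation (K z) ?f"
    using Suc by (intro Bochner_Integration.integral_nonneg) auto
  ultimately show ?case by simp
qed simp

lemma first_passage_bounds: "0 \<le> first_passage K y n z \<and> first_passage K y n z \<le> 1"
proof (induction n arbitrary: z)
  case 0 then show ?case by (simp add: pmf_le_1)
next
  case (Suc n)
  let ?f = "\<lambda>w. if w = y then 0 else first_passage K y n w"
  have "\<bar>?f w\<bar> \<le> 1" for w using Suc[of w] by auto
  then have "\<bar>measure_pmf.expectation (K z) ?f\<bar> \<le> 1" by (rule expectation_abs_bound)
  moreover have "0 \<le> measure_pmf.expectation (K z) ?f"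
    using Suc by (intro Bochner_Integration.integral_nonneg) auto
  ultimately show ?case by simp
qed

lemma avoid_prob_step: "avoid_prob K y n z - avoid_prob K y (Suc n) z = first_passage K y n z"
proof (induction n arbitrary: z)
  case 0
  have "measure_pmf.expectation (K z) (\<lambda>w. if w = y then 0 else 1)
      = measure_pmf.expectation (K z) (\<lambda>w. 1 - indicator {y} w)"
    by (rule Bochner_Integration.integral_cong) (auto simp: indicator_def)
  also have "\<dots> = 1 - pmf (K z) y"
    by (subst Bochner_Integration.integral_diff)
       (auto intro!: integrable_pmf_bounded[where c=1] simp: indicator_def measure_pmf_single)
  finally have "measure_pmf.expectation (K z) (\<lambda>w. if w = y then 0 else 1) = 1 - pmf (K z) y" .
  then show ?case by (simp cong: if_cong)
next
  case (Suc n)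
  have i: "integrable (K z) (\<lambda>w. if w = y then 0 else avoid_prob K y m w)" for m
    using avoid_prob_bounds[of K y m] by (intro integrable_pmf_bounded[where c=1]) auto
  have "avoid_prob K y (Suc n) z - avoid_prob K y (Suc (Suc n)) z
      = measure_pmf.expectation (K z) (\<lambda>w. (if w = y then 0 else avoid_prob K y n w)
           - (if w = y then 0 else avoid_prob K y (Suc n) w))"
    by (subst Bochner_Integration.integral_diff[OF i i]) (simp only: avoid_prob.simps)
  also have "\<dots> = measure_pmf.expectation (K z) (\<lambda>w. if w = y then 0 else first_passage K y n w)"
    by (rule Bochner_Integration.integral_cong) (use Suc in auto)
  finally show ?case by simp
qed

lemma sum_first_passage: "(\<Sum>m<n. first_passage K y m z) = 1 - avoid_prob K y n z"
proof (induction n)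
  case (Suc n)
  then show ?case using avoid_prob_step[of K y n z] by simp
qed simp

lemma sum_weighted_first_passage:
  "(\<Sum>m<n. real (m + 1) * first_passage K y m z)
     = (\<Sum>m<n. avoid_prob K y m z) - real n * avoid_prob K y n z"
proof (induction n)
  case (Suc n)
  have "first_passage K y n z = avoid_prob K y n z - avoid_prob K y (Suc n) z"
    using avoid_prob_step[of K y n z] by simp
  with Suc show ?case by (simp only: sum.lessThan_Suc) (simp add: algebra_simps)
qed simp

text \<open>The mean return time is the sum of the tail probabilities, by summation by parts.\<close>

lemma positive_recurrent_iff_summable_avoid:
  "positive_recurrent K x \<longleftrightarrow> summable (\<lambda>n. avoid_prob K x n x)"
proof
  assume s: "summable (\<lambda>n. avoid_prob K x n x)"
  then have "(\<lambda>n. 1 - avoid_prob K x n x) \<longlonglongrightarrow> 1 - 0"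
    by (intro tendsto_intros summable_LIMSEQ_zero)
  then have "(\<lambda>n. first_passage K x n x) sums 1"
    unfolding sums_def sum_first_passage by simp
  moreover have "summable (\<lambda>n. real (n + 1) * first_passage K x n x)"
  proof (rule summableI_nonneg_bounded[where x="suminf (\<lambda>n. avoid_prob K x n x)"])
    fix n
    show "0 \<le> real (n + 1) * first_passage K x n x" using first_passage_bounds[of K x n x] by simp
    have "(\<Sum>m<n. real (m + 1) * first_passage K x m x) \<le> (\<Sum>m<n. avoid_prob K x m x)"
      unfolding sum_weighted_first_passage using avoid_prob_bounds[of K x n x] by simp
    also have "\<dots> \<le> suminf (\<lambda>n. avoid_prob K x n x)"
      by (intro sum_le_suminf s) (simp_all add: avoid_prob_bounds)
    finally show "(\<Sum>m<n. real (m + 1) * first_passage K x m x) \<le> suminf (\<lambda>n. avoid_prob K x n x)" .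
  qed
  ultimately show "positive_recurrent K x" by (simp add: positive_recurrent_def)
next
  assume pr: "positive_recurrent K x"
  let ?f = "\<lambda>n. first_passage K x n x"
  let ?g = "\<lambda>n. real (n + 1) * ?f n"
  have f1: "?f sums 1" and g: "summable ?g" using pr by (auto simp: positive_recurrent_def)
  have fnn: "0 \<le> ?f n" for n by (simp only: first_passage_bounds)
  have tail: "avoid_prob K x n x = (\<Sum>m. ?f (m + n))" for n
    using suminf_minus_initial_segment[OF sums_summable[OF f1], of n] sums_unique[OF f1]
      sum_first_passage[of K x x n] by simp
  have ntail: "real n * avoid_prob K x n x \<le> (\<Sum>m. ?g (m + n))" for n
  proof -
    have sf: "summable (\<lambda>m. ?f (m + n))" by (rule summable_ignore_initial_segment[OF sums_summable[OF f1]])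
    have "real n * avoid_prob K x n x = (\<Sum>m. real n * ?f (m + n))"
      unfolding tail by (rule suminf_mult[OF sf, symmetric])
    also have "\<dots> \<le> (\<Sum>m. ?g (m + n))"
      by (intro suminf_le summable_mult sf summable_ignore_initial_segment[OF g] mult_right_mono fnn) simp
    finally show ?thesis .
  qed
  show "summable (\<lambda>n. avoid_prob K x n x)"
  proof (rule summableI_nonneg_bounded[where x="suminf ?g"])
    fix n
    show "0 \<le> avoid_prob K x n x" by (simp only: avoid_prob_bounds)
    have "(\<Sum>m<n. avoid_prob K x m x) = (\<Sum>m<n. ?g m) + real n * avoid_prob K x n x"
      unfolding sum_weighted_first_passage by simp
    also have "\<dots> \<le> (\<Sum>m<n. ?g m) + (\<Sum>m. ?g (m + n))" using ntail by simp
    also have "\<dots> = suminf ?g" using suminf_minus_initial_segment[OF g, of n] by simp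
    finally show "(\<Sum>m<n. avoid_prob K x m x) \<le> suminf ?g" .
  qed
qed

text \<open>
  Kac's argument. Let \<open>r n\<close> be the stationary probability of avoiding \<open>x\<close> at the times \<open>0, \<dots>, n\<close>. By
  stationarity it is also that of avoiding \<open>x\<close> at the times \<open>1, \<dots>, n + 1\<close>, hence
  \<open>r n - r (n + 1)\<close> is the probability of being in \<open>x\<close> at time 0 and staying away during the next
  \<open>n + 1\<close> steps. These probabilities telescope, so the tails of the return time are summable.
\<close>

lemma invariant_pmf_positive_recurrent:
  assumes inv: "bind_pmf \<nu> K = \<nu>" and pos: "pmf \<nu> x > 0"
  shows "positive_recurrent K x"
proof -
  let ?a = "\<lambda>n. avoid_prob K x n"
  define r where "r n = measure_pmf.expectation \<nu> (\<lambda>z. if z = x then 0 else ?a n z)" for n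
  have r: "0 \<le> r n" "r n \<le> 1" for n
  proof -
    show "0 \<le> r n" unfolding r_def
      using avoid_prob_bounds[of K x n] by (intro Bochner_Integration.integral_nonneg) auto
    have "\<bar>r n\<bar> \<le> 1" unfolding r_def
      using avoid_prob_bounds[of K x n] by (intro expectation_abs_bound) auto
    then show "r n \<le> 1" by simp
  qed
  have step: "pmf \<nu> x * ?a (Suc n) x = r n - r (Suc n)" for n
  proof -
    have "measure_pmf.expectation \<nu> (?a (Suc n)) = measure_pmf.expectation (bind_pmf \<nu> K) (\<lambda>z. if z = x then 0 else ?a n z)"
      using avoid_prob_bounds[of K x n]
      by (subst expectation_bind_bounded[where c=1]) (auto intro!: Bochner_Integration.integral_cong)
    then have 1: "measure_pmf.expectation \<nu> (?a (Suc n)) = r n" by (simp add: inv r_def)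
    have "measure_pmf.expectation \<nu> (?a (Suc n))
        = measure_pmf.expectation \<nu> (\<lambda>z. (if z = x then 0 else ?a (Suc n) z) + ?a (Suc n) x * indicator {x} z)"
      by (rule Bochner_Integration.integral_cong) (auto simp del: avoid_prob.simps)
    also have "\<dots> = r (Suc n) + ?a (Suc n) x * pmf \<nu> x"
      unfolding r_def using avoid_prob_bounds[of K x "Suc n"]
      by (subst Bochner_Integration.integral_add)
         (auto simp del: avoid_prob.simps simp: measure_pmf_single intro!: integrable_pmf_bounded[where c=1] integrable_mult_right)
    finally show ?thesis using 1 by (simp add: mult.commute)
  qed
  have tel: "(\<Sum>n<m. pmf \<nu> x * ?a (Suc n) x) = r 0 - r m" for m
    by (induction m) (use step in \<open>auto simp del: avoid_prob.simps\<close>)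
  have "summable (\<lambda>n. pmf \<nu> x * ?a (Suc n) x)"
  proof (rule summableI_nonneg_bounded[where x=1])
    fix n
    show "0 \<le> pmf \<nu> x * ?a (Suc n) x" by (intro mult_nonneg_nonneg) (simp_all only: avoid_prob_bounds pmf_nonneg)
    show "(\<Sum>n<n. pmf \<nu> x * ?a (Suc n) x) \<le> 1" using r[of 0] r[of n] by (simp only: tel)
  qed
  then have "summable (\<lambda>n. ?a (Suc n) x)"
    using pos by (simp del: avoid_prob.simps add: summable_cmult_iff)
  then have "summable (\<lambda>n. ?a n x)" by (subst (asm) summable_Suc_iff)
  then show ?thesis by (simp add: positive_recurrent_iff_summable_avoid)
qed

lemma ergodic_chain_if_invariant_pmf:
  assumes "irreducible_chain E K" "aperiodic_chain E K" "set_pmf \<nu> \<subseteq> E" "bind_pmf \<nu> K = \<nu>"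
  shows "ergodic_chain E K"
  unfolding ergodic_chain_def
  using assms invariant_pmf_positive_recurrent[OF assms(4)] invariant_pmf_positive[OF assms(1,3,4)]
  by blast

lemma pmf_eq_if_eq_off_point:
  assumes "\<And>y. y \<noteq> x \<Longrightarrow> pmf p y = pmf q y"
  shows "p = q"
proof (rule ccontr)
  assume "p \<noteq> q"
  then obtain a b where "pmf p a < pmf q a" "pmf q b < pmf p b"
    using pmf_neq_exists_less by metis
  moreover from this have "a = x" "b = x" using assms by (metis less_irrefl)+
  ultimately show False by simp
qed

text \<open>
  The cycle formula: the expected number of visits to \<open>y\<close> during an excursion from \<open>x\<close> is an invariant
  measure, of total mass the mean return time. The excursion is described by the chain \<open>Kx\<close> that stops
  once it is back in \<open>x\<close>, and \<open>\<rho> n\<close> is its law at time \<open>n + 1\<close>.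
\<close>

lemma positive_recurrent_invariant_pmf:
  assumes pr: "positive_recurrent K x" and x: "x \<in> E" and closed: "\<And>z. z \<in> E \<Longrightarrow> set_pmf (K z) \<subseteq> E"
  shows "\<exists>\<nu>. set_pmf \<nu> \<subseteq> E \<and> bind_pmf \<nu> K = \<nu>"
proof -
  define Kx where "Kx w = (if w = x then return_pmf x else K w)" for w
  define \<rho> where "\<rho> n = bind_pmf (K x) (nsteps Kx n)" for n
  have \<rho>_Suc: "\<rho> (Suc n) = bind_pmf (\<rho> n) Kx" for n
    unfolding \<rho>_def nsteps_Suc_right by (simp add: bind_assoc_pmf)
  have absorbed: "nsteps Kx n x = return_pmf x" for n
    by (induction n) (auto simp: Kx_def bind_return_pmf)
  have hit: "pmf (nsteps Kx n z) x = (if z = x then 1 else 1 - avoid_prob K x n z)" for n z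
  proof (induction n arbitrary: z)
    case (Suc n)
    show ?case
    proof (cases "z = x")
      case False
      have "pmf (nsteps Kx (Suc n) z) x = measure_pmf.expectation (K z) (\<lambda>w. pmf (nsteps Kx n w) x)"
        using False by (simp add: Kx_def pmf_bind)
      also have "\<dots> = measure_pmf.expectation (K z) (\<lambda>w. 1 - (if w = x then 0 else avoid_prob K x n w))"
        using Suc by (intro Bochner_Integration.integral_cong) auto
      also have "\<dots> = 1 - avoid_prob K x (Suc n) z"
        using avoid_prob_bounds[of K x n]
        by (subst Bochner_Integration.integral_diff) (auto intro!: integrable_pmf_bounded[where c=1])
      finally show ?thesis using False by simp
    qed (simp add: absorbed del: nsteps.simps)
  qed auto
  have \<rho>x: "pmf (\<rho> n) x = 1 - avoid_prob K x (Suc n) x" for n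
  proof -
    have "pmf (\<rho> n) x = measure_pmf.expectation (K x) (\<lambda>w. 1 - (if w = x then 0 else avoid_prob K x n w))"
      unfolding \<rho>_def pmf_bind hit by (intro Bochner_Integration.integral_cong) auto
    also have "\<dots> = 1 - avoid_prob K x (Suc n) x"
      using avoid_prob_bounds[of K x n]
      by (subst Bochner_Integration.integral_diff) (auto intro!: integrable_pmf_bounded[where c=1])
    finally show ?thesis .
  qed
  have \<rho>E: "set_pmf (\<rho> n) \<subseteq> E" for n
  proof -
    have "set_pmf (nsteps Kx n z) \<subseteq> E" if "z \<in> E" for z
      by (rule nsteps_closed) (use closed x that in \<open>auto simp: Kx_def split: if_splits\<close>)
    then show ?thesis using closed[OF x] by (auto simp: \<rho>_def)
  qed
  let ?C = "count_space UNIV"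
  define nu where "nu y = (if y = x then 1 else \<Sum>n. ennreal (pmf (\<rho> n) y))" for y
  have sa: "summable (\<lambda>n. avoid_prob K x (Suc n) x)"
    using pr unfolding positive_recurrent_iff_summable_avoid by (subst summable_Suc_iff)
  define m where "m = 1 + (\<Sum>n. avoid_prob K x (Suc n) x)"
  have off: "emeasure (measure_pmf (\<rho> n)) (- {x}) = ennreal (avoid_prob K x (Suc n) x)" for n
  proof -
    have "measure (\<rho> n) (- {x}) = 1 - measure (\<rho> n) {x}"
      using measure_pmf.prob_compl[of "{x}" "\<rho> n"] by (simp add: Compl_eq_Diff_UNIV)
    then show ?thesis by (simp add: measure_pmf.emeasure_eq_measure measure_pmf_single \<rho>x del: avoid_prob.simps)
  qed
  have nn0: "0 \<le> (\<Sum>n. avoid_prob K x (Suc n) x)"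
    by (intro suminf_nonneg sa) (simp only: avoid_prob_bounds)
  then have m: "m > 0" by (simp add: m_def)
  \<comment> \<open>Integrals against \<open>nu\<close> split into the start of the excursion and the later times.\<close>
  have split: "(\<integral>\<^sup>+y. nu y * f y \<partial>?C) = f x + (\<Sum>n. \<integral>\<^sup>+y. indicator (- {x}) y * f y \<partial>measure_pmf (\<rho> n))"
    for f :: "'a \<Rightarrow> ennreal"
  proof -
    have "(\<integral>\<^sup>+y. nu y * f y \<partial>?C)
        = (\<integral>\<^sup>+y. f y * indicator {x} y + (\<Sum>n. ennreal (pmf (\<rho> n) y) * (indicator (- {x}) y * f y)) \<partial>?C)"
    proof (intro nn_integral_cong)
      fix y
      show "nu y * f y = f y * indicator {x} y + (\<Sum>n. ennreal (pmf (\<rho> n) y) * (indicator (- {x}) y * f y))"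
      proof (cases "y = x")
        case False
        then have "nu y * f y = (\<Sum>n. ennreal (pmf (\<rho> n) y) * f y)"
          by (simp only: nu_def if_False ennreal_suminf_multc)
        with False show ?thesis by simp
      qed (simp add: nu_def)
    qed
    also have "\<dots> = (\<integral>\<^sup>+y. f y * indicator {x} y \<partial>?C) + (\<integral>\<^sup>+y. (\<Sum>n. ennreal (pmf (\<rho> n) y) * (indicator (- {x}) y * f y)) \<partial>?C)"
      by (rule nn_integral_add) auto
    also have "(\<integral>\<^sup>+y. f y * indicator {x} y \<partial>?C) = f x"
      by (subst nn_integral_indicator_finite) auto
    also have "(\<integral>\<^sup>+y. (\<Sum>n. ennreal (pmf (\<rho> n) y) * (indicator (- {x}) y * f y)) \<partial>?C)
        = (\<Sum>n. \<integral>\<^sup>+y. ennreal (pmf (\<rho> n) y) * (indicator (- {x}) y * f y) \<partial>?C)"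
      by (rule nn_integral_suminf) auto
    finally show ?thesis by (simp add: nn_integral_measure_pmf)
  qed
  have total: "(\<integral>\<^sup>+y. nu y \<partial>?C) = ennreal m"
  proof -
    have "(\<integral>\<^sup>+y. nu y \<partial>?C) = 1 + (\<Sum>n. emeasure (measure_pmf (\<rho> n)) (- {x}))"
      using split[of "\<lambda>_. 1"] by simp
    also have "\<dots> = ennreal 1 + ennreal (\<Sum>n. avoid_prob K x (Suc n) x)"
      unfolding off by (subst suminf_ennreal2) (simp_all only: avoid_prob_bounds sa ennreal_1)
    also have "\<dots> = ennreal m" unfolding m_def using nn0 by (subst ennreal_plus[symmetric]) auto
    finally show ?thesis .
  qed
  have fin: "nu y < \<top>" for y
  proof -
    have "nu y = (\<integral>\<^sup>+z. nu z * indicator {y} z \<partial>?C)" by (subst nn_integral_indicator_finite) auto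
    also have "\<dots> \<le> (\<integral>\<^sup>+z. nu z \<partial>?C)" by (intro nn_integral_mono) (auto simp: indicator_def)
    finally show ?thesis using total by (simp add: le_less_trans)
  qed
  define \<nu> where "\<nu> = embed_pmf (\<lambda>y. enn2real (nu y) / m)"
  have e: "ennreal (enn2real (nu y) / m) = nu y / ennreal m" for y
    using fin[of y] m by (simp add: divide_ennreal[symmetric])
  have pmf_\<nu>: "pmf \<nu> y = enn2real (nu y) / m" for y
    unfolding \<nu>_def
  proof (rule pmf_embed_pmf)
    show "0 \<le> enn2real (nu y) / m" for y using m by simp
    have "(\<integral>\<^sup>+y. ennreal (enn2real (nu y) / m) \<partial>?C) = (\<integral>\<^sup>+y. nu y \<partial>?C) / ennreal m"
      unfolding e by (rule nn_integral_divide) auto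
    also have "\<dots> = 1" using m by (simp add: total divide_ennreal)
    finally show "(\<integral>\<^sup>+y. ennreal (enn2real (nu y) / m) \<partial>?C) = 1" .
  qed
  have "pmf (bind_pmf \<nu> K) y = pmf \<nu> y" if y: "y \<noteq> x" for y
  proof -
    have "ennreal (pmf (bind_pmf \<nu> K) y) = (\<integral>\<^sup>+z. ennreal (pmf \<nu> z) * ennreal (pmf (K z) y) \<partial>?C)"
      by (simp add: ennreal_pmf_bind nn_integral_measure_pmf)
    also have "\<dots> = (\<integral>\<^sup>+z. (nu z * ennreal (pmf (K z) y)) / ennreal m \<partial>?C)"
      by (intro nn_integral_cong) (simp add: pmf_\<nu> e divide_ennreal_def mult_ac)
    also have "\<dots> = (\<integral>\<^sup>+z. nu z * ennreal (pmf (K z) y) \<partial>?C) / ennreal m"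
      by (rule nn_integral_divide) auto
    also have "(\<integral>\<^sup>+z. nu z * ennreal (pmf (K z) y) \<partial>?C)
        = ennreal (pmf (K x) y) + (\<Sum>n. ennreal (pmf (\<rho> (Suc n)) y))"
    proof -
      have "(\<integral>\<^sup>+z. indicator (- {x}) z * ennreal (pmf (K z) y) \<partial>measure_pmf (\<rho> n)) = ennreal (pmf (\<rho> (Suc n)) y)" for n
        unfolding \<rho>_Suc ennreal_pmf_bind using y
        by (intro nn_integral_cong) (auto simp: Kx_def indicator_def)
      then show ?thesis by (simp add: split)
    qed
    also have "ennreal (pmf (K x) y) = ennreal (pmf (\<rho> 0) y)"
    proof -
      have "nsteps Kx 0 = return_pmf" by (rule ext) simp
      then show ?thesis by (simp add: \<rho>_def bind_return_pmf')
    qed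
    also have "ennreal (pmf (\<rho> 0) y) + (\<Sum>n. ennreal (pmf (\<rho> (Suc n)) y)) = (\<Sum>n. ennreal (pmf (\<rho> n) y))"
    proof -
      have "(\<Sum>n. ennreal (pmf (\<rho> n) y)) = (\<Sum>n. ennreal (pmf (\<rho> (n + 1)) y)) + (\<Sum>n<1. ennreal (pmf (\<rho> n) y))"
        by (rule suminf_offset) (rule summableI)
      moreover have "(\<Sum>n<1. ennreal (pmf (\<rho> n) y)) = ennreal (pmf (\<rho> 0) y)"
        by (simp only: One_nat_def sum.lessThan_Suc lessThan_0 sum.empty add_0)
      ultimately show ?thesis by (simp only: Suc_eq_plus1 add.commute)
    qed
    also have "\<dots> = nu y" using y by (simp only: nu_def if_False)
    also have "nu y / ennreal m = ennreal (pmf \<nu> y)" by (simp only: pmf_\<nu> e)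
    finally show ?thesis by simp
  qed
  then have inv: "bind_pmf \<nu> K = \<nu>" by (rule pmf_eq_if_eq_off_point)
  have "y \<in> E" if "y \<in> set_pmf \<nu>" for y
  proof (rule ccontr)
    assume "y \<notin> E"
    then have "pmf (\<rho> n) y = 0" for n using \<rho>E[of n] by (auto simp: set_pmf_iff)
    moreover have "y \<noteq> x" using x \<open>y \<notin> E\<close> by auto
    ultimately have "pmf \<nu> y = 0" by (simp add: pmf_\<nu> nu_def)
    with that show False by (simp add: set_pmf_iff)
  qed
  with inv show ?thesis by blast
qed

lemma stationary_pmf_eq:
  assumes "irreducible_chain E K" "set_pmf \<nu> \<subseteq> E" "bind_pmf \<nu> K = \<nu>"
  shows "stationary_pmf E K = \<nu>"
  unfolding stationary_pmf_def
  by (rule the_equality) (use assms invariant_pmf_unique[OF assms(1)] in auto)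

lemma stationary_pmf_ergodic:
  assumes erg: "ergodic_chain E K" and "E \<noteq> {}" and closed: "\<And>z. z \<in> E \<Longrightarrow> set_pmf (K z) \<subseteq> E"
  shows "set_pmf (stationary_pmf E K) \<subseteq> E" "bind_pmf (stationary_pmf E K) K = stationary_pmf E K"
proof -
  obtain x where "x \<in> E" "positive_recurrent K x"
    using assms by (auto simp: ergodic_chain_def)
  from positive_recurrent_invariant_pmf[OF this(2,1) closed]
  obtain \<nu> where \<nu>: "set_pmf \<nu> \<subseteq> E" "bind_pmf \<nu> K = \<nu>" by blast
  moreover have "irreducible_chain E K" using erg by (simp add: ergodic_chain_def)
  ultimately have "stationary_pmf E K = \<nu>" by (intro stationary_pmf_eq)
  with \<nu> show "set_pmf (stationary_pmf E K) \<subseteq> E"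
    "bind_pmf (stationary_pmf E K) K = stationary_pmf E K" by auto
qed

section \<open>Finitely additive limits\<close>

text \<open>
  Along an ultrafilter every bounded sequence converges. A sequence of measures thus has a limit on all
  sets at once; the price is that the limit is only finitely additive, as mass may escape to infinity.
\<close>

definition ultrafilter :: "'a filter \<Rightarrow> bool" where
  "ultrafilter U \<longleftrightarrow> U \<noteq> bot \<and> (\<forall>P. eventually P U \<or> eventually (\<lambda>x. \<not> P x) U)"

lemma ultrafilter_exists:
  assumes "F \<noteq> bot"
  obtains U where "ultrafilter U" "U \<le> F"
proof -
  let ?A = "{G. G \<noteq> bot \<and> G \<le> F}"
  have "\<exists>m\<in>?A. \<forall>a\<in>?A. m \<ge> a \<longrightarrow> a = m"
  proof (rule predicate_Zorn)
    show "partial_order_on ?A (relation_of (\<lambda>x y. x \<ge> y) ?A)"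
      by (rule partial_order_on_relation_ofI) auto
    fix C assume "C \<in> Chains (relation_of (\<lambda>x y. x \<ge> y) ?A)"
    then have C: "C \<subseteq> ?A" "\<And>a b. a \<in> C \<Longrightarrow> b \<in> C \<Longrightarrow> a \<ge> b \<or> b \<ge> a"
      unfolding Chains_def relation_of_def by blast+
    have fin: "X = {} \<or> Inf X \<in> X" if "finite X" "X \<subseteq> C" for X
      using that
    proof (induction X rule: finite_induct)
      case (insert x X)
      show ?case
      proof (cases "X = {}")
        case False
        then have "Inf X \<in> X" using insert by auto
        then have "x \<le> Inf X \<or> Inf X \<le> x" using C(2) insert.prems by blast
        then show ?thesis using \<open>Inf X \<in> X\<close> by (auto simp: inf_absorb1 inf_absorb2)
      qed simp
    qed simp
    have "Inf (insert F C) \<noteq> bot"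
    proof (rule Inf_filter_not_bot)
      fix X assume X: "X \<subseteq> insert F C" "finite X"
      let ?Y = "X - {F}"
      have Y: "?Y = {} \<or> Inf ?Y \<in> ?Y" using X by (intro fin) auto
      have "inf F (Inf ?Y) \<noteq> bot"
      proof (cases "?Y = {}")
        case True
        then have "Inf ?Y = top" by (simp only: Inf_empty)
        then show ?thesis using assms by (simp only: inf_top_right not_False_eq_True)
      next
        case False
        then have "Inf ?Y \<in> C" using X(1) Y by blast
        then have "Inf ?Y \<in> ?A" using C(1) by blast
        then show ?thesis by (simp add: inf_absorb2)
      qed
      moreover have "inf F (Inf ?Y) \<le> Inf X"
      proof -
        have "Inf (insert F ?Y) \<le> Inf X" by (rule Inf_superset_mono) auto
        then show ?thesis by (simp only: Complete_Lattices.Inf_insert)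
      qed
      ultimately show "Inf X \<noteq> bot" using bot_unique by metis
    qed
    moreover have "Inf (insert F C) \<le> F" by simp
    ultimately show "\<exists>u\<in>?A. \<forall>a\<in>C. u \<le> a"
      by (intro bexI[of _ "Inf (insert F C)"]) (auto intro: le_infI2 Inf_lower)
  qed
  then obtain U where U: "U \<noteq> bot" "U \<le> F" and max: "\<And>G. G \<noteq> bot \<Longrightarrow> G \<le> F \<Longrightarrow> G \<le> U \<Longrightarrow> G = U"
    by auto
  have "eventually P U \<or> eventually (\<lambda>x. \<not> P x) U" for P
  proof (cases "inf U (principal {x. P x}) = bot")
    case True
    then have "eventually (\<lambda>x. False) (inf U (principal {x. P x}))" by simp
    then show ?thesis by (simp add: eventually_inf_principal)
  next
    case False
    then have "inf U (principal {x. P x}) = U" using U(2) by (intro max) (auto intro: le_infI1)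
    moreover have "eventually P (inf U (principal {x. P x}))" by (simp add: eventually_inf_principal)
    ultimately show ?thesis by simp
  qed
  with U that show ?thesis by (auto simp: ultrafilter_def)
qed

text \<open>A cluster point exists by compactness, and an ultrafilter converges to its cluster points.\<close>

lemma ultrafilter_limit:
  fixes f :: "'a \<Rightarrow> real"
  assumes U: "ultrafilter U" and bd: "\<And>x. \<bar>f x\<bar> \<le> c"
  shows "\<exists>L. (f \<longlongrightarrow> L) U"
proof -
  let ?F = "filtermap f U"
  have "compact {-c..c}" by (rule compact_Icc)
  moreover have "?F \<noteq> bot" using U by (simp add: ultrafilter_def filtermap_bot_iff)
  moreover have "eventually (\<lambda>y. y \<in> {-c..c}) ?F"
    using bd by (simp add: eventually_filtermap abs_le_iff minus_le_iff)
  ultimately obtain L where L: "inf (nhds L) ?F \<noteq> bot" by (auto simp: compact_filter)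
  have "(f \<longlongrightarrow> L) U"
  proof (rule topological_tendstoI)
    fix S assume S: "open S" "L \<in> S"
    have "\<not> eventually (\<lambda>x. \<not> f x \<in> S) U"
    proof
      assume "eventually (\<lambda>x. \<not> f x \<in> S) U"
      then have "eventually (\<lambda>y. y \<notin> S) ?F" by (simp add: eventually_filtermap)
      moreover have "eventually (\<lambda>y. y \<in> S) (nhds L)" using S by (rule eventually_nhds_in_open)
      ultimately have "eventually (\<lambda>y. False) (inf (nhds L) ?F)"
        unfolding eventually_inf by blast
      with L show False by simp
    qed
    with U show "eventually (\<lambda>x. f x \<in> S) U" unfolding ultrafilter_def by blast
  qed
  then show ?thesis by blast
qed

definition fin_additive :: "('a set \<Rightarrow> real) \<Rightarrow> bool" where
  "fin_additive m \<longleftrightarrow> (\<forall>A. 0 \<le> m A) \<and> (\<forall>A B. A \<inter> B = {} \<longrightarrow> m (A \<union> B) = m A + m B)"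

lemma fin_additive_nonneg: "fin_additive m \<Longrightarrow> 0 \<le> m A"
  by (simp add: fin_additive_def)

lemma fin_additive_Un: "fin_additive m \<Longrightarrow> A \<inter> B = {} \<Longrightarrow> m (A \<union> B) = m A + m B"
  by (simp add: fin_additive_def)

lemma fin_additive_empty: "fin_additive m \<Longrightarrow> m {} = 0"
  using fin_additive_Un[of m "{}" "{}"] by simp

lemma fin_additive_split: "fin_additive m \<Longrightarrow> m A = m (A \<inter> B) + m (A - B)"
  using fin_additive_Un[of m "A \<inter> B" "A - B"] by (simp add: Int_Diff_Un Int_Diff_disjoint)

lemma fin_additive_Compl: "fin_additive m \<Longrightarrow> m UNIV = m A + m (- A)"
  using fin_additive_split[of m UNIV A] by (simp add: Compl_eq_Diff_UNIV)

lemma fin_additive_mono: "fin_additive m \<Longrightarrow> A \<subseteq> B \<Longrightarrow> m A \<le> m B"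
  using fin_additive_split[of m B A] fin_additive_nonneg[of m "B - A"] by (simp add: Int_absorb1)

lemma fin_additive_Union:
  assumes "fin_additive m" "finite I" "disjoint_family_on A I"
  shows "m (\<Union>i\<in>I. A i) = (\<Sum>i\<in>I. m (A i))"
  using assms(2,3)
proof (induction I rule: finite_induct)
  case empty
  then show ?case by (simp add: fin_additive_empty[OF assms(1)])
next
  case (insert i I)
  have "A i \<inter> (\<Union>i\<in>I. A i) = {}"
    using insert.prems insert.hyps by (auto simp: disjoint_family_on_def)
  moreover have "disjoint_family_on A I"
    using insert.prems by (auto simp: disjoint_family_on_def)
  ultimately show ?case
    using insert fin_additive_Un[OF assms(1)] by simp
qed

lemma fin_additive_Un_le: "fin_additive m \<Longrightarrow> m (A \<union> B) \<le> m A + m B"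
  using fin_additive_Un[of m A "B - A"] fin_additive_mono[of m "B - A" B] by simp

lemma fin_additive_eq_0_if_le: "fin_additive m \<Longrightarrow> m A \<le> 0 \<Longrightarrow> m A = 0"
  using fin_additive_nonneg[of m A] by simp

lemma fin_additive_UN_le:
  assumes "fin_additive m" "finite I"
  shows "m (\<Union>i\<in>I. A i) \<le> (\<Sum>i\<in>I. m (A i))"
  using assms(2)
proof (induction I rule: finite_induct)
  case empty
  then show ?case by (simp add: fin_additive_empty[OF assms(1)])
next
  case (insert i I)
  then show ?case using fin_additive_Un_le[OF assms(1), of "A i" "\<Union>i\<in>I. A i"] by simp
qed

lemma fin_additive_eq_mod_null:
  assumes m: "fin_additive m" and null: "m N = 0" and eq: "A - N = B - N"
  shows "m A = m B"
proof -
  have "m (C \<inter> N) = 0" for C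
    using fin_additive_mono[OF m, of "C \<inter> N" N] fin_additive_nonneg[OF m, of "C \<inter> N"] null by simp
  then have "m C = m (C - N)" for C using fin_additive_split[OF m, of C N] by simp
  then show ?thesis using eq by metis
qed

text \<open>
  The mass that escapes to \<open>c = \<infinity>\<close> is the limit of the masses of \<open>A \<inter> {c \<ge> r}\<close>; the rest is tight.
\<close>

lemma fin_additive_split_at_infinity:
  fixes c :: "'a \<Rightarrow> nat"
  assumes m: "fin_additive m"
  obtains mi mt where "fin_additive mi" "fin_additive mt" "\<And>A. m A = mi A + mt A"
    "\<And>r. mi {x. c x < r} = 0" "(\<lambda>r. mt {x. r \<le> c x}) \<longlonglongrightarrow> 0"
proof -
  let ?s = "\<lambda>A r. m (A \<inter> {x. r \<le> c x})"
  define mi where "mi A = (INF r. ?s A r)" for A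
  have bdd: "bdd_below (range (?s A))" for A
    using fin_additive_nonneg[OF m] by (intro bdd_belowI[where m=0]) auto
  have dec: "decseq (?s A)" for A
    unfolding decseq_def by (auto intro!: fin_additive_mono[OF m])
  have lim: "?s A \<longlonglongrightarrow> mi A" for A
    unfolding mi_def by (rule LIMSEQ_decseq_INF[OF bdd dec])
  have le: "mi A \<le> m A" for A
    by (rule LIMSEQ_le_const2[OF lim]) (auto intro!: fin_additive_mono[OF m])
  have nn: "0 \<le> mi A" for A
    by (rule LIMSEQ_le_const[OF lim]) (auto simp: fin_additive_nonneg[OF m])
  have add: "mi (A \<union> B) = mi A + mi B" if "A \<inter> B = {}" for A B
  proof (rule LIMSEQ_unique[OF lim])
    have "?s (A \<union> B) = (\<lambda>r. ?s A r + ?s B r)"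
      using that by (auto simp: Int_Un_distrib2 intro!: fin_additive_Un[OF m])
    then show "?s (A \<union> B) \<longlonglongrightarrow> mi A + mi B" using tendsto_add[OF lim lim] by simp
  qed
  define mt where "mt A = m A - mi A" for A
  have 1: "fin_additive mi" unfolding fin_additive_def using nn add by blast
  have 2: "fin_additive mt" unfolding fin_additive_def mt_def using le add fin_additive_Un[OF m] by auto
  have 3: "mi {x. c x < r} = 0" for r
  proof (rule LIMSEQ_unique[OF lim])
    have "eventually (\<lambda>q. ?s {x. c x < r} q = 0) sequentially"
      using eventually_ge_at_top[of r]
    proof eventually_elim
      case (elim q)
      then have "{x. c x < r} \<inter> {x. q \<le> c x} = {}" by auto
      then show ?case by (simp add: fin_additive_empty[OF m])
    qed
    then show "?s {x. c x < r} \<longlonglongrightarrow> 0" by (rule tendsto_eventually)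
  qed
  have full: "mi {x. r \<le> c x} = mi UNIV" for r
  proof -
    have "UNIV = {x. c x < r} \<union> {x. r \<le> c x}" by auto
    moreover have "{x. c x < r} \<inter> {x. r \<le> c x} = {}" by auto
    ultimately show ?thesis using fin_additive_Un[OF 1, of "{x. c x < r}" "{x. r \<le> c x}"] 3 by simp
  qed
  have "(\<lambda>r. m {x. r \<le> c x} - mi UNIV) \<longlonglongrightarrow> mi UNIV - mi UNIV"
    using lim[of UNIV] by (intro tendsto_intros) simp
  then have 4: "(\<lambda>r. mt {x. r \<le> c x}) \<longlonglongrightarrow> 0" by (simp add: mt_def full)
  show thesis by (rule that[OF 1 2 _ 3 4]) (simp add: mt_def)
qed

lemma tendsto_0_submeasure:
  fixes f g :: "nat \<Rightarrow> real"
  assumes "g \<longlonglongrightarrow> 0" "\<And>n. 0 \<le> f n" "\<And>n. f n \<le> g n"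
  shows "f \<longlonglongrightarrow> 0"
  by (rule tendsto_sandwich[OF _ _ tendsto_const assms(1)]) (use assms in auto)

text \<open>
  One coordinate is split after the other: being infinite or tight in a coordinate passes to the pieces
  of a later splitting. The index \<open>L\<close> of a piece collects the coordinates that are infinite on it.
\<close>

lemma fin_additive_face_decomposition:
  fixes c :: "'i \<Rightarrow> 'a \<Rightarrow> nat"
  assumes m: "fin_additive m" and "finite D"
  shows "\<exists>M. (\<forall>L. fin_additive (M L)) \<and> (\<forall>A. m A = (\<Sum>L\<in>Pow D. M L A)) \<and>
     (\<forall>L\<subseteq>D. (\<forall>i\<in>L. \<forall>r. M L {x. c i x < r} = 0) \<and> (\<forall>i\<in>D - L. (\<lambda>r. M L {x. r \<le> c i x}) \<longlonglongrightarrow> 0))"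
  using assms(2)
proof (induction D rule: finite_induct)
  case empty
  show ?case by (rule exI[of _ "\<lambda>_. m"]) (use m in simp)
next
  case (insert j D)
  from insert.IH obtain M where M0: "\<forall>L. fin_additive (M L)" "\<forall>A. m A = (\<Sum>L\<in>Pow D. M L A)"
    "\<forall>L\<subseteq>D. (\<forall>i\<in>L. \<forall>r. M L {x. c i x < r} = 0) \<and> (\<forall>i\<in>D - L. (\<lambda>r. M L {x. r \<le> c i x}) \<longlonglongrightarrow> 0)"
    by blast
  have M: "fin_additive (M L)" "m A = (\<Sum>L\<in>Pow D. M L A)"
    "L \<subseteq> D \<Longrightarrow> i \<in> L \<Longrightarrow> M L {x. c i x < r} = 0"
    "L \<subseteq> D \<Longrightarrow> i \<in> D - L \<Longrightarrow> (\<lambda>r. M L {x. r \<le> c i x}) \<longlonglongrightarrow> 0" for L A i r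
    using M0 by blast+
  have "\<forall>L. \<exists>mi mt. fin_additive mi \<and> fin_additive mt \<and> (\<forall>A. M L A = mi A + mt A) \<and>
      (\<forall>r. mi {x. c j x < r} = 0) \<and> (\<lambda>r. mt {x. r \<le> c j x}) \<longlonglongrightarrow> 0"
    by (metis fin_additive_split_at_infinity[OF M(1)])
  then obtain MI MT where N: "\<And>L. fin_additive (MI L)" "\<And>L. fin_additive (MT L)"
    "\<And>L A. M L A = MI L A + MT L A" "\<And>L r. MI L {x. c j x < r} = 0"
    "\<And>L. (\<lambda>r. MT L {x. r \<le> c j x}) \<longlonglongrightarrow> 0"
    by metis
  have le: "MI L A \<le> M L A" "MT L A \<le> M L A" for L A
    using N(3)[of L A] fin_additive_nonneg[OF N(1), of L A] fin_additive_nonneg[OF N(2), of L A] by auto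
  define M' where "M' L = (if j \<in> L then MI (L - {j}) else MT L)" for L
  have "fin_additive (M' L)" for L using N by (simp add: M'_def)
  moreover have "m A = (\<Sum>L\<in>Pow (insert j D). M' L A)" for A
  proof -
    have "(\<Sum>L\<in>Pow (insert j D). M' L A) = (\<Sum>L\<in>Pow D. M' L A) + (\<Sum>L\<in>insert j ` Pow D. M' L A)"
      unfolding Pow_insert using insert.hyps by (intro sum.union_disjoint) auto
    also have "(\<Sum>L\<in>insert j ` Pow D. M' L A) = (\<Sum>L\<in>Pow D. M' (insert j L) A)"
      using insert.hyps by (subst sum.reindex) (auto simp: inj_on_def)
    also have "(\<Sum>L\<in>Pow D. M' L A) + \<dots> = (\<Sum>L\<in>Pow D. M L A)"
      unfolding sum.distrib[symmetric]
    proof (rule sum.cong[OF refl])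
      fix L assume "L \<in> Pow D"
      then have "j \<notin> L" using insert.hyps by auto
      then show "M' L A + M' (insert j L) A = M L A" by (simp add: M'_def N(3))
    qed
    finally show ?thesis using M(2) by simp
  qed
  moreover have "M' L {x. c i x < r} = 0" if L: "L \<subseteq> insert j D" "i \<in> L" for L i r
  proof (cases "j \<in> L")
    case True
    show ?thesis
    proof (cases "i = j")
      case False
      then have "M (L - {j}) {x. c i x < r} = 0" using L by (intro M(3)) auto
      then show ?thesis
        using True le(1)[of "L - {j}" "{x. c i x < r}"]
          fin_additive_nonneg[OF N(1), of "L - {j}" "{x. c i x < r}"]
        by (simp add: M'_def)
    qed (use True N(4) in \<open>simp add: M'_def\<close>)
  next
    case False
    then have "M L {x. c i x < r} = 0" using L by (intro M(3)) auto
    then show ?thesis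
      using False le(2)[of L "{x. c i x < r}"] fin_additive_nonneg[OF N(2), of L "{x. c i x < r}"]
      by (simp add: M'_def)
  qed
  moreover have "(\<lambda>r. M' L {x. r \<le> c i x}) \<longlonglongrightarrow> 0"
    if L: "L \<subseteq> insert j D" "i \<in> insert j D - L" for L i
  proof (cases "j \<in> L")
    case True
    then have "(\<lambda>r. M (L - {j}) {x. r \<le> c i x}) \<longlonglongrightarrow> 0" using L by (intro M(4)) auto
    then have "(\<lambda>r. MI (L - {j}) {x. r \<le> c i x}) \<longlonglongrightarrow> 0"
      by (rule tendsto_0_submeasure) (use le fin_additive_nonneg[OF N(1)] in auto)
    with True show ?thesis by (simp add: M'_def)
  next
    case False
    show ?thesis
    proof (cases "i = j")
      case False2: False
      then have "(\<lambda>r. M L {x. r \<le> c i x}) \<longlonglongrightarrow> 0" using L False by (intro M(4)) auto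
      then have "(\<lambda>r. MT L {x. r \<le> c i x}) \<longlonglongrightarrow> 0"
        by (rule tendsto_0_submeasure) (use le fin_additive_nonneg[OF N(2)] in auto)
      with False show ?thesis by (simp add: M'_def)
    qed (use False N(5) in \<open>simp add: M'_def\<close>)
  qed
  ultimately show ?case by (intro exI[of _ M']) blast
qed

text \<open>
  Under a projection for which it is tight, a finitely additive measure becomes countably additive:
  finite sets carry almost all of the image, so the masses of the points add up to the total mass.
\<close>

lemma fin_additive_tight_image:
  fixes f :: "'a \<Rightarrow> 't"
  assumes m: "fin_additive m" and w: "m UNIV > 0"
    and tight: "\<And>e. e > 0 \<Longrightarrow> \<exists>Z. finite Z \<and> m (f -` (- Z)) < e"
  obtains \<nu> where "\<And>C. m (f -` C) = m UNIV * measure (measure_pmf \<nu>) C"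
proof -
  let ?w = "m UNIV"
  define p where "p z = m (f -` {z}) / ?w" for z
  have pnn: "0 \<le> p z" for z using w fin_additive_nonneg[OF m] by (simp add: p_def)
  have fs: "sum p Z = m (f -` Z) / ?w" if "finite Z" for Z
  proof -
    have "disjoint_family_on (\<lambda>z. f -` {z}) Z" by (auto simp: disjoint_family_on_def)
    then have "m (\<Union>z\<in>Z. f -` {z}) = (\<Sum>z\<in>Z. m (f -` {z}))"
      by (rule fin_additive_Union[OF m that])
    moreover have "(\<Union>z\<in>Z. f -` {z}) = f -` Z" by auto
    ultimately show ?thesis by (simp add: p_def sum_divide_distrib)
  qed
  have fs_le: "sum p Z \<le> 1" if "finite Z" for Z
    using fs[OF that] fin_additive_mono[OF m, of "f -` Z" UNIV] w by simp
  have sm: "p summable_on UNIV"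
    using fs_le pnn by (intro nonneg_bdd_above_summable_on bdd_aboveI[where M=1]) auto
  have "infsum p UNIV = 1"
  proof (rule antisym)
    show "infsum p UNIV \<le> 1" by (rule infsum_le_finite_sums[OF sm]) (use fs_le in auto)
    show "1 \<le> infsum p UNIV"
    proof (rule field_le_epsilon)
      fix e :: real assume "e > 0"
      then obtain Z where Z: "finite Z" "m (f -` (- Z)) < e * ?w" using tight[of "e * ?w"] w by auto
      have "m UNIV = m (f -` Z) + m (f -` (- Z))"
        unfolding vimage_Compl by (rule fin_additive_Compl[OF m])
      then have "m (f -` Z) \<ge> ?w - e * ?w" using Z by simp
      then have "sum p Z \<ge> 1 - e" using w by (simp add: fs[OF Z(1)] field_simps)
      moreover have "sum p Z \<le> infsum p UNIV"
        by (rule finite_sum_le_infsum[OF sm Z(1)]) (auto simp: pnn)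
      ultimately show "1 \<le> infsum p UNIV + e" by simp
    qed
  qed
  moreover have "(\<lambda>z. norm (p z)) summable_on UNIV" using sm pnn by simp
  ultimately have "(\<integral>z. p z \<partial>count_space UNIV) = 1" "integrable (count_space UNIV) p"
    using infsetsum_infsum[of p UNIV] abs_summable_equivalent[of p UNIV]
    by (auto simp: infsetsum_def Infinite_Set_Sum.abs_summable_on_def)
  then have "(\<integral>\<^sup>+z. ennreal (p z) \<partial>count_space UNIV) = 1"
    by (subst nn_integral_eq_integral) (auto simp: pnn)
  then have pmf: "pmf (embed_pmf p) z = p z" for z by (intro pmf_embed_pmf pnn)
  let ?\<nu> = "embed_pmf p"
  have compl: "?w * measure ?\<nu> (- C) = ?w - ?w * measure ?\<nu> C" for C
    using measure_pmf.prob_compl[of C ?\<nu>] by (simp add: Compl_eq_Diff_UNIV right_diff_distrib)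
  \<comment> \<open>It suffices to compare the two sides from one direction, as complements have the same total.\<close>
  have le: "?w * measure ?\<nu> C \<le> m (f -` C)" for C
  proof (rule field_le_epsilon)
    fix e :: real assume "e > 0"
    then obtain Z where Z: "finite Z" "m (f -` (- Z)) < e" using tight by blast
    have n: "?w * measure ?\<nu> Y = m (f -` Y)" if "finite Y" for Y
      using that w by (simp add: measure_measure_pmf_finite pmf fs)
    have "m UNIV = m (f -` Z) + m (f -` (- Z))"
      unfolding vimage_Compl by (rule fin_additive_Compl[OF m])
    then have nZ: "?w * measure ?\<nu> (- Z) = m (f -` (- Z))"
      using n[OF Z(1)] compl[of Z] by linarith
    have "measure ?\<nu> C \<le> measure ?\<nu> ((C \<inter> Z) \<union> (- Z))"
      by (rule measure_pmf.finite_measure_mono) auto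
    also have "\<dots> \<le> measure ?\<nu> (C \<inter> Z) + measure ?\<nu> (- Z)" by (rule measure_Un_le) auto
    finally have "?w * measure ?\<nu> C \<le> ?w * measure ?\<nu> (C \<inter> Z) + ?w * measure ?\<nu> (- Z)"
      using w by (simp add: distrib_left[symmetric])
    also have "\<dots> = m (f -` (C \<inter> Z)) + m (f -` (- Z))" using n[of "C \<inter> Z"] nZ Z(1) by simp
    also have "\<dots> \<le> m (f -` C) + e"
      using Z(2) fin_additive_mono[OF m, of "f -` (C \<inter> Z)" "f -` C"] by auto
    finally show "?w * measure ?\<nu> C \<le> m (f -` C) + e" .
  qed
  have "m (f -` C) = ?w * measure ?\<nu> C" for C
  proof (rule antisym[OF _ le])
    have "m UNIV = m (f -` C) + m (f -` (- C))"
      unfolding vimage_Compl by (rule fin_additive_Compl[OF m])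
    then show "m (f -` C) \<le> ?w * measure ?\<nu> C" using le[of "- C"] compl[of C] by linarith
  qed
  with that show thesis by blast
qed

section \<open>One step of the polling system\<close>

definition busy :: "'n set \<Rightarrow> 'n \<times> ('n \<Rightarrow> nat) \<Rightarrow> bool" where
  "busy L z \<longleftrightarrow> fst z \<in> L \<or> snd z (fst z) > 0"

definition next_queues :: "'n set \<Rightarrow> 'n \<times> ('n \<Rightarrow> nat) \<Rightarrow> ('n \<Rightarrow> nat) \<Rightarrow> 'n \<Rightarrow> nat" where
  "next_queues L z b q = (if q \<in> L then 0
     else (if busy L z \<and> q = fst z then snd z q - 1 else snd z q) + b q)"

locale polling =
  fixes P P' :: "'n::finite \<Rightarrow> 'n pmf"
    and B B' :: "'n \<Rightarrow> 'n \<Rightarrow> ('n \<Rightarrow> nat) pmf"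
    and lam \<tau> \<tau>' :: "'n \<Rightarrow> real"
  assumes finite_mean: "integrable (measure_pmf (B i j)) (\<lambda>b. real (b q))"
    and finite_mean': "integrable (measure_pmf (B' i j)) (\<lambda>b. real (b q))"
    and nonneg: "0 \<le> lam i" "0 \<le> \<tau> i" "0 \<le> \<tau>' i"
    and mean: "(\<Sum>j\<in>UNIV. pmf (P i) j * measure_pmf.expectation (B i j) (\<lambda>b. real (b q)))
                 = lam q * \<tau> i"
    and mean': "(\<Sum>j\<in>UNIV. pmf (P' i) j * measure_pmf.expectation (B' i j) (\<lambda>b. real (b q)))
                 = lam q * \<tau>' i"
    and irreducible: "irreducible_chain (face_states L) (induced_kernel P P' B B' L)"
    and aperiodic: "aperiodic_chain (face_states L) (induced_kernel P P' B B' L)"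
begin

abbreviation K :: "'n set \<Rightarrow> 'n \<times> ('n \<Rightarrow> nat) \<Rightarrow> ('n \<times> ('n \<Rightarrow> nat)) pmf" where
  "K \<equiv> induced_kernel P P' B B'"

definition route :: "bool \<Rightarrow> 'n \<Rightarrow> 'n pmf" where
  "route u s = (if u then P s else P' s)"

definition arrive :: "bool \<Rightarrow> 'n \<Rightarrow> 'n \<Rightarrow> ('n \<Rightarrow> nat) pmf" where
  "arrive u s t = (if u then B s t else B' s t)"

text \<open>
  The Boolean argument says whether the server finds its station \<open>s\<close> nonempty; saturated queues always are.
\<close>

definition drift :: "'n \<Rightarrow> 'n \<Rightarrow> bool \<Rightarrow> real" where
  "drift q s u = (if u then lam q * \<tau> s - of_bool (s = q) else lam q * \<tau>' s)"

lemma K_eq: "K L z = bind_pmf (route (busy L z) (fst z))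
   (\<lambda>t. map_pmf (\<lambda>b. (t, next_queues L z b)) (arrive (busy L z) (fst z) t))"
proof (cases z)
  case (Pair s x)
  show ?thesis
  proof (cases "busy L z")
    case True
    then have e: "next_queues L z b = (\<lambda>q. if q \<in> L then 0 else (if q = s then x q - 1 else x q) + b q)" for b
      by (auto simp: next_queues_def Pair fun_eq_iff)
    show ?thesis using True
      by (simp add: Pair induced_kernel_def route_def arrive_def busy_def map_pmf_def e[unfolded Pair])
  next
    case False
    then have e: "next_queues L z b = (\<lambda>q. if q \<in> L then 0 else x q + b q)" for b
      by (auto simp: next_queues_def Pair fun_eq_iff)
    show ?thesis using False
      by (simp add: Pair induced_kernel_def route_def arrive_def busy_def map_pmf_def e[unfolded Pair])
  qed
qed

lemma expectation_K:
  fixes f :: "'n \<times> ('n \<Rightarrow> nat) \<Rightarrow> real"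
  assumes i: "\<And>t. integrable (measure_pmf (arrive (busy L z) (fst z) t)) (\<lambda>b. f (t, next_queues L z b))"
  shows "integrable (measure_pmf (K L z)) f"
    and "measure_pmf.expectation (K L z) f = (\<Sum>t\<in>UNIV. pmf (route (busy L z) (fst z)) t *
      measure_pmf.expectation (arrive (busy L z) (fst z) t) (\<lambda>b. f (t, next_queues L z b)))"
proof -
  have fin: "integrable (measure_pmf (route (busy L z) (fst z))) g" for g :: "'n \<Rightarrow> real"
    by (rule integrable_measure_pmf_finite) simp
  show "integrable (measure_pmf (K L z)) f" unfolding K_eq
    by (rule integrable_bind_pmf) (use i fin in auto)
  have "measure_pmf.expectation (K L z) f = measure_pmf.expectation (route (busy L z) (fst z))
      (\<lambda>t. measure_pmf.expectation (arrive (busy L z) (fst z) t) (\<lambda>b. f (t, next_queues L z b)))"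
    unfolding K_eq by (subst expectation_bind) (use i fin in auto)
  also have "\<dots> = (\<Sum>t\<in>UNIV. pmf (route (busy L z) (fst z)) t *
      measure_pmf.expectation (arrive (busy L z) (fst z) t) (\<lambda>b. f (t, next_queues L z b)))"
    by (subst integral_measure_pmf[where A=UNIV]) (auto simp: scaleR_conv_of_real)
  finally show "measure_pmf.expectation (K L z) f = (\<Sum>t\<in>UNIV. pmf (route (busy L z) (fst z)) t *
      measure_pmf.expectation (arrive (busy L z) (fst z) t) (\<lambda>b. f (t, next_queues L z b)))" .
qed

lemma arrive_integrable: "integrable (measure_pmf (arrive u s t)) (\<lambda>b. real (b q))"
  by (simp add: arrive_def finite_mean finite_mean')

lemma arrive_mean: "(\<Sum>t\<in>UNIV. pmf (route u s) t * measure_pmf.expectation (arrive u s t) (\<lambda>b. real (b q)))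
    = lam q * (if u then \<tau> s else \<tau>' s)"
  by (simp add: arrive_def route_def mean mean')

lemma next_queues_real:
  assumes "q \<notin> L"
  shows "real (next_queues L z b q) = real (snd z q) - of_bool (busy L z \<and> q = fst z) + real (b q)"
  using assms by (auto simp: next_queues_def busy_def)

lemma queue_mean:
  assumes q: "q \<notin> L"
  shows "integrable (measure_pmf (K L z)) (\<lambda>z'. real (snd z' q))"
    and "measure_pmf.expectation (K L z) (\<lambda>z'. real (snd z' q))
           = real (snd z q) + drift q (fst z) (busy L z)"
proof -
  let ?u = "busy L z" and ?s = "fst z"
  let ?c = "real (snd z q) - of_bool (?u \<and> q = ?s)"
  have i: "integrable (measure_pmf (arrive ?u ?s t)) (\<lambda>b. real (snd (t, next_queues L z b) q))" for t
    using arrive_integrable[of ?u ?s t q] by (simp add: next_queues_real[OF q])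
  show "integrable (measure_pmf (K L z)) (\<lambda>z'. real (snd z' q))" by (rule expectation_K(1)[OF i])
  have "measure_pmf.expectation (K L z) (\<lambda>z'. real (snd z' q))
      = (\<Sum>t\<in>UNIV. pmf (route ?u ?s) t * (?c + measure_pmf.expectation (arrive ?u ?s t) (\<lambda>b. real (b q))))"
    unfolding expectation_K(2)[OF i] using arrive_integrable[of ?u ?s _ q]
    by (simp add: next_queues_real[OF q])
  also have "\<dots> = (\<Sum>t\<in>UNIV. pmf (route ?u ?s) t) * ?c
      + (\<Sum>t\<in>UNIV. pmf (route ?u ?s) t * measure_pmf.expectation (arrive ?u ?s t) (\<lambda>b. real (b q)))"
    by (simp only: distrib_left sum.distrib sum_distrib_right)
  also have "\<dots> = real (snd z q) + drift q ?s ?u"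
    unfolding arrive_mean by (auto simp: sum_pmf_eq_1 drift_def)
  finally show "measure_pmf.expectation (K L z) (\<lambda>z'. real (snd z' q)) = real (snd z q) + drift q ?s ?u" .
qed

lemma queue_decrease_le_1:
  assumes "z' \<in> set_pmf (K L z)" "q \<notin> L"
  shows "snd z q \<le> snd z' q + 1"
  using assms unfolding K_eq by (auto simp: next_queues_def)

definition drift_bound :: real where
  "drift_bound = 1 + (\<Sum>q\<in>UNIV. \<Sum>s\<in>UNIV. lam q * \<tau> s + lam q * \<tau>' s)"

lemma drift_le_bound: "\<bar>drift q s u\<bar> \<le> drift_bound"
proof -
  have "lam q * \<tau> s + lam q * \<tau>' s \<le> (\<Sum>s\<in>UNIV. lam q * \<tau> s + lam q * \<tau>' s)"
    by (rule member_le_sum) (use nonneg in auto)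
  also have "\<dots> \<le> (\<Sum>q\<in>UNIV. \<Sum>s\<in>UNIV. lam q * \<tau> s + lam q * \<tau>' s)"
    by (rule member_le_sum[where f="\<lambda>q. \<Sum>s\<in>UNIV. lam q * \<tau> s + lam q * \<tau>' s"])
       (use nonneg in \<open>auto intro!: sum_nonneg\<close>)
  moreover have "0 \<le> lam q * \<tau> s" "0 \<le> lam q * \<tau>' s" using nonneg by auto
  ultimately show ?thesis by (auto simp: drift_def drift_bound_def of_bool_def)
qed

text \<open>
  The queue lengths need not be integrable in the stationary regime, so stationarity is applied to
  \<open>min (x q) M\<close>. Its mean increments are bounded uniformly in \<open>M\<close> and tend to the drift.
\<close>

lemma stationary_drift_zero:
  assumes inv: "bind_pmf \<nu> (K L) = \<nu>" and q: "q \<notin> L"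
  shows "measure_pmf.expectation \<nu> (\<lambda>z. drift q (fst z) (busy L z)) = 0"
proof -
  let ?E = "measure_pmf.expectation"
  let ?g = "\<lambda>M z. min (real (snd z q)) (real M)"
  define d where "d M z = ?E (K L z) (?g M) - ?g M z" for M z
  have gb: "\<bar>?g M z\<bar> \<le> real M" for M z by auto
  have gi: "integrable (measure_pmf p) (?g M)" for p M by (rule integrable_pmf_bounded[OF gb])
  have zero: "?E \<nu> (d M) = 0" for M
  proof -
    have "?E \<nu> (d M) = ?E \<nu> (\<lambda>z. ?E (K L z) (?g M)) - ?E \<nu> (?g M)"
      unfolding d_def
      by (rule Bochner_Integration.integral_diff[OF integrable_pmf_bounded gi])
         (rule expectation_abs_bound[OF gb])
    also have "?E \<nu> (\<lambda>z. ?E (K L z) (?g M)) = ?E (bind_pmf \<nu> (K L)) (?g M)"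
      by (rule expectation_bind_bounded[OF gb, symmetric])
    finally show ?thesis by (simp add: inv)
  qed
  have lim: "(\<lambda>M. d M z) \<longlonglongrightarrow> drift q (fst z) (busy L z)" for z
  proof -
    have ev: "(\<lambda>M. ?g M z) \<longlonglongrightarrow> real (snd z q)" for z :: "'n \<times> ('n \<Rightarrow> nat)"
    proof (rule tendsto_eventually)
      show "\<forall>\<^sub>F M in sequentially. ?g M z = real (snd z q)"
        using eventually_ge_at_top[of "snd z q"] by eventually_elim auto
    qed
    have "(\<lambda>M. ?E (K L z) (?g M)) \<longlonglongrightarrow> ?E (K L z) (\<lambda>z'. real (snd z' q))"
      by (rule integral_dominated_convergence[where w="\<lambda>z'. real (snd z' q)"])
         (use ev queue_mean(1)[OF q] in auto)
    then have "(\<lambda>M. d M z) \<longlonglongrightarrow> ?E (K L z) (\<lambda>z'. real (snd z' q)) - real (snd z q)"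
      unfolding d_def by (rule tendsto_diff[OF _ ev])
    then show ?thesis by (simp add: queue_mean(2)[OF q])
  qed
  have bound: "\<bar>d M z\<bar> \<le> drift_bound + 1" for M z
  proof -
    have sup: "snd z q \<le> snd z' q + 1" if "z' \<in> set_pmf (K L z)" for z'
      using queue_decrease_le_1[OF that q] .
    have "?E (K L z) (\<lambda>_. ?g M z - 1) \<le> ?E (K L z) (?g M)"
      by (rule integral_mono_AE[OF _ gi]) (use sup in \<open>fastforce simp: AE_measure_pmf_iff\<close>)+
    then have 1: "- 1 \<le> d M z" by (simp add: d_def)
    have "?E (K L z) (?g M) \<le> ?E (K L z) (\<lambda>z'. (real (snd z' q) + (1 - real (snd z q))) + ?g M z)"
      by (rule integral_mono_AE[OF gi])
         (use sup queue_mean(1)[OF q] in \<open>fastforce simp: AE_measure_pmf_iff\<close>)+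
    also have "\<dots> = drift q (fst z) (busy L z) + 1 + ?g M z"
      using queue_mean[OF q, of z] by simp
    finally have 2: "d M z \<le> drift q (fst z) (busy L z) + 1" by (simp add: d_def)
    show ?thesis using 1 2 drift_le_bound[of q "fst z" "busy L z"] by linarith
  qed
  have "(\<lambda>M. ?E \<nu> (d M)) \<longlonglongrightarrow> ?E \<nu> (\<lambda>z. drift q (fst z) (busy L z))"
    by (rule integral_dominated_convergence[where w="\<lambda>_. drift_bound + 1"]) (use lim bound in auto)
  then show ?thesis unfolding zero using LIMSEQ_unique tendsto_const by metis
qed

lemma K_closed: "z \<in> face_states L \<Longrightarrow> set_pmf (K L z) \<subseteq> face_states L"
  by (rule induced_kernel_closed)

lemma arrive_zero_if_mean_zero:
  assumes "lam q * (if u then \<tau> s else \<tau>' s) = 0" and t: "t \<in> set_pmf (route u s)"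
    and b: "b \<in> set_pmf (arrive u s t)"
  shows "b q = 0"
proof -
  let ?e = "\<lambda>t. measure_pmf.expectation (arrive u s t) (\<lambda>b. real (b q))"
  have nn: "0 \<le> ?e t" for t by simp
  have "(\<Sum>t\<in>UNIV. pmf (route u s) t * ?e t) = 0" using assms(1) arrive_mean[of u s q] by simp
  then have "pmf (route u s) t * ?e t = 0"
    using nn by (subst (asm) sum_nonneg_eq_0_iff) auto
  then have "?e t = 0" using t by (simp add: set_pmf_iff)
  then have "AE b in arrive u s t. real (b q) = 0"
    by (subst (asm) integral_nonneg_eq_0_iff_AE[OF arrive_integrable]) auto
  then show ?thesis using b by (auto simp: AE_measure_pmf_iff)
qed

lemma K_face_states_reachable:
  assumes closed: "\<And>z. z \<in> A \<Longrightarrow> set_pmf (K {} z) \<subseteq> A" and "z \<in> A"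
  shows "A = UNIV"
  using irreducible_closed[OF irreducible[of "{}"] closed assms(2)] by (auto simp: face_states_empty)

text \<open>Without arrivals at \<open>q\<close> that queue would stay empty once it is empty.\<close>

lemma lam_pos: "lam q > 0"
proof (rule ccontr)
  assume "\<not> lam q > 0"
  then have 0: "lam q = 0" using nonneg(1)[of q] by simp
  define A where "A = {z :: 'n \<times> ('n \<Rightarrow> nat). snd z q = 0}"
  have "A = UNIV"
  proof (rule K_face_states_reachable)
    show "(undefined, \<lambda>_. 0) \<in> A" by (simp add: A_def)
    fix z assume "z \<in> A"
    then show "set_pmf (K {} z) \<subseteq> A"
      unfolding K_eq A_def using arrive_zero_if_mean_zero[of q "busy {} z" "fst z"] 0
      by (auto simp: next_queues_def)
  qed
  moreover have "(undefined, \<lambda>_. 1) \<notin> A" by (simp add: A_def)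
  ultimately show False by simp
qed

text \<open>Without arrivals during idle steps the empty system would stay empty.\<close>

lemma ex_idle_time_pos: "\<exists>s. \<tau>' s > 0"
proof (rule ccontr)
  assume "\<not> (\<exists>s. \<tau>' s > 0)"
  then have 0: "\<tau>' s = 0" for s using nonneg(3)[of s] by (metis less_eq_real_def)
  define A where "A = {z :: 'n \<times> ('n \<Rightarrow> nat). snd z = (\<lambda>_. 0)}"
  have "A = UNIV"
  proof (rule K_face_states_reachable)
    show "(undefined, \<lambda>_. 0) \<in> A" by (simp add: A_def)
    fix z assume "z \<in> A"
    then have z: "snd z = (\<lambda>_. 0)" "\<not> busy {} z" by (auto simp: A_def busy_def)
    show "set_pmf (K {} z) \<subseteq> A"
      unfolding K_eq A_def using arrive_zero_if_mean_zero[of _ False "fst z"] 0 z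
      by (auto simp: next_queues_def fun_eq_iff)
  qed
  moreover have "(undefined, \<lambda>_. 1) \<notin> A" by (simp add: A_def fun_eq_iff)
  ultimately show False by simp
qed

subsection \<open>Mean drifts in the stationary regime of a face\<close>

abbreviation \<pi> :: "'n set \<Rightarrow> ('n \<times> ('n \<Rightarrow> nat)) pmf" where
  "\<pi> L \<equiv> face_pmf P P' B B' L"

abbreviation server :: "'n set \<Rightarrow> 'n \<Rightarrow> real" where
  "server L s \<equiv> server_prob P P' B B' L s"

abbreviation v :: "'n set \<Rightarrow> 'n \<Rightarrow> real" where
  "v L \<equiv> second_vector_field P P' B B' lam \<tau> \<tau>' L"

abbreviation \<rho> :: real where "\<rho> \<equiv> rho_hat lam \<tau> \<tau>'"

definition found_at :: "'n set \<Rightarrow> 'n \<Rightarrow> bool \<Rightarrow> ('n \<times> ('n \<Rightarrow> nat)) set" where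
  "found_at L s u = {z. fst z = s \<and> busy L z = u}"

definition occ :: "'n set \<Rightarrow> 'n \<Rightarrow> bool \<Rightarrow> real" where
  "occ L s u = measure (\<pi> L) (found_at L s u)"

lemma expectation_at:
  fixes h :: "'n \<Rightarrow> bool \<Rightarrow> real" and g :: "'n \<times> ('n \<Rightarrow> nat) \<Rightarrow> real"
  assumes g: "\<And>z. \<bar>g z\<bar> \<le> c"
  shows "measure_pmf.expectation p (\<lambda>z. g z * h (fst z) (busy L z))
    = (\<Sum>s\<in>UNIV. \<Sum>u\<in>UNIV. measure_pmf.expectation p (\<lambda>z. g z * indicator (found_at L s u) z) * h s u)"
proof -
  have "g z * h (fst z) (busy L z) = (\<Sum>s\<in>UNIV. \<Sum>u\<in>UNIV. (g z * indicator (found_at L s u) z) * h s u)" for z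
  proof -
    have "(\<Sum>s\<in>UNIV. \<Sum>u\<in>UNIV. (g z * indicator (found_at L s u) z) * h s u)
        = (\<Sum>s\<in>UNIV. if s = fst z then \<Sum>u\<in>UNIV. if u = busy L z then g z * h s u else 0 else 0)"
      by (intro sum.cong refl) (auto simp: found_at_def indicator_def UNIV_bool)
    then show ?thesis by simp
  qed
  then have "measure_pmf.expectation p (\<lambda>z. g z * h (fst z) (busy L z))
      = measure_pmf.expectation p (\<lambda>z. \<Sum>s\<in>UNIV. \<Sum>u\<in>UNIV. (g z * indicator (found_at L s u) z) * h s u)"
    by simp
  moreover have "integrable (measure_pmf p) (\<lambda>z. g z * indicator (found_at L s u) z)" for s u
    using g by (intro integrable_pmf_bounded[where c=c])
      (auto simp: indicator_def intro: order_trans[OF abs_ge_zero])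
  ultimately show ?thesis by simp
qed

lemma expectation_face:
  "measure_pmf.expectation (\<pi> L) (\<lambda>z. h (fst z) (busy L z)) = (\<Sum>s\<in>UNIV. \<Sum>u\<in>UNIV. occ L s u * h s u)"
  using expectation_at[of "\<lambda>_. 1" 1 "\<pi> L" h L] by (simp add: occ_def)

lemma server_eq_occ: "server L s = occ L s True + occ L s False"
proof -
  have "server L s = measure (\<pi> L) (found_at L s True \<union> found_at L s False)"
    unfolding server_prob_def pmf_map
    by (rule arg_cong[where f="measure (\<pi> L)"]) (auto simp: found_at_def vimage_def)
  also have "\<dots> = occ L s True + occ L s False"
    unfolding occ_def by (rule measure_pmf.finite_measure_Union) (auto simp: found_at_def)
  finally show ?thesis .
qed

lemma occ_saturated: "s \<in> L \<Longrightarrow> occ L s True = server L s" "s \<in> L \<Longrightarrow> occ L s False = 0"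
proof -
  assume "s \<in> L"
  then have "found_at L s False = {}" by (auto simp: found_at_def busy_def)
  then show "occ L s False = 0" by (simp add: occ_def)
  then show "occ L s True = server L s" by (simp add: server_eq_occ)
qed

definition mean_time :: "'n set \<Rightarrow> real" where
  "mean_time L = (\<Sum>s\<in>UNIV. occ L s True * \<tau> s + occ L s False * \<tau>' s)"

definition mean_drift :: "'n set \<Rightarrow> 'n \<Rightarrow> real" where
  "mean_drift L q = (\<Sum>s\<in>UNIV. \<Sum>u\<in>UNIV. occ L s u * drift q s u)"

lemma mean_drift_eq: "mean_drift L q = lam q * mean_time L - occ L q True"
proof -
  have "mean_drift L q = (\<Sum>s\<in>UNIV. lam q * (occ L s True * \<tau> s + occ L s False * \<tau>' s)
      - (if s = q then occ L s True else 0))"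
    unfolding mean_drift_def by (intro sum.cong refl) (auto simp: UNIV_bool drift_def algebra_simps)
  also have "\<dots> = lam q * mean_time L - occ L q True"
    by (simp add: sum_subtractf mean_time_def sum_distrib_left)
  finally show ?thesis .
qed

lemma face_pmf_invariant:
  assumes "ergodic_chain (face_states L) (K L)"
  shows "set_pmf (\<pi> L) \<subseteq> face_states L" "bind_pmf (\<pi> L) (K L) = \<pi> L"
proof -
  have "face_states L \<noteq> {}" by (auto simp: face_states_def intro: exI[of _ "\<lambda>_. 0"])
  from stationary_pmf_ergodic[OF assms this K_closed]
  show "set_pmf (\<pi> L) \<subseteq> face_states L" "bind_pmf (\<pi> L) (K L) = \<pi> L"
    by (auto simp: face_pmf_def)
qed

lemma mean_drift_unsaturated:
  assumes "ergodic_face P P' B B' L" "q \<notin> L"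
  shows "mean_drift L q = 0"
proof -
  have "ergodic_chain (face_states L) (K L)" using assms by (auto simp: ergodic_face_def)
  from stationary_drift_zero[OF face_pmf_invariant(2)[OF this] assms(2)]
  show ?thesis by (simp add: mean_drift_def expectation_face[where h="drift q"])
qed

lemma second_vector_field_eq_mean_drift:
  assumes "ergodic_face P P' B B' L"
  shows "v L q = mean_drift L q"
proof (cases "q \<in> L")
  case True
  have e: "(\<lambda>(s, x). lam q * \<tau> s * of_bool (s \<in> L \<or> x s > 0) + lam q * \<tau>' s * of_bool (s \<notin> L \<and> x s = 0))
      = (\<lambda>z. (\<lambda>s u. lam q * (if u then \<tau> s else \<tau>' s)) (fst z) (busy L z))"
    by (auto simp: busy_def fun_eq_iff)
  have "v L q = (\<Sum>s\<in>UNIV. \<Sum>u\<in>UNIV. occ L s u * (lam q * (if u then \<tau> s else \<tau>' s))) - server L q"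
    unfolding second_vector_field_def if_P[OF True] e
    by (simp only: expectation_face[of L "\<lambda>s u. lam q * (if u then \<tau> s else \<tau>' s)"])
  also have "(\<Sum>s\<in>UNIV. \<Sum>u\<in>UNIV. occ L s u * (lam q * (if u then \<tau> s else \<tau>' s))) = lam q * mean_time L"
    unfolding mean_time_def sum_distrib_left by (intro sum.cong refl) (simp add: UNIV_bool algebra_simps)
  finally show ?thesis using True by (simp add: mean_drift_eq occ_saturated)
next
  case False
  then show ?thesis using mean_drift_unsaturated[OF assms] by (simp add: second_vector_field_def)
qed

text \<open>
  The equation \<open>mean_drift_eq\<close> has the same form for saturated and unsaturated queues. So a single sum
  over all stations relates the mean time to the mean drifts and the position of the server.
\<close>

lemma weighted_mean_drift:
  "(\<Sum>j\<in>UNIV. mean_drift L j * (\<tau> j - \<tau>' j))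
     = (\<Sum>j\<in>UNIV. server L j * \<tau>' j) - (1 - \<rho>) * mean_time L"
proof -
  have "(\<Sum>j\<in>UNIV. mean_drift L j * (\<tau> j - \<tau>' j)) = (\<Sum>j\<in>UNIV. mean_time L * (lam j * (\<tau> j - \<tau>' j))
      + server L j * \<tau>' j - (occ L j True * \<tau> j + occ L j False * \<tau>' j))"
    unfolding mean_drift_eq server_eq_occ by (intro sum.cong refl) (simp add: algebra_simps)
  also have "\<dots> = mean_time L * \<rho> + (\<Sum>j\<in>UNIV. server L j * \<tau>' j) - mean_time L"
    by (simp add: sum_subtractf sum.distrib rho_hat_def sum_distrib_left[symmetric])
       (simp add: mean_time_def sum.distrib)
  finally show ?thesis by (simp add: algebra_simps)
qed

text \<open>The two terms with the mean time cancel, which is what the coefficients of \<open>drift_form\<close> are made for.\<close>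

lemma drift_form_mean_drift:
  assumes "\<rho> < 1"
  shows "drift_form lam \<tau> \<tau>' i (mean_drift L)
    = lam i * (\<Sum>j\<in>UNIV. server L j * \<tau>' j) / (1 - \<rho>) - occ L i True"
proof -
  have "1 - \<rho> \<noteq> 0" using assms by simp
  then show ?thesis
    unfolding drift_form_def weighted_mean_drift by (simp add: mean_drift_eq field_simps)
qed

lemma drift_form_second_vector_field:
  assumes "\<rho> < 1" "ergodic_face P P' B B' L" "i \<in> L"
  shows "drift_form lam \<tau> \<tau>' i (v L) = lam i * (\<Sum>j\<in>UNIV. server L j * \<tau>' j) / (1 - \<rho>) - server L i"
proof -
  have "v L = mean_drift L" using second_vector_field_eq_mean_drift[OF assms(2)] by (rule ext)
  then show ?thesis using drift_form_mean_drift[OF assms(1)] occ_saturated(1)[OF assms(3)] by simp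
qed

end

section \<open>Limits of occupation measures are mixtures over the ergodic faces\<close>

lemma finite_bounded_states: "finite {y :: 'a::finite \<times> ('b::finite \<Rightarrow> nat). \<forall>i. snd y i < r}"
proof -
  have "finite (PiE (UNIV :: 'b set) (\<lambda>_. {..<r}))" by (rule finite_PiE) auto
  then have "finite ((UNIV :: 'a set) \<times> PiE (UNIV :: 'b set) (\<lambda>_. {..<r}))" by simp
  then show ?thesis by (rule finite_subset[rotated]) (auto simp: PiE_def)
qed

definition face_proj :: "'n set \<Rightarrow> 'n \<times> ('n \<Rightarrow> nat) \<Rightarrow> 'n \<times> ('n \<Rightarrow> nat)" where
  "face_proj L z = (fst z, \<lambda>i. if i \<in> L then 0 else snd z i)"

text \<open>
  As \<open>R\<close> grows, these sets shrink to the point whose queues in \<open>L\<close> are infinite and whose other queues are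
  those of \<open>y\<close>.
\<close>

definition cyl :: "'n set \<Rightarrow> 'n \<times> ('n \<Rightarrow> nat) \<Rightarrow> nat \<Rightarrow> ('n \<times> ('n \<Rightarrow> nat)) set" where
  "cyl L y R = {z. face_proj L z = y \<and> (\<forall>i\<in>L. R \<le> snd z i)}"

lemma face_proj_states: "face_proj L z \<in> face_states L"
  by (simp add: face_proj_def face_states_def)

context polling
begin

lemma K_face_proj:
  assumes "\<And>i. i \<in> L \<Longrightarrow> 1 \<le> snd z i"
  shows "map_pmf (face_proj L) (K {} z) = K L (face_proj L z)"
proof -
  have b: "busy {} z = busy L (face_proj L z)"
    using assms by (force simp: busy_def face_proj_def)
  have n: "face_proj L (t, next_queues {} z y) = (t, next_queues L (face_proj L z) y)" for t y
    using b by (auto simp: face_proj_def next_queues_def)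
  have f: "fst (face_proj L z) = fst z" by (simp add: face_proj_def)
  show ?thesis
    unfolding K_eq map_bind_pmf pmf.map_comp b f by (simp add: o_def n)
qed

text \<open>
  Far out in the direction of \<open>L\<close> the queues in \<open>L\<close> are nonempty, and in one step they shrink by at most
  1. So the transition probabilities between cylinders are those of the induced chain.
\<close>

lemma K_cyl:
  assumes "z \<in> cyl L y (Suc R)"
  shows "measure (K {} z) (cyl L y' R) = pmf (K L y) y'"
proof -
  have z: "face_proj L z = y" "\<And>i. i \<in> L \<Longrightarrow> Suc R \<le> snd z i" using assms by (auto simp: cyl_def)
  have "pmf (K L y) y' = measure (K {} z) (face_proj L -` {y'})"
    using K_face_proj[of L z] z by (force simp: pmf_map[symmetric])
  also have "\<dots> = measure (K {} z) (cyl L y' R)"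
  proof (rule measure_pmf.finite_measure_eq_AE)
    have "R \<le> snd z' i" if "z' \<in> set_pmf (K {} z)" "i \<in> L" for z' i
      using queue_decrease_le_1[OF that(1), of i] z(2)[OF that(2)] by simp
    then show "AE z' in K {} z. (z' \<in> face_proj L -` {y'}) = (z' \<in> cyl L y' R)"
      by (auto simp: AE_measure_pmf_iff cyl_def)
  qed auto
  finally show ?thesis by simp
qed

text \<open>
  The face of a point at infinity is the set of its infinite queues. Split a limit accordingly into
  pieces \<open>M L\<close>. Each piece projects to a multiple of a probability distribution on the states of the
  face, and this distribution is stationary: cylinders with large queues in \<open>L\<close> see the induced chain,
  and taking the limit shows that the image is subinvariant, hence invariant since its mass is finite.
  The limits are computed for the sets \<open>A\<close> that do not depend on the exact lengths of long queues.
\<close>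

lemma limit_mixture:
  fixes \<mu> :: "nat \<Rightarrow> ('n \<times> ('n \<Rightarrow> nat)) pmf" and g :: "nat \<Rightarrow> 'n \<times> ('n \<Rightarrow> nat) \<Rightarrow> real"
  assumes g: "\<And>l z. 0 \<le> g l z" "\<And>l z. g l z \<le> 1"
    and U: "ultrafilter U" "U \<le> sequentially"
    and eps: "eps \<longlonglongrightarrow> 0"
    and inv: "\<And>l A. measure_pmf.expectation (\<mu> l) (\<lambda>z. g l z * measure (K {} z) A)
        \<le> measure_pmf.expectation (\<mu> l) (\<lambda>z. g l z * indicator A z) + eps l"
  obtains w where "\<And>L. 0 \<le> w L" "\<And>L. w L > 0 \<Longrightarrow> ergodic_face P P' B B' L"
    "\<And>A A' R. (\<And>L z. \<forall>i\<in>L. R \<le> snd z i \<Longrightarrow> z \<in> A \<longleftrightarrow> face_proj L z \<in> A' L) \<Longrightarrow>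
       ((\<lambda>l. measure_pmf.expectation (\<mu> l) (\<lambda>z. g l z * indicator A z))
          \<longlongrightarrow> (\<Sum>L\<in>UNIV. w L * measure (\<pi> L) (A' L))) U"
proof -
  let ?E = "measure_pmf.expectation"
  have Ubot: "U \<noteq> bot" using U by (simp add: ultrafilter_def)
  define \<psi> where "\<psi> l A = ?E (\<mu> l) (\<lambda>z. g l z * indicator A z)" for l A
  have gint: "integrable (measure_pmf p) (\<lambda>z. g l z * h z)" if "\<And>z. 0 \<le> h z" "\<And>z. h z \<le> 1" for p h l
    by (rule integrable_pmf_bounded[where c=1]) (use g that in \<open>auto simp: abs_mult mult_le_one\<close>)
  have gind: "integrable (measure_pmf p) (\<lambda>z. g l z * indicator A z)" for p A l
    by (rule gint) (auto simp: indicator_def)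
  have \<psi>_nonneg: "0 \<le> \<psi> l A" for l A
    unfolding \<psi>_def using g by (intro Bochner_Integration.integral_nonneg) auto
  have \<psi>_le: "\<bar>\<psi> l A\<bar> \<le> 1" for l A
    unfolding \<psi>_def using g by (intro expectation_abs_bound) (auto simp: indicator_def)
  have \<psi>_Un: "\<psi> l (A \<union> C) = \<psi> l A + \<psi> l C" if "A \<inter> C = {}" for l A C
    unfolding \<psi>_def
    by (subst Bochner_Integration.integral_add[OF gind gind, symmetric])
       (use that in \<open>simp add: indicator_disj_union distrib_left\<close>)
  have "\<forall>A. \<exists>c. ((\<lambda>l. \<psi> l A) \<longlongrightarrow> c) U"
    by (intro allI ultrafilter_limit[OF U(1), where c=1] \<psi>_le)
  then obtain m where lim: "\<And>A. ((\<lambda>l. \<psi> l A) \<longlongrightarrow> m A) U" by metis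
  have m: "fin_additive m"
    unfolding fin_additive_def
  proof (intro conjI allI impI)
    show "0 \<le> m A" for A
      by (rule tendsto_lowerbound[OF lim _ Ubot]) (simp add: \<psi>_nonneg)
    fix A C :: "('n \<times> ('n \<Rightarrow> nat)) set" assume "A \<inter> C = {}"
    then have "((\<lambda>l. \<psi> l (A \<union> C)) \<longlongrightarrow> m A + m C) U"
      using tendsto_add[OF lim lim] by (simp add: \<psi>_Un)
    then show "m (A \<union> C) = m A + m C" using tendsto_unique[OF Ubot lim] by blast
  qed
  obtain M where M: "\<And>L. fin_additive (M L)" "\<And>A. m A = (\<Sum>L\<in>UNIV. M L A)"
    and M_inf: "\<And>L i r. i \<in> L \<Longrightarrow> M L {z. snd z i < r} = 0"
    and M_tight: "\<And>L i. i \<notin> L \<Longrightarrow> (\<lambda>r. M L {z. r \<le> snd z i}) \<longlonglongrightarrow> 0"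
  proof -
    obtain M where "\<forall>L. fin_additive (M L)" "\<forall>A. m A = (\<Sum>L\<in>Pow UNIV. M L A)"
      "\<forall>L\<subseteq>UNIV. (\<forall>i\<in>L. \<forall>r. M L {z. snd z i < r} = 0) \<and>
         (\<forall>i\<in>UNIV - L. (\<lambda>r. M L {z. r \<le> snd z i}) \<longlonglongrightarrow> 0)"
      using fin_additive_face_decomposition[OF m, of UNIV "\<lambda>i z. snd z i"] by auto
    then show thesis by (intro that[of M]) auto
  qed
  define w where "w L = M L UNIV" for L
  have w: "0 \<le> w L" for L by (simp add: w_def fin_additive_nonneg[OF M(1)])
  have null: "M L {z. \<exists>i\<in>L. snd z i < R} = 0" for L R
  proof -
    have "M L (\<Union>i\<in>L. {z. snd z i < R}) \<le> (\<Sum>i\<in>L. M L {z. snd z i < R})"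
      by (rule fin_additive_UN_le[OF M(1)]) simp
    also have "\<dots> = 0" by (simp add: M_inf)
    also have "(\<Union>i\<in>L. {z. snd z i < R}) = {z. \<exists>i\<in>L. snd z i < R}" by auto
    finally show ?thesis by (rule fin_additive_eq_0_if_le[OF M(1)])
  qed
  have M_eq: "M L A = M L A'" if e: "\<And>z. \<forall>i\<in>L. R \<le> snd z i \<Longrightarrow> z \<in> A \<longleftrightarrow> z \<in> A'" for L A A' R
  proof (rule fin_additive_eq_mod_null[OF M(1) null[of L R]], rule set_eqI)
    fix z
    show "z \<in> A - {z. \<exists>i\<in>L. snd z i < R} \<longleftrightarrow> z \<in> A' - {z. \<exists>i\<in>L. snd z i < R}"
      using e[of z] by (cases "\<forall>i\<in>L. R \<le> snd z i") (simp_all add: not_less, force simp: not_le)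
  qed
  have M_le: "M L A \<le> m A" for L A
    unfolding M(2) by (rule member_le_sum) (auto simp: fin_additive_nonneg[OF M(1)])
  have tight: "\<exists>Z. finite Z \<and> M L (face_proj L -` (- Z)) < e" if e: "e > 0" for L e
  proof -
    have "(\<lambda>r. \<Sum>i\<in>-L. M L {z. r \<le> snd z i}) \<longlonglongrightarrow> (\<Sum>i\<in>-L. 0)"
      by (intro tendsto_sum M_tight) auto
    then have "\<forall>\<^sub>F r in sequentially. (\<Sum>i\<in>-L. M L {z. r \<le> snd z i}) < e"
      using e by (intro order_tendstoD(2)[where y="\<Sum>i\<in>-L. 0"]) auto
    then obtain r where r: "(\<Sum>i\<in>-L. M L {z. r \<le> snd z i}) < e"
      by (meson eventually_sequentially order_refl)
    let ?Z = "{y :: 'n \<times> ('n \<Rightarrow> nat). \<forall>i. snd y i < Suc r}"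
    have "face_proj L -` (- ?Z) \<subseteq> (\<Union>i\<in>-L. {z. r \<le> snd z i})"
      by (auto simp: face_proj_def split: if_splits)
    then have "M L (face_proj L -` (- ?Z)) \<le> M L (\<Union>i\<in>-L. {z. r \<le> snd z i})"
      by (rule fin_additive_mono[OF M(1)])
    also have "\<dots> \<le> (\<Sum>i\<in>-L. M L {z. r \<le> snd z i})" by (rule fin_additive_UN_le[OF M(1)]) simp
    finally show ?thesis using r finite_bounded_states by (intro exI[of _ ?Z]) auto
  qed
  have sub: "(\<Sum>y\<in>Z. m (cyl L y (Suc R)) * pmf (K L y) y') \<le> m (cyl L y' R)"
    if Z: "finite Z" for L Z y' R
  proof -
    have l: "(\<Sum>y\<in>Z. \<psi> l (cyl L y (Suc R)) * pmf (K L y) y') \<le> \<psi> l (cyl L y' R) + eps l" for l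
    proof -
      have pw: "(\<Sum>y\<in>Z. indicator (cyl L y (Suc R)) z * pmf (K L y) y') \<le> measure (K {} z) (cyl L y' R)" for z
      proof (cases "\<exists>y\<in>Z. z \<in> cyl L y (Suc R)")
        case True
        then obtain y where y: "y \<in> Z" "z \<in> cyl L y (Suc R)" by blast
        then have "(\<Sum>y\<in>Z. indicator (cyl L y (Suc R)) z * pmf (K L y) y')
            = (\<Sum>x\<in>Z. if x = y then pmf (K L y) y' else 0)"
          by (intro sum.cong refl) (auto simp: indicator_def cyl_def)
        also have "\<dots> = pmf (K L y) y'" using y Z by simp
        finally show ?thesis using K_cyl[OF y(2)] by simp
      next
        case False
        then have "(\<Sum>y\<in>Z. indicator (cyl L y (Suc R)) z * pmf (K L y) y') = 0"
          by (intro sum.neutral) (auto simp: indicator_def)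
        then show ?thesis by simp
      qed
      have "(\<Sum>y\<in>Z. \<psi> l (cyl L y (Suc R)) * pmf (K L y) y')
          = ?E (\<mu> l) (\<lambda>z. \<Sum>y\<in>Z. (g l z * indicator (cyl L y (Suc R)) z) * pmf (K L y) y')"
        unfolding \<psi>_def using gind by simp
      also have "\<dots> = ?E (\<mu> l) (\<lambda>z. g l z * (\<Sum>y\<in>Z. indicator (cyl L y (Suc R)) z * pmf (K L y) y'))"
        by (simp add: sum_distrib_left mult.assoc)
      also have "\<dots> \<le> ?E (\<mu> l) (\<lambda>z. g l z * measure (K {} z) (cyl L y' R))"
        by (intro integral_mono gint mult_left_mono pw sum_nonneg)
           (use g pw order_trans[OF pw measure_pmf.prob_le_1] in auto)
      also have "\<dots> \<le> \<psi> l (cyl L y' R) + eps l" unfolding \<psi>_def by (rule inv)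
      finally show ?thesis .
    qed
    have "(eps \<longlongrightarrow> 0) U" using eps U(2) by (rule tendsto_mono[rotated])
    then have r: "((\<lambda>l. \<psi> l (cyl L y' R) + eps l) \<longlongrightarrow> m (cyl L y' R) + 0) U"
      by (intro tendsto_add lim)
    have "((\<lambda>l. \<Sum>y\<in>Z. \<psi> l (cyl L y (Suc R)) * pmf (K L y) y')
        \<longlongrightarrow> (\<Sum>y\<in>Z. m (cyl L y (Suc R)) * pmf (K L y) y')) U"
      by (intro tendsto_intros lim)
    from tendsto_le[OF Ubot r this] l show ?thesis by simp
  qed
  have main: "ergodic_face P P' B B' L \<and> (\<forall>C. M L (face_proj L -` C) = w L * measure (\<pi> L) C)"
    if wp: "w L > 0" for L
  proof -
    obtain \<nu> where \<nu>: "\<And>C. M L (face_proj L -` C) = w L * measure (measure_pmf \<nu>) C"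
      using fin_additive_tight_image[OF M(1), of L "face_proj L"] wp tight[of _ L] unfolding w_def by blast
    have \<nu>1: "M L (face_proj L -` {y}) = w L * pmf \<nu> y" for y by (simp add: \<nu> measure_pmf_single)
    have E: "set_pmf \<nu> \<subseteq> face_states L"
    proof -
      have "M L (face_proj L -` (- face_states L)) = M L {}"
        by (rule arg_cong[where f="M L"])
          (simp add: set_eq_iff vimage_def face_proj_states del: split_paired_All)
      then have "w L * measure \<nu> (- face_states L) = 0"
        by (simp add: \<nu> fin_additive_empty[OF M(1)])
      then have "measure \<nu> (- face_states L) = 0" using wp by simp
      then show ?thesis by (auto simp: measure_pmf_zero_iff)
    qed
    have fsub: "(\<Sum>y\<in>Z. pmf \<nu> y * pmf (K L y) y') \<le> pmf \<nu> y'" if Z: "finite Z" for Z y'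
    proof -
      have "(\<lambda>R. \<Sum>L'\<in>UNIV. M L' (cyl L y' R)) \<longlonglongrightarrow> (\<Sum>L'\<in>UNIV. if L' = L then w L * pmf \<nu> y' else 0)"
      proof (rule tendsto_sum)
        fix L' :: "'n set"
        show "(\<lambda>R. M L' (cyl L y' R)) \<longlonglongrightarrow> (if L' = L then w L * pmf \<nu> y' else 0)"
        proof (cases "L' = L")
          case True
          have "M L (cyl L y' R) = M L (face_proj L -` {y'})" for R
            by (rule M_eq[of _ R]) (auto simp: cyl_def)
          then show ?thesis using True by (simp add: \<nu>1)
        next
          case False
          show ?thesis
          proof (cases "L \<subseteq> L'")
            case True
            then obtain i where i: "i \<in> L'" "i \<notin> L" using False by auto
            have "M L' (cyl L y' R) \<le> M L' {z. snd z i < Suc (snd y' i)}" for R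
              using i by (intro fin_additive_mono[OF M(1)]) (auto simp: cyl_def face_proj_def)
            then have "M L' (cyl L y' R) = 0" for R
              by (intro fin_additive_eq_0_if_le[OF M(1)]) (simp add: M_inf[OF i(1)])
            then show ?thesis using False by simp
          next
            case no: False
            then obtain i where i: "i \<in> L" "i \<notin> L'" by auto
            have "(\<lambda>R. M L' (cyl L y' R)) \<longlonglongrightarrow> 0"
              by (rule tendsto_0_submeasure[OF M_tight[OF i(2)]])
                 (use i in \<open>auto simp: cyl_def fin_additive_nonneg[OF M(1)] intro!: fin_additive_mono[OF M(1)]\<close>)
            then show ?thesis using False by simp
          qed
        qed
      qed
      then have rlim: "(\<lambda>R. m (cyl L y' R)) \<longlonglongrightarrow> w L * pmf \<nu> y'" by (simp add: M(2))
      have "(\<Sum>y\<in>Z. (w L * pmf \<nu> y) * pmf (K L y) y') \<le> m (cyl L y' R)" for R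
      proof (rule order_trans[OF sum_mono sub[OF Z]])
        fix y
        have "w L * pmf \<nu> y = M L (cyl L y (Suc R))"
          unfolding \<nu>1[symmetric] by (rule M_eq[of _ "Suc R"]) (auto simp: cyl_def)
        also have "\<dots> \<le> m (cyl L y (Suc R))" by (rule M_le)
        finally show "(w L * pmf \<nu> y) * pmf (K L y) y' \<le> m (cyl L y (Suc R)) * pmf (K L y) y'"
          by (rule mult_right_mono) simp
      qed
      then have "(\<Sum>y\<in>Z. (w L * pmf \<nu> y) * pmf (K L y) y') \<le> w L * pmf \<nu> y'"
        by (intro LIMSEQ_le_const[OF rlim]) blast
      then have "w L * (\<Sum>y\<in>Z. pmf \<nu> y * pmf (K L y) y') \<le> w L * pmf \<nu> y'"
        by (simp add: sum_distrib_left mult.assoc)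
      then show ?thesis using wp by simp
    qed
    have le: "pmf (bind_pmf \<nu> (K L)) y' \<le> pmf \<nu> y'" for y'
    proof (rule field_le_epsilon)
      fix e :: real assume "e > 0"
      then obtain Z where Z: "finite Z" "M L (face_proj L -` (- Z)) < w L * e"
        using tight[of "w L * e" L] wp by auto
      then have Ze: "measure \<nu> (- Z) < e" using wp by (simp add: \<nu>)
      have "pmf (bind_pmf \<nu> (K L)) y' = ?E \<nu> (\<lambda>y. pmf (K L y) y')" by (rule pmf_bind)
      also have "\<dots> \<le> ?E \<nu> (\<lambda>y. pmf (K L y) y' * indicator Z y + indicator (- Z) y)"
        by (intro integral_mono integrable_pmf_bounded[where c=1])
           (auto simp: indicator_def pmf_le_1)
      also have "\<dots> = ?E \<nu> (\<lambda>y. pmf (K L y) y' * indicator Z y) + measure \<nu> (- Z)"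
        by (subst Bochner_Integration.integral_add)
           (auto intro!: integrable_pmf_bounded[where c=1] simp: indicator_def pmf_le_1)
      also have "?E \<nu> (\<lambda>y. pmf (K L y) y' * indicator Z y) = (\<Sum>y\<in>Z. pmf \<nu> y * pmf (K L y) y')"
        by (subst integral_measure_pmf[OF Z(1)]) (auto simp: indicator_def split: if_splits)
      also have "\<dots> \<le> pmf \<nu> y'" by (rule fsub[OF Z(1)])
      finally show "pmf (bind_pmf \<nu> (K L)) y' \<le> pmf \<nu> y' + e" using Ze by simp
    qed
    have inv\<nu>: "bind_pmf \<nu> (K L) = \<nu>"
    proof (rule ccontr)
      assume "bind_pmf \<nu> (K L) \<noteq> \<nu>"
      then obtain y where "pmf \<nu> y < pmf (bind_pmf \<nu> (K L)) y" using pmf_neq_exists_less by metis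
      with le[of y] show False by simp
    qed
    have "ergodic_chain (face_states L) (K L)"
      by (rule ergodic_chain_if_invariant_pmf[OF irreducible aperiodic E inv\<nu>])
    moreover have "\<pi> L = \<nu>"
      unfolding face_pmf_def by (rule stationary_pmf_eq[OF irreducible E inv\<nu>])
    ultimately show ?thesis by (simp add: ergodic_face_def \<nu>)
  qed
  show thesis
  proof (rule that[of w])
    show "0 \<le> w L" for L by (rule w)
    show "ergodic_face P P' B B' L" if "w L > 0" for L using main[OF that] by blast
    fix A :: "('n \<times> ('n \<Rightarrow> nat)) set" and A' and R :: nat
    assume A: "\<And>L z. \<forall>i\<in>L. R \<le> snd z i \<Longrightarrow> z \<in> A \<longleftrightarrow> face_proj L z \<in> A' L"
    have "M L A = w L * measure (\<pi> L) (A' L)" for L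
    proof (cases "w L > 0")
      case True
      have "M L A = M L (face_proj L -` A' L)"
        by (rule M_eq[of _ R]) (simp add: A)
      then show ?thesis using main[OF True] by simp
    next
      case False
      then have "w L = 0" using w[of L] by simp
      moreover from this have "M L A = 0"
        using fin_additive_mono[OF M(1), of A UNIV L] fin_additive_nonneg[OF M(1), of L A] by (simp add: w_def)
      ultimately show ?thesis by simp
    qed
    then have "m A = (\<Sum>L\<in>UNIV. w L * measure (\<pi> L) (A' L))" by (simp add: M(2))
    then show "((\<lambda>l. ?E (\<mu> l) (\<lambda>z. g l z * indicator A z)) \<longlongrightarrow> (\<Sum>L\<in>UNIV. w L * measure (\<pi> L) (A' L))) U"
      using lim[of A] by (simp add: \<psi>_def)
  qed
qed

end

section \<open>Occupation measures\<close>

definition occupation :: "('s \<Rightarrow> 's pmf) \<Rightarrow> 's \<Rightarrow> nat \<Rightarrow> 's pmf" where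
  "occupation K z k = bind_pmf (pmf_of_set {..<k}) (\<lambda>m. nsteps K m z)"

lemma expectation_occupation:
  fixes f :: "'s \<Rightarrow> real"
  assumes "k > 0" "\<And>x. \<bar>f x\<bar> \<le> c"
  shows "measure_pmf.expectation (occupation K z k) f
    = (\<Sum>m<k. measure_pmf.expectation (nsteps K m z) f) / real k"
proof -
  have "measure_pmf.expectation (occupation K z k) f
      = measure_pmf.expectation (pmf_of_set {..<k}) (\<lambda>m. measure_pmf.expectation (nsteps K m z) f)"
    unfolding occupation_def by (rule expectation_bind_bounded[OF assms(2)])
  also have "\<dots> = (\<Sum>m<k. measure_pmf.expectation (nsteps K m z) f) / real k"
    using assms(1) by (subst integral_pmf_of_set) (auto simp: lessThan_empty_iff)
  finally show ?thesis .
qed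

lemma occupation_almost_invariant:
  fixes f :: "'s \<Rightarrow> real"
  assumes k: "k > 0" and f: "\<And>x. 0 \<le> f x" "\<And>x. f x \<le> 1"
  shows "measure_pmf.expectation (occupation K z k) (\<lambda>x. measure_pmf.expectation (K x) f)
    \<le> measure_pmf.expectation (occupation K z k) f + 1 / real k"
proof -
  let ?e = "\<lambda>m. measure_pmf.expectation (nsteps K m z) f"
  have bd: "\<bar>f x\<bar> \<le> 1" for x using f by simp
  have bd2: "\<bar>measure_pmf.expectation (K x) f\<bar> \<le> 1" for x by (rule expectation_abs_bound[OF bd])
  have "measure_pmf.expectation (occupation K z k) (\<lambda>x. measure_pmf.expectation (K x) f)
      = (\<Sum>m<k. ?e (Suc m)) / real k"
    by (simp only: expectation_occupation[OF k bd2] nsteps_Suc_right expectation_bind_bounded[OF bd])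
  also have "(\<Sum>m<k. ?e (Suc m)) = (\<Sum>m<k. ?e m) + (?e k - ?e 0)"
    using sum_lessThan_telescope[of ?e k] by (simp only: sum_subtractf)
  also have "\<dots> \<le> (\<Sum>m<k. ?e m) + 1"
    using expectation_abs_bound[of f 1 "nsteps K k z", OF bd] f(1)[of z] by simp
  finally show ?thesis
    using k by (simp add: expectation_occupation[OF k bd] divide_right_mono add_divide_distrib[symmetric])
qed

text \<open>A nonnegative function cannot decrease on average for long.\<close>

lemma occupation_lyapunov:
  fixes h u :: "'s \<Rightarrow> real"
  assumes k: "k > 0" and h: "\<And>x. 0 \<le> h x" and hi: "\<And>x. integrable (measure_pmf (K x)) h"
    and step: "\<And>x. measure_pmf.expectation (K x) h \<le> h x + u x" and u: "\<And>x. \<bar>u x\<bar> \<le> c"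
  shows "- h z / real k \<le> measure_pmf.expectation (occupation K z k) u"
proof -
  let ?E = "\<lambda>m. measure_pmf.expectation (nsteps K m z)"
  have ui: "integrable (measure_pmf p) u" for p by (rule integrable_pmf_bounded[OF u])
  have *: "integrable (nsteps K m z) h \<and> ?E m h \<le> h z + (\<Sum>j<m. ?E j u)" for m
  proof (induction m)
    case 0
    show ?case by (simp add: integrable_measure_pmf_finite)
  next
    case (Suc m)
    have i2: "integrable (nsteps K m z) (\<lambda>x. measure_pmf.expectation (K x) h)"
    proof (rule Bochner_Integration.integrable_bound)
      show "integrable (nsteps K m z) (\<lambda>x. h x + c)" using Suc by simp
      have "measure_pmf.expectation (K x) h \<le> h x + c" for x
        using step[of x] u[of x] by (simp add: abs_le_iff)
      moreover have "0 \<le> measure_pmf.expectation (K x) h" for x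
        by (rule Bochner_Integration.integral_nonneg) (rule h)
      ultimately show "AE x in nsteps K m z. norm (measure_pmf.expectation (K x) h) \<le> norm (h x + c)"
        by (intro AE_I2) (simp add: order_trans[OF _ abs_ge_self])
    qed simp
    note b = expectation_bind_nonneg[of h K "nsteps K m z", OF h hi i2, folded nsteps_Suc_right]
    have "?E (Suc m) h = ?E m (\<lambda>x. measure_pmf.expectation (K x) h)" by (rule b(2))
    also have "\<dots> \<le> ?E m (\<lambda>x. h x + u x)"
      using Suc ui by (intro integral_mono i2 step) auto
    also have "\<dots> = ?E m h + ?E m u" using Suc ui by simp
    also have "\<dots> \<le> h z + (\<Sum>j<Suc m. ?E j u)" using Suc by simp
    finally show ?case using b(1) by simp
  qed
  have "0 \<le> ?E k h" by (rule Bochner_Integration.integral_nonneg) (rule h)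
  with *[of k] have "- h z \<le> (\<Sum>j<k. ?E j u)" by simp
  then show ?thesis unfolding expectation_occupation[OF k u] by (rule divide_right_mono) simp
qed

section \<open>The smoothed maximum\<close>

definition softmax :: "real \<Rightarrow> ('n::finite \<Rightarrow> real) \<Rightarrow> 'n \<Rightarrow> real" where
  "softmax \<beta> a i = exp (\<beta> * a i) / (\<Sum>j\<in>UNIV. exp (\<beta> * a j))"

definition smooth_max :: "real \<Rightarrow> ('n::finite \<Rightarrow> real) \<Rightarrow> real" where
  "smooth_max \<beta> a = ln (\<Sum>j\<in>UNIV. exp (\<beta> * a j)) / \<beta>"

lemma sum_exp_pos: "0 < (\<Sum>j\<in>(UNIV :: 'n::finite set). exp (f j :: real))"
  by (intro sum_pos) auto

lemma softmax_nonneg: "0 \<le> softmax \<beta> a i"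
  unfolding softmax_def by (intro divide_nonneg_nonneg sum_nonneg) auto

lemma sum_softmax: "(\<Sum>i\<in>UNIV. softmax \<beta> a i) = 1"
  unfolding softmax_def sum_divide_distrib[symmetric]
  using sum_exp_pos[of "\<lambda>j. \<beta> * a j"] by simp

lemma softmax_le_1: "softmax \<beta> a i \<le> 1"
proof -
  have "softmax \<beta> a i \<le> (\<Sum>i\<in>UNIV. softmax \<beta> a i)"
    by (rule member_le_sum) (auto simp: softmax_nonneg)
  then show ?thesis by (simp add: sum_softmax)
qed

lemma softmax_le_exp: "softmax \<beta> a i \<le> exp (\<beta> * (a i - a j))"
proof -
  have "exp (\<beta> * a j) \<le> (\<Sum>j\<in>UNIV. exp (\<beta> * a j))" by (rule member_le_sum) auto
  then have "softmax \<beta> a i \<le> exp (\<beta> * a i) / exp (\<beta> * a j)"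
    unfolding softmax_def by (intro divide_left_mono mult_pos_pos sum_exp_pos) auto
  then show ?thesis by (simp add: exp_diff[symmetric] right_diff_distrib)
qed

lemma le_smooth_max:
  assumes "\<beta> > 0"
  shows "a i \<le> smooth_max \<beta> a"
proof -
  have "exp (\<beta> * a i) \<le> (\<Sum>j\<in>UNIV. exp (\<beta> * a j))" by (rule member_le_sum) auto
  then have "\<beta> * a i \<le> ln (\<Sum>j\<in>UNIV. exp (\<beta> * a j))"
    using sum_exp_pos[of "\<lambda>j. \<beta> * a j"] by (simp add: ln_ge_iff)
  then show ?thesis using assms by (simp add: smooth_max_def field_simps)
qed

text \<open>\<open>smooth_max \<beta>\<close> is convex with gradient \<open>softmax \<beta>\<close>.\<close>

lemma smooth_max_subgradient:
  assumes "\<beta> > 0"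
  shows "smooth_max \<beta> b - smooth_max \<beta> a \<le> (\<Sum>i\<in>UNIV. softmax \<beta> b i * (b i - a i))"
proof -
  let ?t = "\<Sum>i\<in>UNIV. softmax \<beta> b i * (b i - a i)"
  let ?Sa = "\<Sum>i\<in>UNIV. exp (\<beta> * a i)" and ?Sb = "\<Sum>i\<in>UNIV. exp (\<beta> * b i)"
  note pos = sum_exp_pos[of "\<lambda>j. \<beta> * a j"] sum_exp_pos[of "\<lambda>j. \<beta> * b j"]
  have shift: "exp (- \<beta> * t) * exp (x + \<beta> * t) = exp x" for x t
    by (simp add: exp_add[symmetric])
  have r: "softmax \<beta> b i * exp (\<beta> * (a i - b i)) = exp (\<beta> * a i) / ?Sb" for i
    by (simp add: softmax_def exp_add[symmetric] algebra_simps)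
  have e: "(\<Sum>i\<in>UNIV. softmax \<beta> b i * exp (\<beta> * (a i - b i))) = ?Sa / ?Sb"
    unfolding r by (simp add: sum_divide_distrib)
  have "exp (- \<beta> * ?t) * softmax \<beta> b i * (1 + (\<beta> * (a i - b i) + \<beta> * ?t)) \<le> softmax \<beta> b i * exp (\<beta> * (a i - b i))" for i
  proof -
    have "1 + (\<beta> * (a i - b i) + \<beta> * ?t) \<le> exp (\<beta> * (a i - b i) + \<beta> * ?t)" by (rule exp_ge_add_one_self)
    then have "exp (- \<beta> * ?t) * softmax \<beta> b i * (1 + (\<beta> * (a i - b i) + \<beta> * ?t))
        \<le> exp (- \<beta> * ?t) * softmax \<beta> b i * exp (\<beta> * (a i - b i) + \<beta> * ?t)"
      by (intro mult_left_mono) (auto simp: softmax_nonneg)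
    also have "\<dots> = softmax \<beta> b i * (exp (- \<beta> * ?t) * exp (\<beta> * (a i - b i) + \<beta> * ?t))"
      by (simp only: mult.assoc mult.left_commute)
    also have "\<dots> = softmax \<beta> b i * exp (\<beta> * (a i - b i))" by (simp only: shift)
    finally show ?thesis .
  qed
  then have "(\<Sum>i\<in>UNIV. exp (- \<beta> * ?t) * softmax \<beta> b i * (1 + (\<beta> * (a i - b i) + \<beta> * ?t))) \<le> ?Sa / ?Sb"
    unfolding e[symmetric] by (rule sum_mono)
  also have "(\<Sum>i\<in>UNIV. exp (- \<beta> * ?t) * softmax \<beta> b i * (1 + (\<beta> * (a i - b i) + \<beta> * ?t)))
      = exp (- \<beta> * ?t) * (\<Sum>i\<in>UNIV. softmax \<beta> b i * (1 + \<beta> * ?t) - \<beta> * (softmax \<beta> b i * (b i - a i)))"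
    unfolding sum_distrib_left by (intro sum.cong refl) (simp add: algebra_simps)
  also have "(\<Sum>i\<in>UNIV. softmax \<beta> b i * (1 + \<beta> * ?t) - \<beta> * (softmax \<beta> b i * (b i - a i)))
      = (\<Sum>i\<in>UNIV. softmax \<beta> b i) * (1 + \<beta> * ?t) - \<beta> * ?t"
    by (simp only: sum_subtractf sum_distrib_right sum_distrib_left)
  finally have "exp (- \<beta> * ?t) \<le> ?Sa / ?Sb" by (simp add: sum_softmax)
  then have "- \<beta> * ?t \<le> ln (?Sa / ?Sb)" using pos by (simp add: ln_ge_iff)
  then have "ln ?Sb - ln ?Sa \<le> \<beta> * ?t" using pos by (simp add: ln_div)
  then show ?thesis using assms
    by (simp add: smooth_max_def diff_divide_distrib[symmetric] divide_le_eq mult.commute)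
qed

lemma softmax_lipschitz:
  assumes b: "\<beta> \<ge> 0" and c: "\<And>j. \<bar>b j - a j\<bar> \<le> c"
  shows "\<bar>softmax \<beta> b i - softmax \<beta> a i\<bar> \<le> 2 * \<beta> * c"
proof -
  have *: "softmax \<beta> y i - softmax \<beta> x i \<le> 2 * \<beta> * c" if xy: "\<And>j. \<bar>y j - x j\<bar> \<le> c" for x y
  proof -
    have le: "exp (\<beta> * x j) \<le> exp (\<beta> * c) * exp (\<beta> * y j)" "exp (\<beta> * y j) \<le> exp (\<beta> * c) * exp (\<beta> * x j)" for j
    proof -
      have "\<beta> * x j \<le> \<beta> * (c + y j)" "\<beta> * y j \<le> \<beta> * (c + x j)"
        using xy[of j] b by (auto intro!: mult_left_mono simp: abs_le_iff)
      then show "exp (\<beta> * x j) \<le> exp (\<beta> * c) * exp (\<beta> * y j)" "exp (\<beta> * y j) \<le> exp (\<beta> * c) * exp (\<beta> * x j)"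
        unfolding exp_add[symmetric] by (simp_all add: distrib_left)
    qed
    let ?Sx = "\<Sum>j\<in>UNIV. exp (\<beta> * x j)" and ?Sy = "\<Sum>j\<in>UNIV. exp (\<beta> * y j)"
    note pos = sum_exp_pos[of "\<lambda>j. \<beta> * x j"] sum_exp_pos[of "\<lambda>j. \<beta> * y j"]
    have S: "?Sx \<le> exp (\<beta> * c) * ?Sy" unfolding sum_distrib_left by (intro sum_mono le)
    \<comment> \<open>Numerator and denominator of \<open>softmax\<close> each change by a factor of at most \<open>exp (\<beta> * c)\<close>.\<close>
    have "exp (- (2 * \<beta> * c)) * softmax \<beta> y i = (exp (- (\<beta> * c)) * exp (\<beta> * y i)) / (exp (\<beta> * c) * ?Sy)"
      by (simp add: softmax_def exp_minus field_simps exp_add[symmetric])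
    also have "\<dots> \<le> exp (\<beta> * x i) / ?Sx"
      using le(2)[of i] S pos by (intro frac_le) (auto simp: exp_minus field_simps)
    finally have 1: "exp (- (2 * \<beta> * c)) * softmax \<beta> y i \<le> softmax \<beta> x i" by (simp add: softmax_def)
    have "(1 - 2 * \<beta> * c) * softmax \<beta> y i \<le> exp (- (2 * \<beta> * c)) * softmax \<beta> y i"
      using exp_ge_add_one_self[of "- (2 * \<beta> * c)"] by (intro mult_right_mono softmax_nonneg) simp
    with 1 have "softmax \<beta> y i - softmax \<beta> x i \<le> 2 * \<beta> * c * softmax \<beta> y i"
      by (simp add: algebra_simps)
    also have "\<dots> \<le> 2 * \<beta> * c * 1"
      using b order_trans[OF abs_ge_zero xy[of i]] by (intro mult_left_mono softmax_le_1) auto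
    finally show ?thesis by simp
  qed
  have "\<bar>a j - b j\<bar> \<le> c" for j using c[of j] by (simp add: abs_minus_commute)
  then show ?thesis using *[of b a] *[of a b] c by (simp add: abs_le_iff)
qed

section \<open>The Lyapunov function\<close>

context polling
begin

definition scaled :: "'n \<times> ('n \<Rightarrow> nat) \<Rightarrow> 'n \<Rightarrow> real" where
  "scaled z i = real (snd z i) / lam i"

text \<open>
  Divided by \<open>lam i\<close>, the \<open>i\<close>-th drift form is \<open>scaled i + common\<close>. The second summand is the same for
  all \<open>i\<close>, so the largest of these forms belongs to the queue with the largest scaled length, which is a
  long one. The Lyapunov function is a smooth version of this maximum.
\<close>

definition common :: "'n \<times> ('n \<Rightarrow> nat) \<Rightarrow> real" where
  "common z = (\<Sum>j\<in>UNIV. real (snd z j) * (\<tau> j - \<tau>' j)) / (1 - \<rho>)"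

definition lyapunov :: "real \<Rightarrow> 'n \<times> ('n \<Rightarrow> nat) \<Rightarrow> real" where
  "lyapunov \<beta> z = smooth_max \<beta> (scaled z) + common z"

definition scaled_drift_form :: "'n \<Rightarrow> 'n \<Rightarrow> bool \<Rightarrow> real" where
  "scaled_drift_form i s u = drift_form lam \<tau> \<tau>' i (\<lambda>q. drift q s u) / lam i"

text \<open>
  With \<open>m\<close> the largest scaled queue length, \<open>(1 - \<rho>) * (m + common z)\<close> is \<open>m\<close> minus the sum of
  \<open>(m - scaled z j) * lam j * (\<tau> j - \<tau>' j)\<close>, and this sum is at most \<open>m\<close> times the load.
\<close>

lemma lyapunov_nonneg:
  assumes "\<beta> > 0" "\<rho> < 1" and load: "(\<Sum>i\<in>UNIV. lam i * \<tau> i) \<le> 1"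
  shows "0 \<le> lyapunov \<beta> z"
proof -
  define m where "m = Max (range (scaled z))"
  have le: "scaled z j \<le> m" for j unfolding m_def by (rule Max_ge) auto
  have "m \<in> range (scaled z)" unfolding m_def by (rule Max_in) auto
  then have ms: "m \<le> smooth_max \<beta> (scaled z)" using le_smooth_max[OF assms(1)] by auto
  have s0: "0 \<le> scaled z j" for j using lam_pos[of j] by (simp add: scaled_def)
  then have m0: "0 \<le> m" using le order_trans by blast
  have x: "real (snd z j) = lam j * scaled z j" for j using lam_pos[of j] by (simp add: scaled_def)
  have "(1 - \<rho>) * (m + common z) = m * (1 - \<rho>) + (\<Sum>j\<in>UNIV. real (snd z j) * (\<tau> j - \<tau>' j))"
    using assms(2) by (simp add: common_def field_simps)
  also have "\<dots> = m - (\<Sum>j\<in>UNIV. (m - scaled z j) * lam j * (\<tau> j - \<tau>' j))"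
  proof -
    have "(\<Sum>j\<in>UNIV. (m - scaled z j) * lam j * (\<tau> j - \<tau>' j))
        = m * \<rho> - (\<Sum>j\<in>UNIV. real (snd z j) * (\<tau> j - \<tau>' j))"
      unfolding rho_hat_def sum_distrib_left sum_subtractf[symmetric]
      by (intro sum.cong refl) (simp add: x algebra_simps)
    then show ?thesis by (simp add: algebra_simps)
  qed
  also have "\<dots> \<ge> m - (\<Sum>j\<in>UNIV. m * (lam j * \<tau> j))"
  proof -
    have "(m - scaled z j) * lam j * (\<tau> j - \<tau>' j) \<le> m * (lam j * \<tau> j)" for j
    proof -
      have "(m - scaled z j) * lam j * (\<tau> j - \<tau>' j) \<le> (m - scaled z j) * lam j * \<tau> j"
        using le[of j] nonneg[of j] by (intro mult_left_mono) auto
      also have "\<dots> \<le> m * (lam j * \<tau> j)"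
        using s0[of j] nonneg[of j] unfolding mult.assoc by (intro mult_right_mono) auto
      finally show ?thesis .
    qed
    then show ?thesis by (intro diff_left_mono sum_mono)
  qed
  also have "m - (\<Sum>j\<in>UNIV. m * (lam j * \<tau> j)) \<ge> 0"
    using mult_left_mono[OF load m0] by (simp add: sum_distrib_left[symmetric])
  finally have "0 \<le> (1 - \<rho>) * (m + common z)" .
  then have "0 \<le> m + common z" using assms(2) by (simp add: zero_le_mult_iff)
  then show ?thesis using ms by (simp add: lyapunov_def)
qed

definition jump :: "'n \<times> ('n \<Rightarrow> nat) \<Rightarrow> 'n \<times> ('n \<Rightarrow> nat) \<Rightarrow> real" where
  "jump z z' = (\<Sum>q\<in>UNIV. \<bar>scaled z' q - scaled z q\<bar>)"

text \<open>
  Bounds the jump caused by the arrivals \<open>b\<close>, uniformly in the state; the 1 accounts for a departure.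
\<close>

definition jump_size :: "('n \<Rightarrow> nat) \<Rightarrow> real" where
  "jump_size b = (\<Sum>q\<in>UNIV. (real (b q) + 1) / lam q)"

text \<open>The sum over all finitely many arrival laws bounds the mean over any of them.\<close>

definition worst_mean :: "(real \<Rightarrow> real) \<Rightarrow> real" where
  "worst_mean G = (\<Sum>s\<in>UNIV. \<Sum>u\<in>UNIV. \<Sum>t\<in>UNIV. measure_pmf.expectation (arrive u s t) (\<lambda>b. G (jump_size b)))"

lemma jump_nonneg: "0 \<le> jump z z'"
  by (simp add: jump_def sum_nonneg)

lemma jump_component: "\<bar>scaled z' q - scaled z q\<bar> \<le> jump z z'"
  unfolding jump_def by (rule member_le_sum) auto

lemma jump_size_nonneg: "0 \<le> jump_size b"
  unfolding jump_size_def by (intro sum_nonneg divide_nonneg_nonneg) (auto simp: nonneg)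

lemma jump_le_jump_size: "jump z (t, next_queues {} z b) \<le> jump_size b"
  unfolding jump_def jump_size_def
proof (rule sum_mono)
  fix q
  have "\<bar>real (next_queues {} z b q) - real (snd z q)\<bar> \<le> real (b q) + 1"
    by (subst next_queues_real) auto
  then have "\<bar>real (next_queues {} z b q) - real (snd z q)\<bar> / lam q \<le> (real (b q) + 1) / lam q"
    using lam_pos[of q] by (intro divide_right_mono) auto
  then show "\<bar>scaled (t, next_queues {} z b) q - scaled z q\<bar> \<le> (real (b q) + 1) / lam q"
    using lam_pos[of q] by (simp add: scaled_def diff_divide_distrib[symmetric])
qed

lemma jump_size_integrable: "integrable (measure_pmf (arrive u s t)) jump_size"
  unfolding jump_size_def using arrive_integrable by (intro Bochner_Integration.integrable_sum) simp

lemma jump_mean_le: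
  assumes G: "\<And>r r'. 0 \<le> r \<Longrightarrow> r \<le> r' \<Longrightarrow> G r \<le> G r'" "\<And>r. 0 \<le> r \<Longrightarrow> 0 \<le> G r"
    "\<And>r. 0 \<le> r \<Longrightarrow> G r \<le> r"
  shows "integrable (measure_pmf (K {} z)) (\<lambda>z'. G (jump z z'))"
    and "measure_pmf.expectation (K {} z) (\<lambda>z'. G (jump z z')) \<le> worst_mean G"
proof -
  let ?u = "busy {} z" and ?s = "fst z"
  have bd: "G (jump z (t, next_queues {} z b)) \<le> jump_size b" for t b
    using G(3)[OF jump_nonneg] jump_le_jump_size order_trans by blast
  have i: "integrable (measure_pmf (arrive ?u ?s t)) (\<lambda>b. G (jump z (t, next_queues {} z b)))" for t
    by (rule Bochner_Integration.integrable_bound[OF jump_size_integrable])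
       (use bd G(2)[OF jump_nonneg] jump_size_nonneg in auto)
  show "integrable (measure_pmf (K {} z)) (\<lambda>z'. G (jump z z'))" by (rule expectation_K(1)[OF i])
  have i2: "integrable (measure_pmf (arrive u s t)) (\<lambda>b. G (jump_size b))" for u s t
    by (rule Bochner_Integration.integrable_bound[OF jump_size_integrable])
       (use G(2,3) jump_size_nonneg in auto)
  let ?m = "\<lambda>s u t. measure_pmf.expectation (arrive u s t) (\<lambda>b. G (jump_size b))"
  have nn: "0 \<le> ?m s u t" for s u t
    using G(2) jump_size_nonneg by (intro Bochner_Integration.integral_nonneg) auto
  have "measure_pmf.expectation (K {} z) (\<lambda>z'. G (jump z z')) \<le> (\<Sum>t\<in>UNIV. 1 * ?m ?s ?u t)"
    unfolding expectation_K(2)[OF i]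
  proof (intro sum_mono mult_mono)
    fix t
    show "measure_pmf.expectation (arrive ?u ?s t) (\<lambda>b. G (jump z (t, next_queues {} z b))) \<le> ?m ?s ?u t"
      by (intro integral_mono i i2 G(1) jump_nonneg jump_le_jump_size)
    show "0 \<le> measure_pmf.expectation (arrive ?u ?s t) (\<lambda>b. G (jump z (t, next_queues {} z b)))"
      using G(2) jump_nonneg by (intro Bochner_Integration.integral_nonneg) auto
  qed (auto simp: pmf_le_1)
  also have "\<dots> \<le> (\<Sum>u\<in>UNIV. \<Sum>t\<in>UNIV. ?m ?s u t)"
    using nn by (simp, intro member_le_sum[where f="\<lambda>u. \<Sum>t\<in>UNIV. ?m ?s u t"]) (auto intro!: sum_nonneg)
  also have "\<dots> \<le> worst_mean G"
    unfolding worst_mean_def using nn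
    by (intro member_le_sum[where f="\<lambda>s. \<Sum>u\<in>UNIV. \<Sum>t\<in>UNIV. ?m s u t"]) (auto intro!: sum_nonneg)
  finally show "measure_pmf.expectation (K {} z) (\<lambda>z'. G (jump z z')) \<le> worst_mean G" .
qed

text \<open>
  The error of the linear approximation of \<open>smooth_max \<beta>\<close>, for each queue, in a step of size \<open>r\<close>: the
  weights change by at most \<open>min 1 (2 * \<beta> * r)\<close>, and they multiply increments of size at most \<open>r\<close>.
\<close>

definition curvature :: "real \<Rightarrow> real \<Rightarrow> real" where
  "curvature \<beta> r = min 1 (2 * \<beta> * r) * r"

text \<open>
  The arrivals need not have second moments, so the error need not be \<open>O(\<beta>)\<close>; it vanishes with \<open>\<beta>\<close> by
  dominated convergence.
\<close>

lemma worst_mean_curvature: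
  assumes "\<beta> \<longlonglongrightarrow> 0" "\<And>l :: nat. 0 \<le> \<beta> l"
  shows "(\<lambda>l. worst_mean (curvature (\<beta> l))) \<longlonglongrightarrow> 0"
proof -
  have "(\<lambda>l. measure_pmf.expectation (arrive u s t) (\<lambda>b. curvature (\<beta> l) (jump_size b))) \<longlonglongrightarrow> 0" for s u t
  proof -
    have "(\<lambda>l. curvature (\<beta> l) r) \<longlonglongrightarrow> min 1 (2 * 0 * r) * r" for r
      unfolding curvature_def by (intro tendsto_intros assms)
    then have "(\<lambda>l. measure_pmf.expectation (arrive u s t) (\<lambda>b. curvature (\<beta> l) (jump_size b)))
        \<longlonglongrightarrow> measure_pmf.expectation (arrive u s t) (\<lambda>b. 0)"
      using assms(2) jump_size_nonneg
      by (intro integral_dominated_convergence[where w=jump_size] jump_size_integrable)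
         (auto simp: curvature_def abs_mult intro!: mult_left_le_one_le)
    then show ?thesis by simp
  qed
  then have "(\<lambda>l. worst_mean (curvature (\<beta> l))) \<longlonglongrightarrow> (\<Sum>s\<in>(UNIV :: 'n set). \<Sum>u\<in>(UNIV :: bool set). \<Sum>t\<in>(UNIV :: 'n set). 0)"
    unfolding worst_mean_def by (intro tendsto_sum)
  then show ?thesis by simp
qed

text \<open>
  By convexity the increment is at most the one linearised at the new state. Moving the weights back to
  the old state makes the main term the combination of the drift forms with the old weights.
\<close>

lemma lyapunov_increment:
  assumes b: "\<beta> > 0"
  shows "lyapunov \<beta> z' - lyapunov \<beta> z
    \<le> (\<Sum>i\<in>UNIV. softmax \<beta> (scaled z) i * (drift_form lam \<tau> \<tau>' i (\<lambda>q. real (snd z' q) - real (snd z q)) / lam i))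
      + real CARD('n) * curvature \<beta> (jump z z')"
proof -
  let ?a = "scaled z" and ?a' = "scaled z'"
  have form: "drift_form lam \<tau> \<tau>' i (\<lambda>q. real (snd z' q) - real (snd z q)) / lam i
      = (?a' i - ?a i) + (common z' - common z)" for i
  proof -
    have cancel: "lam i * S / c / lam i = S / c" for S c
      using lam_pos[of i] by (simp only: times_divide_eq_right[symmetric]) simp
    show ?thesis
      unfolding drift_form_def common_def scaled_def left_diff_distrib sum_subtractf add_divide_distrib cancel
        diff_divide_distrib ..
  qed
  have e: "(\<Sum>i\<in>UNIV. softmax \<beta> ?a i * ((?a' i - ?a i) + (common z' - common z)))
      = (\<Sum>i\<in>UNIV. softmax \<beta> ?a i * (?a' i - ?a i)) + (common z' - common z)"
    by (simp add: distrib_left sum.distrib sum_distrib_right[symmetric] sum_softmax)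
  have c: "softmax \<beta> ?a' i * (?a' i - ?a i) \<le> softmax \<beta> ?a i * (?a' i - ?a i) + curvature \<beta> (jump z z')" for i
  proof -
    have "\<bar>softmax \<beta> ?a' i - softmax \<beta> ?a i\<bar> \<le> min 1 (2 * \<beta> * jump z z')"
      using softmax_lipschitz[of \<beta> ?a' ?a "jump z z'" i] b jump_component[of z' _ z]
        softmax_nonneg[of \<beta> ?a i] softmax_nonneg[of \<beta> ?a' i] softmax_le_1[of \<beta> ?a i] softmax_le_1[of \<beta> ?a' i]
      by auto
    then have "\<bar>softmax \<beta> ?a' i - softmax \<beta> ?a i\<bar> * \<bar>?a' i - ?a i\<bar> \<le> min 1 (2 * \<beta> * jump z z') * jump z z'"
      using b jump_nonneg jump_component by (intro mult_mono) auto
    then have "(softmax \<beta> ?a' i - softmax \<beta> ?a i) * (?a' i - ?a i) \<le> curvature \<beta> (jump z z')"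
      unfolding curvature_def abs_mult[symmetric] by (rule order_trans[OF abs_ge_self])
    then show ?thesis by (simp add: left_diff_distrib)
  qed
  have "lyapunov \<beta> z' - lyapunov \<beta> z \<le> (\<Sum>i\<in>UNIV. softmax \<beta> ?a' i * (?a' i - ?a i)) + (common z' - common z)"
    using smooth_max_subgradient[OF b, of ?a' ?a] by (simp add: lyapunov_def)
  also have "(\<Sum>i\<in>UNIV. softmax \<beta> ?a' i * (?a' i - ?a i))
      \<le> (\<Sum>i\<in>UNIV. softmax \<beta> ?a i * (?a' i - ?a i) + curvature \<beta> (jump z z'))"
    by (intro sum_mono c)
  finally show ?thesis unfolding form e by (simp add: sum.distrib)
qed

lemma mean_drift_form:
  "integrable (measure_pmf (K {} z)) (\<lambda>z'. drift_form lam \<tau> \<tau>' i (\<lambda>q. real (snd z' q) - real (snd z q)))"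
  "measure_pmf.expectation (K {} z) (\<lambda>z'. drift_form lam \<tau> \<tau>' i (\<lambda>q. real (snd z' q) - real (snd z q)))
     = lam i * scaled_drift_form i (fst z) (busy {} z)"
proof -
  have q: "integrable (measure_pmf (K {} z)) (\<lambda>z'. real (snd z' q) - real (snd z q))"
    "measure_pmf.expectation (K {} z) (\<lambda>z'. real (snd z' q) - real (snd z q)) = drift q (fst z) (busy {} z)" for q
    using queue_mean[of q "{}" z] by simp_all
  show "integrable (measure_pmf (K {} z)) (\<lambda>z'. drift_form lam \<tau> \<tau>' i (\<lambda>q. real (snd z' q) - real (snd z q)))"
    unfolding drift_form_def using q(1)
    by (intro Bochner_Integration.integrable_add integrable_divide integrable_mult_right
        Bochner_Integration.integrable_sum integrable_mult_left) auto
  have "measure_pmf.expectation (K {} z) (\<lambda>z'. drift_form lam \<tau> \<tau>' i (\<lambda>q. real (snd z' q) - real (snd z q)))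
      = drift_form lam \<tau> \<tau>' i (\<lambda>q. drift q (fst z) (busy {} z))"
    unfolding drift_form_def q(2)[symmetric] using q(1)
    by (subst Bochner_Integration.integral_add)
       (auto intro!: integrable_divide integrable_mult_right Bochner_Integration.integrable_sum integrable_mult_left
             simp del: Bochner_Integration.integral_diff)
  then show "measure_pmf.expectation (K {} z) (\<lambda>z'. drift_form lam \<tau> \<tau>' i (\<lambda>q. real (snd z' q) - real (snd z q)))
     = lam i * scaled_drift_form i (fst z) (busy {} z)"
    using lam_pos[of i] by (simp add: scaled_drift_form_def)
qed

lemma curvature_props:
  assumes "\<beta> \<ge> 0"
  shows "0 \<le> r \<Longrightarrow> r \<le> r' \<Longrightarrow> curvature \<beta> r \<le> curvature \<beta> r'"
    and "0 \<le> r \<Longrightarrow> 0 \<le> curvature \<beta> r" and "0 \<le> r \<Longrightarrow> curvature \<beta> r \<le> r"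
proof -
  show "0 \<le> r \<Longrightarrow> 0 \<le> curvature \<beta> r" using assms by (simp add: curvature_def)
  show "0 \<le> r \<Longrightarrow> curvature \<beta> r \<le> r" using assms by (simp add: curvature_def mult_left_le_one_le)
  assume r: "0 \<le> r" "r \<le> r'"
  then have "2 * \<beta> * r \<le> 2 * \<beta> * r'" using assms by (intro mult_left_mono) auto
  then have "min 1 (2 * \<beta> * r) \<le> min 1 (2 * \<beta> * r')" by auto
  then show "curvature \<beta> r \<le> curvature \<beta> r'"
    unfolding curvature_def using r assms by (intro mult_mono) auto
qed

lemma lyapunov_step:
  assumes b: "\<beta> > 0" and nn: "\<And>z. 0 \<le> lyapunov \<beta> z"
  shows "integrable (measure_pmf (K {} z)) (lyapunov \<beta>)"
    and "measure_pmf.expectation (K {} z) (lyapunov \<beta>)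
      \<le> lyapunov \<beta> z + ((\<Sum>i\<in>UNIV. softmax \<beta> (scaled z) i * scaled_drift_form i (fst z) (busy {} z))
          + real CARD('n) * worst_mean (curvature \<beta>))"
proof -
  let ?f = "\<lambda>i z'. drift_form lam \<tau> \<tau>' i (\<lambda>q. real (snd z' q) - real (snd z q))"
  let ?r = "\<lambda>z'. (\<Sum>i\<in>UNIV. softmax \<beta> (scaled z) i * (?f i z' / lam i)) + real CARD('n) * curvature \<beta> (jump z z')"
  note cp = curvature_props[OF less_imp_le[OF b]]
  note jm = jump_mean_le[of "curvature \<beta>", OF cp]
  have i1: "integrable (measure_pmf (K {} z)) (\<lambda>z'. softmax \<beta> (scaled z) i * (?f i z' / lam i))" for i
    by (intro integrable_mult_right integrable_divide mean_drift_form(1))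
  have i2: "integrable (measure_pmf (K {} z)) (\<lambda>z'. real CARD('n) * curvature \<beta> (jump z z'))"
    by (intro integrable_mult_right jm(1)) auto
  have ir: "integrable (measure_pmf (K {} z)) ?r"
    by (intro Bochner_Integration.integrable_add Bochner_Integration.integrable_sum i1 i2)
  have le: "lyapunov \<beta> z' \<le> lyapunov \<beta> z + ?r z'" for z'
    using lyapunov_increment[OF b, of z' z] by simp
  show i: "integrable (measure_pmf (K {} z)) (lyapunov \<beta>)"
  proof (rule Bochner_Integration.integrable_bound)
    show "integrable (measure_pmf (K {} z)) (\<lambda>z'. lyapunov \<beta> z + ?r z')" using ir by simp
    show "AE z' in K {} z. norm (lyapunov \<beta> z') \<le> norm (lyapunov \<beta> z + ?r z')"
      using nn le by (intro AE_I2) (simp only: real_norm_def abs_of_nonneg order_trans[OF nn le])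
  qed simp
  have "measure_pmf.expectation (K {} z) (lyapunov \<beta>) \<le> measure_pmf.expectation (K {} z) (\<lambda>z'. lyapunov \<beta> z + ?r z')"
    using ir by (intro integral_mono i le) simp
  also have "\<dots> = lyapunov \<beta> z + measure_pmf.expectation (K {} z) ?r" using ir by simp
  also have "measure_pmf.expectation (K {} z) ?r
      = (\<Sum>i\<in>UNIV. softmax \<beta> (scaled z) i * scaled_drift_form i (fst z) (busy {} z))
        + real CARD('n) * measure_pmf.expectation (K {} z) (\<lambda>z'. curvature \<beta> (jump z z'))"
    using lam_pos
    by (subst Bochner_Integration.integral_add[OF Bochner_Integration.integrable_sum[OF i1] i2],
        subst Bochner_Integration.integral_sum[OF i1])
       (simp add: mean_drift_form(2) less_imp_neq[symmetric])
  also have "measure_pmf.expectation (K {} z) (\<lambda>z'. curvature \<beta> (jump z z')) \<le> worst_mean (curvature \<beta>)"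
    by (rule jm(2)) auto
  finally show "measure_pmf.expectation (K {} z) (lyapunov \<beta>)
      \<le> lyapunov \<beta> z + ((\<Sum>i\<in>UNIV. softmax \<beta> (scaled z) i * scaled_drift_form i (fst z) (busy {} z))
          + real CARD('n) * worst_mean (curvature \<beta>))"
    by (simp add: mult_left_mono)
qed

end

section \<open>Sufficient conditions\<close>

lemma drift_form_sum: "drift_form lam \<tau> \<tau>' i (\<lambda>q. \<Sum>k\<in>A. x k q) = (\<Sum>k\<in>A. drift_form lam \<tau> \<tau>' i (x k))"
proof -
  have "(\<Sum>j\<in>UNIV. (\<Sum>k\<in>A. x k j) * (\<tau> j - \<tau>' j)) = (\<Sum>k\<in>A. \<Sum>j\<in>UNIV. x k j * (\<tau> j - \<tau>' j))"
    unfolding sum_distrib_right by (rule sum.swap)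
  then show ?thesis
    by (simp add: drift_form_def sum.distrib sum_divide_distrib sum_distrib_left)
qed

lemma drift_form_scale: "drift_form lam \<tau> \<tau>' i (\<lambda>q. c * x q) = c * drift_form lam \<tau> \<tau>' i x"
  by (simp add: drift_form_def mult.assoc sum_distrib_left[symmetric] distrib_left)

context polling
begin

lemma scaled_drift_form_mean:
  "(\<Sum>s\<in>UNIV. \<Sum>u\<in>UNIV. occ L s u * scaled_drift_form i s u)
     = drift_form lam \<tau> \<tau>' i (mean_drift L) / lam i"
proof -
  have "mean_drift L = (\<lambda>q. \<Sum>s\<in>UNIV. \<Sum>u\<in>UNIV. occ L s u * drift q s u)"
    by (rule ext) (rule mean_drift_def)
  then have "drift_form lam \<tau> \<tau>' i (mean_drift L)
      = (\<Sum>s\<in>UNIV. \<Sum>u\<in>UNIV. occ L s u * drift_form lam \<tau> \<tau>' i (\<lambda>q. drift q s u))"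
    by (simp only: drift_form_sum drift_form_scale)
  then show ?thesis by (simp add: scaled_drift_form_def sum_divide_distrib)
qed

text \<open>
  At the full face the hypothesis reads \<open>lam i * S < (1 - \<rho>) * server UNIV i\<close> with
  \<open>S = (\<Sum>j. server UNIV j * \<tau>' j)\<close>. Summed with weights \<open>\<tau>' i\<close>, both sides are multiples of \<open>S\<close>, and
  dividing by \<open>S\<close> bounds the sum of the \<open>lam i * \<tau>' i\<close> by \<open>1 - \<rho>\<close>.
\<close>

lemma load_le_1:
  assumes rho: "\<rho> < 1" and neg: "\<And>i. drift_form lam \<tau> \<tau>' i (v UNIV) < 0"
  shows "(\<Sum>i\<in>UNIV. lam i * \<tau> i) \<le> 1"
proof -
  define S where "S = (\<Sum>j\<in>UNIV. server UNIV j * \<tau>' j)"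
  have sv: "0 \<le> server UNIV j" for j by (simp add: server_prob_def)
  have S0: "0 \<le> S" unfolding S_def using sv nonneg by (intro sum_nonneg) auto
  have face: "ergodic_face P P' B B' UNIV" by (simp add: ergodic_face_def)
  have lt: "lam i * S < (1 - \<rho>) * server UNIV i" for i
    using neg[of i] rho drift_form_second_vector_field[OF rho face, of i]
    by (simp add: S_def field_simps)
  have pos: "0 < server UNIV i" for i
  proof -
    have "0 \<le> lam i * S" using S0 nonneg by simp
    then have "0 < (1 - \<rho>) * server UNIV i" using lt[of i] by linarith
    then show ?thesis using rho by (simp add: zero_less_mult_iff)
  qed
  obtain s where s: "\<tau>' s > 0" using ex_idle_time_pos by blast
  have "server UNIV s * \<tau>' s \<le> S"
    unfolding S_def by (rule member_le_sum) (use sv nonneg in auto)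
  then have Sp: "0 < S" using s pos[of s] mult_pos_pos by (metis less_le_trans)
  have "(\<Sum>i\<in>UNIV. lam i * \<tau>' i) * S \<le> (1 - \<rho>) * S"
  proof -
    have "(\<Sum>i\<in>UNIV. lam i * \<tau>' i) * S = (\<Sum>i\<in>UNIV. (lam i * S) * \<tau>' i)"
      unfolding sum_distrib_right by (intro sum.cong refl) (simp add: mult_ac)
    also have "\<dots> \<le> (\<Sum>i\<in>UNIV. ((1 - \<rho>) * server UNIV i) * \<tau>' i)"
      by (intro sum_mono mult_right_mono less_imp_le[OF lt] nonneg)
    also have "\<dots> = (1 - \<rho>) * S" by (simp add: S_def sum_distrib_left mult.assoc)
    finally show ?thesis .
  qed
  then have "(\<Sum>i\<in>UNIV. lam i * \<tau>' i) \<le> 1 - \<rho>" using Sp by simp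
  moreover have "\<rho> = (\<Sum>i\<in>UNIV. lam i * \<tau> i) - (\<Sum>i\<in>UNIV. lam i * \<tau>' i)"
    by (simp add: rho_hat_def right_diff_distrib sum_subtractf)
  ultimately show ?thesis by simp
qed

lemma ergodic_face_empty: "ergodic_face P P' B B' {} \<longleftrightarrow> ergodic_chain UNIV (K {})"
  by (auto simp: ergodic_face_def face_states_empty)

definition box :: "nat \<Rightarrow> ('n \<times> ('n \<Rightarrow> nat)) set" where
  "box M = {z. \<forall>i. snd z i \<le> M}"

text \<open>
  Weighting the time by a slowly varying \<open>g\<close> preserves invariance up to the mean change of \<open>g\<close> in one step.
\<close>

lemma occupation_almost_invariant_set:
  assumes k: "k > 0" and g: "\<And>z. 0 \<le> g z" "\<And>z. g z \<le> 1"
    and lip: "\<And>z z'. \<bar>g z' - g z\<bar> \<le> c * jump z z'" and c: "0 \<le> c"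
  shows "measure_pmf.expectation (occupation (K {}) z0 k) (\<lambda>z. g z * measure (K {} z) A)
    \<le> measure_pmf.expectation (occupation (K {}) z0 k) (\<lambda>z. g z * indicator A z)
      + (1 / real k + c * worst_mean (\<lambda>r. r))"
proof -
  let ?E = "measure_pmf.expectation" and ?o = "occupation (K {}) z0 k"
  let ?f = "\<lambda>z. g z * indicator A z"
  have f: "0 \<le> ?f z" "?f z \<le> 1" for z using g[of z] by (auto simp: indicator_def)
  have fi: "integrable (measure_pmf p) ?f" for p
    by (rule integrable_pmf_bounded[where c=1]) (use f in auto)
  note j = jump_mean_le[of "\<lambda>r. r"]
  have pw: "g z * measure (K {} z) A \<le> ?E (K {} z) ?f + c * worst_mean (\<lambda>r. r)" for z
  proof -
    have "g z * measure (K {} z) A = ?E (K {} z) (\<lambda>z'. g z * indicator A z')" by simp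
    also have "\<dots> \<le> ?E (K {} z) (\<lambda>z'. ?f z' + c * jump z z')"
    proof (rule integral_mono)
      show "integrable (K {} z) (\<lambda>z'. g z * indicator A z')"
        by (intro integrable_mult_right integrable_pmf_bounded[where c=1]) (auto simp: indicator_def)
      show "integrable (K {} z) (\<lambda>z'. ?f z' + c * jump z z')"
        by (intro Bochner_Integration.integrable_add fi integrable_mult_right j(1)) auto
      fix z'
      show "g z * indicator A z' \<le> ?f z' + c * jump z z'"
        using lip[where z=z and z'=z'] c jump_nonneg[of z z'] by (auto simp: indicator_def abs_le_iff)
    qed
    also have "\<dots> = ?E (K {} z) ?f + c * ?E (K {} z) (\<lambda>z'. jump z z')"
      by (subst Bochner_Integration.integral_add) (auto intro!: fi j(1) integrable_mult_right)
    also have "\<dots> \<le> ?E (K {} z) ?f + c * worst_mean (\<lambda>r. r)"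
      by (intro add_left_mono mult_left_mono c j(2)) auto
    finally show ?thesis .
  qed
  have i2: "integrable (measure_pmf p) (\<lambda>z. ?E (K {} z) ?f)" for p
    by (rule integrable_pmf_bounded[where c=1], rule expectation_abs_bound) (use f in auto)
  have "?E ?o (\<lambda>z. g z * measure (K {} z) A) \<le> ?E ?o (\<lambda>z. ?E (K {} z) ?f + c * worst_mean (\<lambda>r. r))"
  proof (rule integral_mono[OF _ _ pw])
    show "integrable ?o (\<lambda>z. g z * measure (K {} z) A)"
      by (rule integrable_pmf_bounded[where c=1]) (use g in \<open>auto simp: abs_mult mult_le_one\<close>)
    show "integrable ?o (\<lambda>z. ?E (K {} z) ?f + c * worst_mean (\<lambda>r. r))" using i2 by simp
  qed
  also have "\<dots> = ?E ?o (\<lambda>z. ?E (K {} z) ?f) + c * worst_mean (\<lambda>r. r)" using i2 by simp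
  also have "?E ?o (\<lambda>z. ?E (K {} z) ?f) \<le> ?E ?o ?f + 1 / real k"
    by (rule occupation_almost_invariant[OF k f])
  finally show ?thesis by simp
qed

text \<open>
  If a bounded set keeps a positive share of the time, the limiting mixture charges the empty face.
\<close>

lemma box_occupation_tendsto_0:
  assumes not: "\<not> ergodic_face P P' B B' {}"
  shows "(\<lambda>k. measure (occupation (K {}) z0 k) (box M)) \<longlonglongrightarrow> 0"
proof (rule ccontr)
  let ?m = "\<lambda>k. measure (occupation (K {}) z0 k) (box M)"
  assume "\<not> ?m \<longlonglongrightarrow> 0"
  then obtain e where e: "e > 0" "\<And>N. \<exists>k\<ge>N. e \<le> ?m k"
    unfolding lim_sequentially by (auto simp: not_less)
  then have "\<forall>l. \<exists>k\<ge>Suc l. e \<le> ?m k" by blast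
  then obtain \<kappa> where \<kappa>: "\<And>l. Suc l \<le> \<kappa> l" "\<And>l. e \<le> ?m (\<kappa> l)" by metis
  obtain U where U: "ultrafilter U" "U \<le> sequentially"
    by (rule ultrafilter_exists[OF sequentially_bot])
  have inv: "measure_pmf.expectation (occupation (K {}) z0 (\<kappa> l)) (\<lambda>z. 1 * measure (K {} z) A)
      \<le> measure_pmf.expectation (occupation (K {}) z0 (\<kappa> l)) (\<lambda>z. 1 * indicator A z) + 1 / real (Suc l)" for l A
  proof -
    have "1 / real (\<kappa> l) \<le> 1 / real (Suc l)" using \<kappa>(1)[of l] by (intro divide_left_mono) auto
    moreover have "0 < \<kappa> l" using \<kappa>(1)[of l] by simp
    ultimately show ?thesis
      using occupation_almost_invariant_set[of "\<kappa> l" "\<lambda>_. 1" 0 z0 A] by simp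
  qed
  have eps: "(\<lambda>l. 1 / real (Suc l)) \<longlonglongrightarrow> 0" by real_asymp
  show False
  proof (rule limit_mixture[where g="\<lambda>_ _. 1", OF _ _ U eps inv])
  fix w
  assume w: "\<And>L. 0 \<le> w L" "\<And>L. w L > 0 \<Longrightarrow> ergodic_face P P' B B' L"
    and lim: "\<And>A A' R. (\<And>L z. \<forall>i\<in>L. R \<le> snd z i \<Longrightarrow> z \<in> A \<longleftrightarrow> face_proj L z \<in> A' L) \<Longrightarrow>
       ((\<lambda>l. measure_pmf.expectation (occupation (K {}) z0 (\<kappa> l)) (\<lambda>z. 1 * indicator A z))
          \<longlongrightarrow> (\<Sum>L\<in>UNIV. w L * measure (\<pi> L) (A' L))) U"
  let ?A' = "\<lambda>L. if L = {} then box M else {}"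
  have "(z \<in> box M) = (face_proj L z \<in> ?A' L)" if "\<forall>i\<in>L. Suc M \<le> snd z i" for L z
  proof (cases "L = {}")
    case False
    then obtain i where "i \<in> L" by blast
    then have "\<not> snd z i \<le> M" using that by fastforce
    with False show ?thesis by (auto simp: box_def)
  qed (simp add: face_proj_def)
  from lim[of "Suc M", OF this] have "((\<lambda>l. ?m (\<kappa> l)) \<longlongrightarrow> (\<Sum>L\<in>UNIV. w L * measure (\<pi> L) (?A' L))) U"
    by simp
  also have "(\<Sum>L\<in>UNIV. w L * measure (\<pi> L) (?A' L)) = (\<Sum>L\<in>UNIV. if L = {} then w L * measure (\<pi> L) (box M) else 0)"
    by (intro sum.cong refl) simp
  also have "\<dots> = w {} * measure (\<pi> {}) (box M)" by simp
  also have "w {} = 0" using w[of "{}"] not by fastforce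
  finally have "((\<lambda>l. ?m (\<kappa> l)) \<longlongrightarrow> 0) U" by simp
  then have "e \<le> 0"
    using U(1) \<kappa>(2) by (intro tendsto_lowerbound[of "\<lambda>l. ?m (\<kappa> l)" 0 U e]) (auto simp: ultrafilter_def)
  with e show False by simp
  qed simp_all
qed

text \<open>
  Suppose the chain is not ergodic, so that it leaves every bounded set. Put \<open>\<beta> l = 1 / (l + 1)\<close>, for
  which the smoothing error vanishes in the limit, and choose a horizon \<open>\<kappa> l \<ge> (l + 1)\<^sup>2\<close> up to which the
  time spent in \<open>box ((l + 1)\<^sup>2)\<close> is negligible. Weighting time by the softmax weight of queue \<open>i\<close> counts
  almost only times at which queue \<open>i\<close> is long, so it yields in the limit a mixture over faces containing
  \<open>i\<close>, along which the \<open>i\<close>-th form has negative drift. Hence the mean drift of the Lyapunov function is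
  negative in the limit, which is impossible as it is nonnegative and starts from a value \<open>o(\<kappa> l)\<close>.
\<close>

lemma ergodic_if_negative_drift_forms:
  assumes rho: "\<rho> < 1"
    and neg: "\<And>L i. ergodic_face P P' B B' L \<Longrightarrow> i \<in> L \<Longrightarrow> drift_form lam \<tau> \<tau>' i (v L) < 0"
  shows "ergodic_chain UNIV (K {})"
proof (rule ccontr)
  let ?E = "measure_pmf.expectation"
  assume "\<not> ergodic_chain UNIV (K {})"
  then have not: "\<not> ergodic_face P P' B B' {}" by (simp add: ergodic_face_empty)
  define z0 :: "'n \<times> ('n \<Rightarrow> nat)" where "z0 = (undefined, \<lambda>_. 0)"
  have load: "(\<Sum>i\<in>UNIV. lam i * \<tau> i) \<le> 1"
    by (rule load_le_1[OF rho neg]) (auto simp: ergodic_face_def)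
  have "\<forall>l. \<exists>k\<ge>(Suc l)\<^sup>2. measure (occupation (K {}) z0 k) (box ((Suc l)\<^sup>2)) < 1 / real (Suc l)"
  proof
    fix l
    have "\<forall>\<^sub>F k in sequentially. measure (occupation (K {}) z0 k) (box ((Suc l)\<^sup>2)) < 1 / real (Suc l)"
      by (rule order_tendstoD(2)[OF box_occupation_tendsto_0[OF not]]) simp
    then have "\<forall>\<^sub>F k in sequentially. (Suc l)\<^sup>2 \<le> k \<and> measure (occupation (K {}) z0 k) (box ((Suc l)\<^sup>2)) < 1 / real (Suc l)"
      by (intro eventually_conj eventually_ge_at_top)
    then obtain N where "\<forall>k\<ge>N. (Suc l)\<^sup>2 \<le> k \<and> measure (occupation (K {}) z0 k) (box ((Suc l)\<^sup>2)) < 1 / real (Suc l)"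
      unfolding eventually_sequentially by blast
    then show "\<exists>k\<ge>(Suc l)\<^sup>2. measure (occupation (K {}) z0 k) (box ((Suc l)\<^sup>2)) < 1 / real (Suc l)"
      by (intro exI[of _ N]) blast
  qed
  then obtain \<kappa> where \<kappa>: "\<And>l. (Suc l)\<^sup>2 \<le> \<kappa> l"
    "\<And>l. measure (occupation (K {}) z0 (\<kappa> l)) (box ((Suc l)\<^sup>2)) < 1 / real (Suc l)" by metis
  have \<kappa>_pos: "0 < \<kappa> l" for l using \<kappa>(1)[of l] by (metis zero_less_power zero_less_Suc less_le_trans)
  have \<kappa>_sq: "(real (Suc l))\<^sup>2 \<le> real (\<kappa> l)" for l using \<kappa>(1)[of l] by (metis of_nat_le_iff of_nat_power)
  define \<mu> where "\<mu> l = occupation (K {}) z0 (\<kappa> l)" for l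
  define \<beta> where "\<beta> l = 1 / real (Suc l)" for l
  have \<beta>_pos: "0 < \<beta> l" for l by (simp add: \<beta>_def)
  have \<beta>_lim: "\<beta> \<longlonglongrightarrow> 0" unfolding \<beta>_def by real_asymp
  have \<kappa>_inv: "1 / real (\<kappa> l) \<le> 1 / real (Suc l)" for l
  proof -
    have "Suc l \<le> (Suc l)\<^sup>2" by (simp add: power2_eq_square)
    then have "Suc l \<le> \<kappa> l" using \<kappa>(1)[of l] by (rule order_trans)
    then show ?thesis by (intro divide_left_mono) auto
  qed
  define \<theta> where "\<theta> i l z = softmax (\<beta> l) (scaled z) i" for i l z
  have \<theta>: "0 \<le> \<theta> i l z" "\<theta> i l z \<le> 1" for i l z
    by (simp_all add: \<theta>_def softmax_nonneg softmax_le_1)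
  obtain U where U: "ultrafilter U" "U \<le> sequentially"
    by (rule ultrafilter_exists[OF sequentially_bot])
  have Ubot: "U \<noteq> bot" using U by (simp add: ultrafilter_def)
  define eps where "eps l = (1 + 2 * worst_mean (\<lambda>r. r)) / real (Suc l)" for l
  have eps_lim: "eps \<longlonglongrightarrow> 0" unfolding eps_def by (rule LIMSEQ_Suc[OF lim_const_over_n])
  have inv: "?E (\<mu> l) (\<lambda>z. \<theta> i l z * measure (K {} z) A) \<le> ?E (\<mu> l) (\<lambda>z. \<theta> i l z * indicator A z) + eps l" for i l A
  proof -
    have "\<bar>\<theta> i l z' - \<theta> i l z\<bar> \<le> 2 * \<beta> l * jump z z'" for z z'
      unfolding \<theta>_def using \<beta>_pos[of l] by (intro softmax_lipschitz jump_component) auto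
    then have "?E (\<mu> l) (\<lambda>z. \<theta> i l z * measure (K {} z) A)
        \<le> ?E (\<mu> l) (\<lambda>z. \<theta> i l z * indicator A z) + (1 / real (\<kappa> l) + 2 * \<beta> l * worst_mean (\<lambda>r. r))"
      unfolding \<mu>_def using \<beta>_pos[of l] \<kappa>_pos \<theta> by (intro occupation_almost_invariant_set) auto
    also have "1 / real (\<kappa> l) + 2 * \<beta> l * worst_mean (\<lambda>r. r) \<le> eps l"
      using \<kappa>_inv[of l] by (simp add: eps_def \<beta>_def add_divide_distrib)
    finally show ?thesis by simp
  qed
  define mixture where "mixture i w \<longleftrightarrow> (\<forall>L. 0 \<le> w L) \<and> (\<forall>L. w L > 0 \<longrightarrow> ergodic_face P P' B B' L) \<and>
      (\<forall>A A' R. (\<forall>L z. (\<forall>i\<in>L. R \<le> snd z i) \<longrightarrow> (z \<in> A \<longleftrightarrow> face_proj L z \<in> A' L)) \<longrightarrow>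
        ((\<lambda>l. ?E (\<mu> l) (\<lambda>z. \<theta> i l z * indicator A z)) \<longlongrightarrow> (\<Sum>L\<in>UNIV. w L * measure (\<pi> L) (A' L))) U)" for i w
  have "\<exists>w. mixture i w" for i
    proof (rule limit_mixture[where g="\<theta> i" and \<mu>=\<mu>, OF \<theta> U eps_lim inv])
      fix w
      assume w: "\<And>L. 0 \<le> w L" "\<And>L. w L > 0 \<Longrightarrow> ergodic_face P P' B B' L"
        and l: "\<And>A A' R. (\<And>L z. \<forall>i\<in>L. R \<le> snd z i \<Longrightarrow> z \<in> A \<longleftrightarrow> face_proj L z \<in> A' L) \<Longrightarrow>
          ((\<lambda>l. ?E (\<mu> l) (\<lambda>z. \<theta> i l z * indicator A z)) \<longlongrightarrow> (\<Sum>L\<in>UNIV. w L * measure (\<pi> L) (A' L))) U"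
      show ?thesis unfolding mixture_def
      proof (intro exI[of _ w] conjI allI impI)
        show "0 \<le> w L" for L by (rule w(1))
        show "ergodic_face P P' B B' L" if "w L > 0" for L by (rule w(2)[OF that])
        fix A :: "('n \<times> ('n \<Rightarrow> nat)) set" and A' and R :: nat
        assume "\<forall>L z. (\<forall>i\<in>L. R \<le> snd z i) \<longrightarrow> (z \<in> A \<longleftrightarrow> face_proj L z \<in> A' L)"
        then show "((\<lambda>l. ?E (\<mu> l) (\<lambda>z. \<theta> i l z * indicator A z)) \<longlongrightarrow> (\<Sum>L\<in>UNIV. w L * measure (\<pi> L) (A' L))) U"
          by (intro l[of R]) blast
      qed
    qed
  then obtain w where mix: "\<And>i. mixture i (w i)" by metis
  have w0: "0 \<le> w i L" and w_erg: "w i L > 0 \<Longrightarrow> ergodic_face P P' B B' L" for i L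
    using mix[of i] unfolding mixture_def by blast+
  have lim0: "\<forall>L z. (\<forall>i\<in>L. R \<le> snd z i) \<longrightarrow> (z \<in> A \<longleftrightarrow> face_proj L z \<in> A' L) \<Longrightarrow>
        ((\<lambda>l. ?E (\<mu> l) (\<lambda>z. \<theta> i l z * indicator A z)) \<longlongrightarrow> (\<Sum>L\<in>UNIV. w i L * measure (\<pi> L) (A' L))) U" for i A A' R
    using mix[of i] unfolding mixture_def by blast
  note lim = lim0[OF allI, OF allI, OF impI]
  have total: "(\<Sum>i\<in>UNIV. \<Sum>L\<in>UNIV. w i L) = 1"
  proof (rule tendsto_unique[OF Ubot])
    have "((\<lambda>l. ?E (\<mu> l) (\<lambda>z. \<theta> i l z * indicator UNIV z)) \<longlongrightarrow> (\<Sum>L\<in>UNIV. w i L * measure (\<pi> L) UNIV)) U" for i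
      by (rule lim[of 0]) simp
    then have "((\<lambda>l. \<Sum>i\<in>UNIV. ?E (\<mu> l) (\<lambda>z. \<theta> i l z * indicator UNIV z))
        \<longlongrightarrow> (\<Sum>i\<in>UNIV. \<Sum>L\<in>UNIV. w i L * measure (\<pi> L) UNIV)) U"
      by (intro tendsto_sum)
    then show "((\<lambda>l. \<Sum>i\<in>UNIV. ?E (\<mu> l) (\<lambda>z. \<theta> i l z * indicator UNIV z)) \<longlongrightarrow> (\<Sum>i\<in>UNIV. \<Sum>L\<in>UNIV. w i L)) U"
      by simp
    have "(\<Sum>i\<in>UNIV. ?E (\<mu> l) (\<lambda>z. \<theta> i l z * indicator UNIV z)) = 1" for l
    proof -
      have "(\<Sum>i\<in>UNIV. ?E (\<mu> l) (\<lambda>z. \<theta> i l z * indicator UNIV z)) = ?E (\<mu> l) (\<lambda>z. \<Sum>i\<in>UNIV. \<theta> i l z)"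
        using \<theta> by (subst Bochner_Integration.integral_sum) (auto intro!: integrable_pmf_bounded[where c=1])
      then show ?thesis by (simp add: \<theta>_def sum_softmax)
    qed
    then show "((\<lambda>l. \<Sum>i\<in>UNIV. ?E (\<mu> l) (\<lambda>z. \<theta> i l z * indicator UNIV z)) \<longlongrightarrow> 1) U" by simp
  qed
  \<comment> \<open>Off \<open>box ((Suc l)\<^sup>2)\<close> some queue exceeds \<open>(Suc l)\<^sup>2\<close>, which makes the weight of a bounded queue tiny.\<close>
  have w_in: "i \<in> L" if "w i L > 0" for i L
  proof (rule ccontr)
    assume iL: "i \<notin> L"
    define lm where "lm = (\<Sum>j\<in>UNIV. lam j)"
    have lm_ge: "lam j \<le> lm" for j unfolding lm_def by (rule member_le_sum) (auto simp: nonneg)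
    have lm_pos: "0 < lm" using lam_pos[of i] lm_ge[of i] by simp
    obtain z1 where z1: "z1 \<in> set_pmf (\<pi> L)" using set_pmf_not_empty by fast
    define r where "r = Suc (snd z1 i)"
    let ?A = "{z :: 'n \<times> ('n \<Rightarrow> nat). snd z i < r}"
    let ?A' = "\<lambda>L. if i \<in> L then {} else ?A"
    have c: "(z \<in> ?A) = (face_proj L z \<in> ?A' L)" if "\<forall>i\<in>L. r \<le> snd z i" for L z
      using that by (auto simp: face_proj_def)
    have l1: "((\<lambda>l. ?E (\<mu> l) (\<lambda>z. \<theta> i l z * indicator ?A z)) \<longlongrightarrow> (\<Sum>L\<in>UNIV. w i L * measure (\<pi> L) (?A' L))) U"
      by (rule lim[of r]) (rule c)
    let ?t = "\<lambda>l. exp (real r / lam i * (1 / real (Suc l)) - real (Suc l) / lm)"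
    have pw: "\<theta> i l z * indicator ?A z \<le> indicator (box ((Suc l)\<^sup>2)) z + ?t l" for l z
    proof (cases "z \<in> ?A \<and> z \<notin> box ((Suc l)\<^sup>2)")
      case True
      then obtain j where j: "(Suc l)\<^sup>2 < snd z j" by (auto simp: box_def not_le)
      have "\<theta> i l z \<le> exp (\<beta> l * (scaled z i - scaled z j))" unfolding \<theta>_def by (rule softmax_le_exp)
      also have "\<beta> l * (scaled z i - scaled z j) \<le> \<beta> l * (real r / lam i - (real (Suc l))\<^sup>2 / lm)"
      proof -
        have "scaled z i \<le> real r / lam i"
          unfolding scaled_def using True lam_pos[of i] by (intro divide_right_mono) auto
        moreover have "(real (Suc l))\<^sup>2 / lm \<le> scaled z j"
        proof -
          have "(real (Suc l))\<^sup>2 \<le> real (snd z j)" using j by (metis less_imp_le of_nat_le_iff of_nat_power)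
          then show ?thesis
            unfolding scaled_def using lam_pos[of j] lm_ge[of j] by (intro frac_le) auto
        qed
        ultimately show ?thesis using \<beta>_pos[of l] by (intro mult_left_mono) auto
      qed
      also have "\<beta> l * (real r / lam i - (real (Suc l))\<^sup>2 / lm) = real r / lam i * (1 / real (Suc l)) - real (Suc l) / lm"
        by (simp add: \<beta>_def right_diff_distrib power2_eq_square del: of_nat_Suc)
      finally show ?thesis using True by (simp add: indicator_def)
    next
      case False
      then have "\<theta> i l z * indicator ?A z \<le> indicator (box ((Suc l)\<^sup>2)) z"
        using \<theta>[of i l z] by (auto simp: indicator_def)
      moreover have "0 \<le> ?t l" by (rule exp_ge_zero)
      ultimately show ?thesis by linarith
    qed
    have le: "?E (\<mu> l) (\<lambda>z. \<theta> i l z * indicator ?A z) \<le> 1 / real (Suc l) + ?t l" for l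
    proof -
      have "?E (\<mu> l) (\<lambda>z. \<theta> i l z * indicator ?A z) \<le> ?E (\<mu> l) (\<lambda>z. indicator (box ((Suc l)\<^sup>2)) z + ?t l)"
        using \<theta> by (intro integral_mono pw Bochner_Integration.integrable_add)
          (auto intro!: integrable_pmf_bounded[where c=1] simp: indicator_def)
      also have "\<dots> = measure (\<mu> l) (box ((Suc l)\<^sup>2)) + ?t l"
        by (subst Bochner_Integration.integral_add) (auto intro!: integrable_pmf_bounded[where c=1] simp: indicator_def)
      finally show ?thesis using \<kappa>(2)[of l] by (simp add: \<mu>_def)
    qed
    have "(\<lambda>l. 1 / real (Suc l) + ?t l) \<longlonglongrightarrow> 0" using lm_pos by real_asymp
    then have "((\<lambda>l. 1 / real (Suc l) + ?t l) \<longlongrightarrow> 0) U" using U(2) by (rule tendsto_mono[rotated])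
    from tendsto_le[OF Ubot this l1] le have "(\<Sum>L\<in>UNIV. w i L * measure (\<pi> L) (?A' L)) \<le> 0" by simp
    moreover have "w i L * measure (\<pi> L) (?A' L) \<le> (\<Sum>L\<in>UNIV. w i L * measure (\<pi> L) (?A' L))"
      by (rule member_le_sum) (auto simp: w0)
    moreover have "0 < w i L * measure (\<pi> L) (?A' L)"
      by (rule mult_pos_pos[OF that]) (use z1 iL in \<open>auto simp: r_def intro!: measure_pmf_posI[of z1]\<close>)
    ultimately show False by linarith
  qed
  let ?N = "real CARD('n)"
  let ?D = "\<lambda>i l. ?E (\<mu> l) (\<lambda>z. \<theta> i l z * scaled_drift_form i (fst z) (busy {} z))"
  have sdf_bd: "\<bar>scaled_drift_form i s u\<bar> \<le> (\<Sum>i\<in>UNIV. \<Sum>s\<in>UNIV. \<Sum>u\<in>UNIV. \<bar>scaled_drift_form i s u\<bar>)" (is "_ \<le> ?B") for i s u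
  proof -
    have "\<bar>scaled_drift_form i s u\<bar> \<le> (\<Sum>u\<in>UNIV. \<bar>scaled_drift_form i s u\<bar>)"
      by (rule member_le_sum[where f="\<lambda>u. \<bar>scaled_drift_form i s u\<bar>"]) auto
    also have "\<dots> \<le> (\<Sum>s\<in>UNIV. \<Sum>u\<in>UNIV. \<bar>scaled_drift_form i s u\<bar>)"
      by (rule member_le_sum[where f="\<lambda>s. \<Sum>u\<in>UNIV. \<bar>scaled_drift_form i s u\<bar>"]) (auto intro!: sum_nonneg)
    also have "\<dots> \<le> ?B"
      by (rule member_le_sum[where f="\<lambda>i. \<Sum>s\<in>UNIV. \<Sum>u\<in>UNIV. \<bar>scaled_drift_form i s u\<bar>"]) (auto intro!: sum_nonneg)
    finally show ?thesis .
  qed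
  have term_bd: "\<bar>\<theta> i l z * scaled_drift_form i (fst z) (busy {} z)\<bar> \<le> ?B" for i l z
  proof -
    have "\<bar>\<theta> i l z * scaled_drift_form i (fst z) (busy {} z)\<bar> \<le> 1 * ?B"
      unfolding abs_mult using \<theta>[of i l z] sdf_bd by (intro mult_mono) auto
    then show ?thesis by simp
  qed
  \<comment> \<open>The Lyapunov function starts from \<open>ln CARD('n) / \<beta> l\<close>, which is negligible against \<open>\<kappa> l\<close>.\<close>
  have lower: "- ln ?N / real (Suc l) - ?N * worst_mean (curvature (\<beta> l)) \<le> (\<Sum>i\<in>UNIV. ?D i l)" for l
  proof -
    let ?u = "\<lambda>z. (\<Sum>i\<in>UNIV. \<theta> i l z * scaled_drift_form i (fst z) (busy {} z)) + ?N * worst_mean (curvature (\<beta> l))"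
    have nn: "0 \<le> lyapunov (\<beta> l) z" for z by (rule lyapunov_nonneg[OF \<beta>_pos rho load])
    have ubd: "\<bar>?u z\<bar> \<le> ?N * ?B + \<bar>?N * worst_mean (curvature (\<beta> l))\<bar>" for z
    proof -
      have "\<bar>\<Sum>i\<in>UNIV. \<theta> i l z * scaled_drift_form i (fst z) (busy {} z)\<bar>
          \<le> (\<Sum>i\<in>(UNIV :: 'n set). ?B)"
        by (rule order_trans[OF sum_abs]) (intro sum_mono term_bd)
      also have "\<dots> = ?N * ?B" by simp
      finally show ?thesis by (intro order_trans[OF abs_triangle_ineq] add_right_mono)
    qed
    have "- lyapunov (\<beta> l) z0 / real (\<kappa> l) \<le> ?E (\<mu> l) ?u"
      unfolding \<mu>_def
      by (rule occupation_lyapunov[OF \<kappa>_pos nn lyapunov_step(1)[OF \<beta>_pos nn] _ ubd])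
         (unfold \<theta>_def, rule lyapunov_step(2)[OF \<beta>_pos nn])
    also have "?E (\<mu> l) ?u = (\<Sum>i\<in>UNIV. ?D i l) + ?N * worst_mean (curvature (\<beta> l))"
      by (subst Bochner_Integration.integral_add)
         (auto intro!: Bochner_Integration.integrable_sum integrable_pmf_bounded[OF term_bd]
            simp: Bochner_Integration.integral_sum[OF integrable_pmf_bounded[OF term_bd]])
    also have "lyapunov (\<beta> l) z0 = ln ?N * real (Suc l)"
      by (simp add: lyapunov_def smooth_max_def scaled_def common_def z0_def \<beta>_def)
    finally have 1: "- (ln ?N * real (Suc l)) / real (\<kappa> l) \<le> (\<Sum>i\<in>UNIV. ?D i l) + ?N * worst_mean (curvature (\<beta> l))" .
    have "ln ?N * real (Suc l) / real (\<kappa> l) \<le> ln ?N * real (Suc l) / (real (Suc l))\<^sup>2"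
      using \<kappa>_sq[of l] \<kappa>_pos[of l] by (intro divide_left_mono) (auto intro!: mult_nonneg_nonneg)
    also have "\<dots> = ln ?N / real (Suc l)" by (simp add: power2_eq_square del: of_nat_Suc)
    finally show ?thesis using 1 by simp
  qed
  have D_lim: "(?D i \<longlongrightarrow> (\<Sum>L\<in>UNIV. w i L * (drift_form lam \<tau> \<tau>' i (mean_drift L) / lam i))) U" for i
  proof -
    have "z \<in> found_at {} s u \<longleftrightarrow> face_proj L z \<in> found_at L s u" if "\<forall>i\<in>L. Suc 0 \<le> snd z i" for L z s u
    proof -
      have "busy {} z = busy L (face_proj L z)" using that by (force simp: busy_def face_proj_def)
      then show ?thesis by (simp add: found_at_def face_proj_def)
    qed
    then have "((\<lambda>l. ?E (\<mu> l) (\<lambda>z. \<theta> i l z * indicator (found_at {} s u) z)) \<longlongrightarrow> (\<Sum>L\<in>UNIV. w i L * occ L s u)) U" for s u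
      unfolding occ_def by (rule lim[of "Suc 0"])
    then have "((\<lambda>l. \<Sum>s\<in>UNIV. \<Sum>u\<in>UNIV. ?E (\<mu> l) (\<lambda>z. \<theta> i l z * indicator (found_at {} s u) z) * scaled_drift_form i s u)
        \<longlongrightarrow> (\<Sum>s\<in>UNIV. \<Sum>u\<in>UNIV. (\<Sum>L\<in>UNIV. w i L * occ L s u) * scaled_drift_form i s u)) U"
      by (intro tendsto_sum tendsto_mult_right)
    also have "(\<lambda>l. \<Sum>s\<in>UNIV. \<Sum>u\<in>UNIV. ?E (\<mu> l) (\<lambda>z. \<theta> i l z * indicator (found_at {} s u) z) * scaled_drift_form i s u) = ?D i"
      using \<theta> by (intro ext expectation_at[where c=1, symmetric]) auto
    also have "(\<Sum>s\<in>UNIV. \<Sum>u\<in>UNIV. (\<Sum>L\<in>UNIV. w i L * occ L s u) * scaled_drift_form i s u)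
        = (\<Sum>L\<in>UNIV. w i L * (\<Sum>s\<in>UNIV. \<Sum>u\<in>UNIV. occ L s u * scaled_drift_form i s u))"
    proof -
      have "(\<Sum>s\<in>UNIV. \<Sum>u\<in>UNIV. (\<Sum>L\<in>UNIV. w i L * occ L s u) * scaled_drift_form i s u)
          = (\<Sum>s\<in>UNIV. \<Sum>L\<in>UNIV. \<Sum>u\<in>UNIV. w i L * (occ L s u * scaled_drift_form i s u))"
        unfolding sum_distrib_right mult.assoc by (intro sum.cong refl sum.swap)
      also have "\<dots> = (\<Sum>L\<in>UNIV. \<Sum>s\<in>UNIV. \<Sum>u\<in>UNIV. w i L * (occ L s u * scaled_drift_form i s u))"
        by (rule sum.swap)
      finally show ?thesis by (simp only: sum_distrib_left)
    qed
    finally show ?thesis unfolding scaled_drift_form_mean .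
  qed
  have "((\<lambda>l. \<Sum>i\<in>UNIV. ?D i l) \<longlongrightarrow> (\<Sum>i\<in>UNIV. \<Sum>L\<in>UNIV. w i L * (drift_form lam \<tau> \<tau>' i (mean_drift L) / lam i))) U"
    by (intro tendsto_sum D_lim)
  moreover have "((\<lambda>l. - ln ?N / real (Suc l) - ?N * worst_mean (curvature (\<beta> l))) \<longlongrightarrow> 0) U"
  proof (rule tendsto_mono[OF U(2)])
    have "(\<lambda>l. - ln ?N / real (Suc l)) \<longlonglongrightarrow> 0" by (rule LIMSEQ_Suc[OF lim_const_over_n])
    moreover have "(\<lambda>l. worst_mean (curvature (\<beta> l))) \<longlonglongrightarrow> 0"
      by (rule worst_mean_curvature[OF \<beta>_lim less_imp_le[OF \<beta>_pos]])
    ultimately have "(\<lambda>l. - ln ?N / real (Suc l) - ?N * worst_mean (curvature (\<beta> l))) \<longlonglongrightarrow> 0 - ?N * 0"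
      by (intro tendsto_intros)
    then show "(\<lambda>l. - ln ?N / real (Suc l) - ?N * worst_mean (curvature (\<beta> l))) \<longlonglongrightarrow> 0" by simp
  qed
  ultimately have nonneg_total: "0 \<le> (\<Sum>i\<in>UNIV. \<Sum>L\<in>UNIV. w i L * (drift_form lam \<tau> \<tau>' i (mean_drift L) / lam i))"
    by (rule tendsto_le[OF Ubot]) (intro always_eventually allI lower)
  have t: "w i L * (drift_form lam \<tau> \<tau>' i (mean_drift L) / lam i) \<le> 0 \<and>
      (w i L > 0 \<longrightarrow> w i L * (drift_form lam \<tau> \<tau>' i (mean_drift L) / lam i) < 0)" for i L
  proof (cases "w i L > 0")
    case True
    have "v L = mean_drift L" by (rule ext) (rule second_vector_field_eq_mean_drift[OF w_erg[OF True]])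
    then have "drift_form lam \<tau> \<tau>' i (mean_drift L) < 0"
      using neg[OF w_erg[OF True] w_in[OF True]] by simp
    then have "drift_form lam \<tau> \<tau>' i (mean_drift L) / lam i < 0" using lam_pos by (rule divide_neg_pos)
    then have "w i L * (drift_form lam \<tau> \<tau>' i (mean_drift L) / lam i) < 0" using True by (rule mult_pos_neg[rotated])
    then show ?thesis by simp
  next
    case False
    then have "w i L = 0" using w0[of i L] by simp
    then show ?thesis by simp
  qed
  obtain i L where iL: "w i L > 0"
  proof (rule ccontr)
    assume "\<not> thesis"
    then have "w i L = 0" for i L using that w0[of i L] by (metis less_eq_real_def)
    then show False using total by simp
  qed
  have "(\<Sum>i\<in>UNIV. \<Sum>L\<in>UNIV. w i L * (drift_form lam \<tau> \<tau>' i (mean_drift L) / lam i)) < 0"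
  proof -
    let ?f = "\<lambda>i L. w i L * (drift_form lam \<tau> \<tau>' i (mean_drift L) / lam i)"
    have "(\<Sum>L\<in>UNIV. ?f i L) < (\<Sum>L\<in>(UNIV :: 'n set set). 0)"
      using t iL by (intro sum_strict_mono_ex1) auto
    then have "(\<Sum>i\<in>UNIV. \<Sum>L\<in>UNIV. ?f i L) < (\<Sum>i\<in>(UNIV :: 'n set). 0)"
      using t by (intro sum_strict_mono_ex1) (auto intro!: sum_nonpos)
    then show ?thesis by simp
  qed
  with nonneg_total show False by simp
qed

end

section \<open>Identical routing from busy and idle stations\<close>

lemma map_nsteps:
  assumes "\<And>z. map_pmf f (K z) = Q (f z)"
  shows "map_pmf f (nsteps K n z) = nsteps Q n (f z)"
proof (induction n arbitrary: z)
  case (Suc n)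
  have "map_pmf f (nsteps K (Suc n) z) = bind_pmf (K z) (\<lambda>y. nsteps Q n (f y))"
    by (simp add: map_bind_pmf Suc)
  also have "\<dots> = bind_pmf (map_pmf f (K z)) (nsteps Q n)" by (simp add: bind_map_pmf)
  finally show ?case by (simp add: assms)
qed simp

lemma map_invariant:
  assumes "\<And>z. map_pmf f (K z) = Q (f z)" "bind_pmf \<nu> K = \<nu>"
  shows "bind_pmf (map_pmf f \<nu>) Q = map_pmf f \<nu>"
proof -
  have "bind_pmf (map_pmf f \<nu>) Q = map_pmf f (bind_pmf \<nu> K)"
    by (simp add: bind_map_pmf map_bind_pmf assms(1))
  with assms(2) show ?thesis by simp
qed

text \<open>
  The argument for uniqueness of a stationary distribution, applied to a signed invariant vector: the
  set where it is positive is closed.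
\<close>

lemma invariant_vector_is_pmf:
  fixes F :: "'n::finite \<Rightarrow> real"
  assumes irr: "irreducible_chain UNIV P" and sum: "(\<Sum>j\<in>UNIV. F j) = 1"
    and F: "\<And>j. F j = (\<Sum>i\<in>UNIV. pmf (P i) j * F i)"
  obtains \<mu> where "bind_pmf \<mu> P = \<mu>" "\<And>j. pmf \<mu> j = F j" "\<And>j. F j > 0"
proof -
  define A where "A = {j. F j > 0}"
  have "(\<Sum>i\<in>UNIV. F i * (indicator A i - measure (P i) A)) = 0"
  proof -
    have "(\<Sum>i\<in>UNIV. F i * measure (P i) A) = (\<Sum>i\<in>UNIV. \<Sum>j\<in>A. pmf (P i) j * F i)"
      by (simp add: measure_measure_pmf_finite sum_distrib_left mult.commute)
    also have "\<dots> = (\<Sum>j\<in>A. \<Sum>i\<in>UNIV. pmf (P i) j * F i)" by (rule sum.swap)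
    also have "\<dots> = (\<Sum>j\<in>A. F j)" by (simp add: F[symmetric])
    also have "\<dots> = (\<Sum>i\<in>UNIV. F i * indicator A i)"
      by (simp add: indicator_def if_distrib sum.If_cases cong: if_cong)
    finally show ?thesis by (simp add: right_diff_distrib sum_subtractf)
  qed
  moreover have nn: "0 \<le> F i * (indicator A i - measure (P i) A)" for i
  proof (cases "i \<in> A")
    case True
    then show ?thesis by (auto simp: A_def)
  next
    case False
    then show ?thesis by (auto simp: A_def mult_nonpos_nonneg not_less)
  qed
  ultimately have zero: "F i * (indicator A i - measure (P i) A) = 0" for i
    by (simp add: sum_nonneg_eq_0_iff)
  have closed: "set_pmf (P i) \<subseteq> A" if "i \<in> A" for i
  proof -
    have "measure (P i) A = 1" using zero[of i] that by (simp add: A_def)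
    then have "AE y in P i. y \<in> A" by (subst (asm) measure_pmf.prob_eq_1) auto
    then show ?thesis by (auto simp: AE_measure_pmf_iff)
  qed
  have "\<exists>j. j \<in> A"
  proof (rule ccontr)
    assume "\<nexists>j. j \<in> A"
    then have "(\<Sum>j\<in>UNIV. F j) \<le> 0" by (intro sum_nonpos) (auto simp: A_def not_less)
    with sum show False by simp
  qed
  then obtain j where "j \<in> A" by blast
  from irreducible_closed[OF irr closed this] have pos: "F j > 0" for j by (auto simp: A_def)
  define \<mu> where "\<mu> = embed_pmf F"
  have \<mu>: "pmf \<mu> j = F j" for j
    unfolding \<mu>_def
  proof (rule pmf_embed_pmf)
    show "0 \<le> F j" for j using pos[of j] by simp
    have "(\<integral>\<^sup>+j. ennreal (F j) \<partial>count_space UNIV) = (\<Sum>j\<in>UNIV. ennreal (F j))"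
      by (rule nn_integral_count_space_finite) simp
    also have "\<dots> = ennreal (\<Sum>j\<in>UNIV. F j)" using pos by (intro sum_ennreal) (simp add: less_imp_le)
    finally show "(\<integral>\<^sup>+j. ennreal (F j) \<partial>count_space UNIV) = 1" by (simp add: sum)
  qed
  have "pmf (bind_pmf \<mu> P) j = pmf \<mu> j" for j
    unfolding pmf_bind by (subst integral_measure_pmf[where A=UNIV]) (auto simp: \<mu> F[of j] mult.commute)
  then have "bind_pmf \<mu> P = \<mu>" by (rule pmf_eqI)
  with \<mu> pos that show thesis by blast
qed

context polling
begin

lemma server_marginal:
  assumes "P = P' \<or> L = UNIV"
  shows "map_pmf fst (K L z) = P (fst z)"
proof -
  have "route (busy L z) (fst z) = P (fst z)" using assms by (auto simp: route_def busy_def)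
  then show ?thesis unfolding K_eq map_bind_pmf pmf.map_comp
    by (simp add: o_def map_pmf_const bind_return_pmf')
qed

lemma P_irreducible: "irreducible_chain UNIV P"
  unfolding irreducible_chain_def
proof (intro ballI)
  fix x y :: 'n
  have "(x, \<lambda>_. 0) \<in> face_states UNIV" "(y, \<lambda>_. 0) \<in> face_states UNIV" by (auto simp: face_states_def)
  with irreducible[of UNIV] obtain n where "pmf (nsteps (K UNIV) n (x, \<lambda>_. 0)) (y, \<lambda>_. 0) > 0"
    unfolding irreducible_chain_def by blast
  then have "(y, \<lambda>_. 0) \<in> set_pmf (nsteps (K UNIV) n (x, \<lambda>_. 0))" by (simp add: set_pmf_iff)
  then have "y \<in> set_pmf (map_pmf fst (nsteps (K UNIV) n (x, \<lambda>_. 0)))" by force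
  also have "map_pmf fst (nsteps (K UNIV) n (x, \<lambda>_. 0)) = nsteps P n x"
    using map_nsteps[of fst "K UNIV" P n "(x, \<lambda>_. 0)"] server_marginal by simp
  finally show "\<exists>n. pmf (nsteps P n x) y > 0" by (auto simp: pmf_positive_iff)
qed

text \<open>
  The position of the server moves by \<open>P\<close> alone, so it has the same stationary law on all ergodic faces.
\<close>

lemma server_eq_invariant_vector:
  assumes eq: "P = P'" and sum: "(\<Sum>j\<in>UNIV. F j) = 1" and F: "\<And>j. F j = (\<Sum>i\<in>UNIV. pmf (P i) j * F i)"
    and face: "ergodic_face P P' B B' L"
  shows "server L s = F s"
proof -
  obtain \<mu> where \<mu>: "bind_pmf \<mu> P = \<mu>" "\<And>j. pmf \<mu> j = F j"
    by (rule invariant_vector_is_pmf[OF P_irreducible sum F]) blast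
  have inv: "bind_pmf (\<pi> L) (K L) = \<pi> L"
  proof (cases "L = UNIV")
    case True
    let ?e = "\<lambda>s :: 'n. (s, \<lambda>_ :: 'n. 0 :: nat)"
    let ?\<nu> = "map_pmf ?e \<mu>"
    have nq: "next_queues UNIV z b = (\<lambda>_ :: 'n. 0)" for z b by (rule ext) (simp add: next_queues_def)
    have "K UNIV (?e s) = map_pmf ?e (P s)" for s
      unfolding K_eq by (simp add: route_def busy_def map_pmf_def nq)
    then have inv: "bind_pmf ?\<nu> (K UNIV) = ?\<nu>"
      by (simp add: bind_map_pmf map_bind_pmf[symmetric] \<mu>(1))
    have "set_pmf ?\<nu> \<subseteq> face_states UNIV" by (auto simp: face_states_def)
    then have "\<pi> UNIV = ?\<nu>" unfolding face_pmf_def by (rule stationary_pmf_eq[OF irreducible _ inv])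
    with True inv show ?thesis by simp
  next
    case False
    then show ?thesis using face face_pmf_invariant(2) by (auto simp: ergodic_face_def)
  qed
  have "map_pmf fst (\<pi> L) = \<mu>"
  proof (rule invariant_pmf_unique[OF P_irreducible])
    show "bind_pmf (map_pmf fst (\<pi> L)) P = map_pmf fst (\<pi> L)"
      by (rule map_invariant[OF server_marginal inv]) (rule disjI1, rule eq)
  qed (use \<mu> in auto)
  then show ?thesis by (simp add: server_prob_def \<mu>(2))
qed

text \<open>
  In the stationary regime of the whole chain every queue is balanced. This identifies the number that is
  multiplied by \<open>lam i\<close> with the mean time between polling instants, and the product with the probability
  of finding the server at station \<open>i\<close> and the station nonempty. The server is also found there with
  positive probability when the station is empty, so the inequality is strict.
\<close>

lemma ergodic_imp_conditions:
  assumes eq: "P = P'" and sum: "(\<Sum>j\<in>UNIV. F j) = 1" and F: "\<And>j. F j = (\<Sum>i\<in>UNIV. pmf (P i) j * F i)"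
    and erg: "ergodic_chain UNIV (K {})"
  shows "\<rho> < 1" "lam i * (1 / (1 - \<rho>) * (\<Sum>j\<in>UNIV. F j * \<tau>' j)) < F i"
proof -
  let ?S = "\<Sum>j\<in>UNIV. F j * \<tau>' j"
  have face: "ergodic_face P P' B B' {}" using erg by (simp add: ergodic_face_empty)
  note server = server_eq_invariant_vector[OF eq sum F face]
  have balance: "lam q * mean_time {} = occ {} q True" for q
    using mean_drift_unsaturated[OF face, of q] by (simp add: mean_drift_eq)
  have "0 < occ {} q False" for q
  proof -
    have "ergodic_chain (face_states {}) (K {})" using erg by (simp add: face_states_empty)
    note inv = face_pmf_invariant[OF this]
    have "0 < pmf (\<pi> {}) (q, \<lambda>_. 0)"
      by (rule invariant_pmf_positive[OF irreducible inv]) (simp add: face_states_empty)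
    then show ?thesis unfolding occ_def
      by (intro measure_pmf_posI[of "(q, \<lambda>_. 0)"]) (auto simp: set_pmf_iff found_at_def busy_def)
  qed
  then have less: "occ {} q True < F q" for q
    unfolding server[of q, symmetric] server_eq_occ by simp
  have occ0: "0 \<le> occ {} q True" for q by (simp add: occ_def)
  then have Fpos: "0 < F q" for q using less[of q] by (rule le_less_trans)
  have T0: "0 \<le> mean_time {}"
    using balance[of undefined] occ0[of undefined] lam_pos[of undefined] by (simp add: zero_le_mult_iff flip: balance)
  obtain s where s: "\<tau>' s > 0" using ex_idle_time_pos by blast
  have "F s * \<tau>' s \<le> ?S"
    by (rule member_le_sum) (auto simp: nonneg less_imp_le[OF Fpos])
  moreover have "0 < F s * \<tau>' s" using s Fpos by simp
  ultimately have S: "0 < ?S" by linarith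
  have "?S = (1 - \<rho>) * mean_time {}"
    using weighted_mean_drift[of "{}"] mean_drift_unsaturated[OF face] by (simp add: server)
  with S T0 show rho: "\<rho> < 1" by (auto simp: zero_less_mult_iff)
  have "1 / (1 - \<rho>) * ?S = mean_time {}"
    using \<open>?S = (1 - \<rho>) * mean_time {}\<close> rho by simp
  then show "lam i * (1 / (1 - \<rho>) * ?S) < F i"
    using balance[of i] less[of i] by simp
qed

end

section \<open>The ergodicity theorem\<close>

theorem theorem4p2:
  fixes P P' :: "'n::finite \<Rightarrow> 'n pmf"
    and B B' :: "'n \<Rightarrow> 'n \<Rightarrow> ('n \<Rightarrow> nat) pmf"
    and lam \<tau> \<tau>' F :: "'n \<Rightarrow> real"
    and taubar :: real
  assumes finite_mean: "\<And>i j q. integrable (measure_pmf (B i j)) (\<lambda>b. real (b q))"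
    and finite_mean': "\<And>i j q. integrable (measure_pmf (B' i j)) (\<lambda>b. real (b q))"
    and nonneg: "\<And>i. 0 \<le> lam i" "\<And>i. 0 \<le> \<tau> i" "\<And>i. 0 \<le> \<tau>' i"
    and mean: "\<And>i q. (\<Sum>j\<in>UNIV. pmf (P i) j * measure_pmf.expectation (B i j) (\<lambda>b. real (b q)))
                 = lam q * \<tau> i"
    and mean': "\<And>i q. (\<Sum>j\<in>UNIV. pmf (P' i) j * measure_pmf.expectation (B' i j) (\<lambda>b. real (b q)))
                 = lam q * \<tau>' i"
    and irreducible: "\<And>L. irreducible_chain (face_states L) (induced_kernel P P' B B' L)"
    and aperiodic: "\<And>L. aperiodic_chain (face_states L) (induced_kernel P P' B B' L)"
    and nonzero_drift: "\<And>L i. ergodic_face P P' B B' L \<Longrightarrow> i \<in> L \<Longrightarrow>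
                 second_vector_field P P' B B' lam \<tau> \<tau>' L i \<noteq> 0"
    and F_sum: "(\<Sum>j\<in>UNIV. F j) = 1"
    and F_eq: "\<And>j. F j = (\<Sum>i\<in>UNIV. pmf (P' i) j * F i)
                 + taubar * (\<Sum>i\<in>UNIV. lam i * (pmf (P i) j - pmf (P' i) j))"
    and taubar_eq: "taubar = 1 / (1 - rho_hat lam \<tau> \<tau>') * (\<Sum>j\<in>UNIV. F j * \<tau>' j)"
  shows "(rho_hat lam \<tau> \<tau>' < 1 \<longrightarrow>
            (\<forall>L. ergodic_face P P' B B' L \<longrightarrow>
              (\<forall>i\<in>L. drift_form lam \<tau> \<tau>' i (second_vector_field P P' B B' lam \<tau> \<tau>' L)
                 = lam i * (\<Sum>j\<in>UNIV. server_prob P P' B B' L j * \<tau>' j) / (1 - rho_hat lam \<tau> \<tau>')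
                   - server_prob P P' B B' L i)))
       \<and> (rho_hat lam \<tau> \<tau>' < 1 \<and> (\<forall>i. lam i * taubar < F i) \<and>
            (\<forall>L. ergodic_face P P' B B' L \<longrightarrow>
              (\<forall>i\<in>L. drift_form lam \<tau> \<tau>' i (second_vector_field P P' B B' lam \<tau> \<tau>' L) < 0))
            \<longrightarrow> ergodic_chain UNIV (polling_kernel P P' B B'))
       \<and> (P = P' \<longrightarrow>
            (ergodic_chain UNIV (polling_kernel P P' B B') \<longleftrightarrow>
               rho_hat lam \<tau> \<tau>' < 1 \<and> (\<forall>i. lam i * taubar < F i)))"
proof -
  interpret polling P P' B B' lam \<tau> \<tau>'
    by (unfold_locales; fact)
  have kernel: "polling_kernel P P' B B' = K {}" by (rule induced_kernel_empty[symmetric])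
  show ?thesis
    unfolding kernel
  proof (intro conjI impI allI ballI)
    fix L i assume "\<rho> < 1" "ergodic_face P P' B B' L" "i \<in> L"
    then show "drift_form lam \<tau> \<tau>' i (v L)
        = lam i * (\<Sum>j\<in>UNIV. server L j * \<tau>' j) / (1 - \<rho>) - server L i"
      by (rule drift_form_second_vector_field)
  next
    assume "\<rho> < 1 \<and> (\<forall>i. lam i * taubar < F i) \<and>
      (\<forall>L. ergodic_face P P' B B' L \<longrightarrow> (\<forall>i\<in>L. drift_form lam \<tau> \<tau>' i (v L) < 0))"
    then show "ergodic_chain UNIV (K {})"
      by (intro ergodic_if_negative_drift_forms) blast+
  next
    assume eq: "P = P'"
    have F: "F j = (\<Sum>i\<in>UNIV. pmf (P i) j * F i)" for j
      using F_eq[of j] by (simp add: eq)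
    show "ergodic_chain UNIV (K {}) \<longleftrightarrow> \<rho> < 1 \<and> (\<forall>i. lam i * taubar < F i)"
    proof
      assume "ergodic_chain UNIV (K {})"
      from ergodic_imp_conditions[OF eq F_sum F this]
      show "\<rho> < 1 \<and> (\<forall>i. lam i * taubar < F i)" by (simp only: taubar_eq) blast
    next
      assume c: "\<rho> < 1 \<and> (\<forall>i. lam i * taubar < F i)"
      then have rho: "\<rho> < 1" ..
      show "ergodic_chain UNIV (K {})"
      proof (rule ergodic_if_negative_drift_forms[OF rho])
        fix L i assume L: "ergodic_face P P' B B' L" "i \<in> L"
        have "drift_form lam \<tau> \<tau>' i (v L) = lam i * taubar - F i"
          unfolding drift_form_second_vector_field[OF rho L] server_eq_invariant_vector[OF eq F_sum F L(1)]
          by (simp add: taubar_eq)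
        with c show "drift_form lam \<tau> \<tau>' i (v L) < 0" by simp
      qed
    qed
  qed
qed

end
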